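(* Let $v\in V\setminus\{0\}$ satisfy Property (R): every element $[w]\in Lim(v)$ has a reductive stabilizer group in $G_\Lambda$, and $G_\Lambda.[w]=K_\Lambda.[w]$. Then $Lim(v)=K_\Lambda.[v_\infty]$ for a unique element $[v_\infty]\in\mathbb{P}(V)$. Moreover, there is an algebraic one-parameter subgroup $\phi:\mathbb{C}^*\to G_\Lambda$ that degenerates $[\bar v]$ to $[v_\infty]$, i.e. $\lim_{t\to0}\phi(t).[\bar v]=[v_\infty]$.
   Context: Let $E$ be a finite-dimensional Hermitian vector space, $K=U(E)$, $G=GL(E)$. Let $A_0=\mathrm{Id},A_1,A_2,\dots$ be a sequence in $G$ and $B_i=A_iA_{i-1}^{-1}$. Let $\Lambda\in\sqrt{-1}\,Lie(K)$ and assume condition $( * )$: for every subsequence $\{\alpha\}\subset\{i\}$, after passing to a further subsequence, $B_{\alpha+1}$ and $B_{\alpha+2}$ both converge to a common limit $ge^{\Lambda}g^{-1}$ for some $g\in K$. Put $K_\Lambda=\{h\in K: h\Lambda h^{-1}=\Lambda\}$ and $G_\Lambda=\{h\in G: h\Lambda h^{-1}=\Lambda\}$. Condition $( * )$ is equivalent to the existence of a sequence $g_i\in K$ with $g_0=\mathrm{Id}$ and $\lim_{i\to\infty}B_ig_ie^{-\Lambda}g_i^{-1}=\lim_{i\to\infty}g_{i-1}^{-1}g_i=\mathrm{Id}$; fix such a sequence. Let $V$ be a complex representation of $G$, with a $K$-invariant Hermitian metric. For $v\in V\setminus\{0\}$ the limit $d(v)=\lim_{i\to\infty}i^{-1}\log|A_i.v|$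 exists and is an eigenvalue of $\Lambda$ on $V$; set $d(0)=-\infty$. $Lim(v)\subset\mathbb{P}(V)$ denotes the union of the $K_\Lambda$-orbits of all possible subsequential limits of $[g_i^{-1}A_i.v]$; it is independent of the choice of the $g_i$. The same definitions apply to any representation, in particular to $E$ and $\bigwedge^pE$; for a $p$-dimensional subspace $W\subset E$, $Lim(W)$ is defined by regarding $W$ as a point $[W]\in\mathbb{P}(\bigwedge^pE)$ via the Plücker embedding. Let $\lambda_1>\dots>\lambda_r$ be the eigenvalues of $\Lambda$ on $E$, with eigenspaces $U_s$, and let $V_s=\{u\in E: d(u)\le\lambda_s\}$, $V_{r+1}=\{0\}$. Fix subspaces $W_s\subset E$ with $V_s=W_s\oplus V_{s+1}$ and $Lim(W_s)=[U_s]$ for all $s$ (these exist), let $\xi\in\mathrm{End}(E)$ act on $W_s$ by multiplication by $\lambda_s$, let $\lambda(t)=\exp(t\xi)$ for $t\in\mathbb{R}$, and fix $C_0\in G$ with $C_0W_s=U_s$ for all $s$, so that $\lambda(t)=C_0^{-1}e^{t\Lambda}C_0$. For $[v]\in\mathbb{P}(V)$ define $[\bar v]=\lim_{t\to\infty}C_0\lambda(t).[v]\in\mathbb{P}(V)$; it is fixed by $\Lambda$, and its $G_\Lambda$-orbit is uniquely determined by the sequence $\{A_i\}$ and $[v]$. *)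

theory Defs
  imports "HOL-Analysis.Analysis" "HOL-Computational_Algebra.Polynomial"
begin

text \<open>
  A Hermitian vector space of dimension n is written in an orthonormal basis, as
  \<open>complex^'n\<close> with its Euclidean norm; linear maps are matrices.
\<close>

section \<open>Matrix groups\<close>

definition adj :: "complex^'n^'m \<Rightarrow> complex^'m^'n" where
  "adj M = (\<chi> i j. cnj (M $ j $ i))"

definition GLC :: "(complex^'n^'n) set" where
  "GLC = {M. invertible M}"

definition unitary_group :: "(complex^'n^'n) set" where
  "unitary_group = {M. adj M ** M = mat 1 \<and> M ** adj M = mat 1}"

text \<open>\<open>Lie(U(n))\<close> consists of the skew-Hermitian matrices, so \<open>\<surd>-1 Lie(U(n))\<close> is the set of
  Hermitian ones.\<close>

definition hermitian :: "complex^'n^'n \<Rightarrow> bool" where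
  "hermitian M \<longleftrightarrow> adj M = M"

text \<open>The type \<open>complex^'n^'n\<close> multiplies componentwise with \<open>*\<close>, so that neither the
  library's \<open>^\<close> nor its \<open>exp\<close> is the one for matrices.\<close>

definition mpow :: "complex^'n^'n \<Rightarrow> nat \<Rightarrow> complex^'n^'n" where
  "mpow M k = ((\<lambda>X. M ** X) ^^ k) (mat 1)"

definition mexp :: "complex^'n^'n \<Rightarrow> complex^'n^'n" where
  "mexp M = (\<Sum>k. (1 / fact k) *\<^sub>R mpow M k)"

definition K_cent :: "complex^'n^'n \<Rightarrow> (complex^'n^'n) set" where
  "K_cent \<Lambda> = {h \<in> unitary_group. h ** \<Lambda> ** matrix_inv h = \<Lambda>}"

definition G_cent :: "complex^'n^'n \<Rightarrow> (complex^'n^'n) set" where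
  "G_cent \<Lambda> = {h \<in> GLC. h ** \<Lambda> ** matrix_inv h = \<Lambda>}"


section \<open>Linear algebraic groups\<close>

inductive_set poly_fun :: "(complex^'n^'n \<Rightarrow> complex) set" where
  const: "(\<lambda>_. c) \<in> poly_fun"
| entry: "(\<lambda>M. M $ i $ j) \<in> poly_fun"
| add: "p \<in> poly_fun \<Longrightarrow> q \<in> poly_fun \<Longrightarrow> (\<lambda>M. p M + q M) \<in> poly_fun"
| mult: "p \<in> poly_fun \<Longrightarrow> q \<in> poly_fun \<Longrightarrow> (\<lambda>M. p M * q M) \<in> poly_fun"

definition algebraic_subgroup :: "(complex^'n^'n) set \<Rightarrow> bool" where
  "algebraic_subgroup H \<longleftrightarrow>
     mat 1 \<in> H \<and> (\<forall>a\<in>H. \<forall>b\<in>H. a ** b \<in> H) \<and> (\<forall>a\<in>H. matrix_inv a \<in> H) \<and>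
     (\<exists>F \<subseteq> poly_fun. H = {M \<in> GLC. \<forall>f\<in>F. f M = 0})"

definition unipotent :: "complex^'n^'n \<Rightarrow> bool" where
  "unipotent M \<longleftrightarrow> (\<exists>k. mpow (M - mat 1) k = 0)"

text \<open>Trivial unipotent radical: no nontrivial connected closed normal unipotent subgroup.
  Over \<open>\<complex>\<close> a Zariski-closed subgroup is Zariski-connected iff it is connected in the
  Euclidean topology, which is what \<open>connected\<close> refers to.\<close>

definition reductive :: "(complex^'n^'n) set \<Rightarrow> bool" where
  "reductive H \<longleftrightarrow> algebraic_subgroup H \<and>
     (\<forall>N. algebraic_subgroup N \<and> connected N \<and> N \<subseteq> H \<and>
          (\<forall>h\<in>H. \<forall>n\<in>N. h ** n ** matrix_inv h \<in> N) \<and> (\<forall>n\<in>N. unipotent n)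
          \<longrightarrow> N = {mat 1})"

text \<open>The entries of an algebraic one-parameter subgroup are regular functions on
  \<open>\<complex> - {0}\<close>, i.e. Laurent polynomials.\<close>

definition algebraic_1ps :: "(complex \<Rightarrow> complex^'n^'n) \<Rightarrow> (complex^'n^'n) set \<Rightarrow> bool" where
  "algebraic_1ps \<phi> H \<longleftrightarrow>
     (\<forall>z. z \<noteq> 0 \<longrightarrow> \<phi> z \<in> H) \<and>
     (\<forall>z w. z \<noteq> 0 \<longrightarrow> w \<noteq> 0 \<longrightarrow> \<phi> (z * w) = \<phi> z ** \<phi> w) \<and>
     (\<forall>i j. \<exists>p k. \<forall>z. z \<noteq> 0 \<longrightarrow> \<phi> z $ i $ j = poly p z / z ^ k)"


section \<open>Representations\<close>

text \<open>A complex representation of the complex Lie group \<open>GL(n,\<complex>)\<close> on \<open>\<complex>\<^sup>m\<close>: a holomorphic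
  homomorphism, i.e. the Frechet derivative exists and is complex linear (\<open>mat c ** X\<close> is the
  scalar multiple \<open>c X\<close>). Values outside \<open>GL(n,\<complex>)\<close> are irrelevant.\<close>

definition complex_rep :: "(complex^'n^'n \<Rightarrow> complex^'m^'m) \<Rightarrow> bool" where
  "complex_rep \<rho> \<longleftrightarrow>
     (\<forall>M\<in>GLC. \<rho> M \<in> GLC) \<and>
     (\<forall>M\<in>GLC. \<forall>N\<in>GLC. \<rho> (M ** N) = \<rho> M ** \<rho> N) \<and>
     (\<forall>M\<in>GLC. \<exists>D. (\<rho> has_derivative D) (at M) \<and> (\<forall>c X. D (mat c ** X) = mat c ** D X))"

text \<open>\<open>d(v)\<close>, with \<open>d(0) = -\<infinity>\<close>.\<close>

definition growth ::
  "(complex^'n^'n \<Rightarrow> complex^'m^'m) \<Rightarrow> (nat \<Rightarrow> complex^'n^'n) \<Rightarrow> complex^'m \<Rightarrow> ereal" where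
  "growth \<rho> A v = (if v = 0 then -\<infinity>
     else lim (\<lambda>i. ereal (ln (norm (\<rho> (A i) *v v)) / real i)))"


section \<open>Projective space\<close>

text \<open>The point \<open>[v]\<close> is the line \<open>vec.span {v}\<close>; the topology is the quotient topology.\<close>

definition proj_space :: "(complex^'m) set set" where
  "proj_space = {vec.span {v} | v. v \<noteq> 0}"

definition proj_top :: "(complex^'m) set topology" where
  "proj_top = topology (\<lambda>U. U \<subseteq> proj_space \<and> open {v. v \<noteq> 0 \<and> vec.span {v} \<in> U})"

lemma openin_proj_top:
  "openin proj_top U \<longleftrightarrow> U \<subseteq> proj_space \<and> open {v. v \<noteq> 0 \<and> vec.span {v} \<in> U}"
proof -
  have "istopology (\<lambda>U :: (complex^'m) set set. U \<subseteq> proj_space \<and>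
          open {v. v \<noteq> 0 \<and> vec.span {v} \<in> U})"
    unfolding istopology_def
  proof (intro conjI allI impI)
    fix S T :: "(complex^'m) set set"
    assume S: "S \<subseteq> proj_space \<and> open {v. v \<noteq> 0 \<and> vec.span {v} \<in> S}"
      and T: "T \<subseteq> proj_space \<and> open {v. v \<noteq> 0 \<and> vec.span {v} \<in> T}"
    have "{v. v \<noteq> 0 \<and> vec.span {v} \<in> S \<inter> T} =
          {v. v \<noteq> 0 \<and> vec.span {v} \<in> S} \<inter> {v. v \<noteq> 0 \<and> vec.span {v} \<in> T}" by auto
    then show "open {v. v \<noteq> 0 \<and> vec.span {v} \<in> S \<inter> T}" using S T by auto
    show "S \<inter> T \<subseteq> proj_space" using S by auto
  next
    fix \<K> :: "(complex^'m) set set set"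
    assume K: "\<forall>S\<in>\<K>. S \<subseteq> proj_space \<and> open {v. v \<noteq> 0 \<and> vec.span {v} \<in> S}"
    have "{v. v \<noteq> 0 \<and> vec.span {v} \<in> \<Union>\<K>} =
          (\<Union>S\<in>\<K>. {v. v \<noteq> 0 \<and> vec.span {v} \<in> S})" by auto
    then show "open {v. v \<noteq> 0 \<and> vec.span {v} \<in> \<Union>\<K>}" using K by auto
    show "\<Union>\<K> \<subseteq> proj_space" using K by auto
  qed
  then show ?thesis
    unfolding proj_top_def by (subst topology_inverse') (assumption, rule refl)
qed

lemma topspace_proj_top: "topspace (proj_top :: (complex^'m) set topology) = proj_space"
proof -
  have "{v :: complex^'m. v \<noteq> 0 \<and> vec.span {v} \<in> proj_space} = - {0}"
    by (auto simp: proj_space_def)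
  then have "openin proj_top (proj_space :: (complex^'m) set set)"
    by (simp add: openin_proj_top open_Compl)
  then show ?thesis
    by (meson openin_proj_top openin_subset openin_topspace subset_antisym)
qed

definition proj_lim :: "('a \<Rightarrow> (complex^'m) set) \<Rightarrow> 'a filter \<Rightarrow> (complex^'m) set" where
  "proj_lim f F = (THE L. limitin proj_top f L F)"

definition act :: "complex^'m^'m \<Rightarrow> (complex^'m) set \<Rightarrow> (complex^'m) set" where
  "act M L = (\<lambda>x. M *v x) ` L"

definition proj_orbit ::
  "(complex^'n^'n \<Rightarrow> complex^'m^'m) \<Rightarrow> (complex^'n^'n) set \<Rightarrow> (complex^'m) set
    \<Rightarrow> (complex^'m) set set" where
  "proj_orbit \<rho> H L = (\<lambda>h. act (\<rho> h) L) ` H"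

definition proj_stab ::
  "(complex^'n^'n \<Rightarrow> complex^'m^'m) \<Rightarrow> (complex^'n^'n) set \<Rightarrow> (complex^'m) set
    \<Rightarrow> (complex^'n^'n) set" where
  "proj_stab \<rho> H L = {h \<in> H. act (\<rho> h) L = L}"

definition Lim_set ::
  "(complex^'n^'n \<Rightarrow> complex^'m^'m) \<Rightarrow> complex^'n^'n \<Rightarrow> (nat \<Rightarrow> complex^'n^'n)
    \<Rightarrow> (nat \<Rightarrow> complex^'n^'n) \<Rightarrow> (complex^'m) set \<Rightarrow> (complex^'m) set set" where
  "Lim_set \<rho> \<Lambda> A g L =
     (\<Union>P \<in> {P. \<exists>\<alpha>. strict_mono \<alpha> \<and>
          limitin proj_top (\<lambda>j. act (\<rho> (matrix_inv (g (\<alpha> j)) ** A (\<alpha> j))) L) P sequentially}.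
        proj_orbit \<rho> (K_cent \<Lambda>) P)"


section \<open>Exterior powers\<close>

text \<open>
  The exterior algebra of \<open>complex^'n\<close> is \<open>complex^('n set)\<close>: the coordinate \<open>I\<close> belongs to the
  basis vector \<open>e\<^sub>I = e\<^bsub>i1\<^esub> \<and> \<dots> \<and> e\<^bsub>ip\<^esub>\<close>, where \<open>i1 < \<dots> < ip\<close> are the elements of \<open>I\<close>. The
  p-th exterior power is the subspace of vectors supported on the \<open>I\<close> with \<open>card I = p\<close>; it is
  closed and invariant, so limits of its points in the big projective space are limits in its own.
  By the Leibniz formula for minors, \<open>wedge [w1, \<dots>, wp] = w1 \<and> \<dots> \<and> wp\<close>.
\<close>

definition wedge :: "(complex^'n::{finite,linorder}) list \<Rightarrow> complex^('n::{finite,linorder} set)" where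
  "wedge ws = (\<chi> I. if card I = length ws
     then (\<Sum>\<sigma> \<in> {\<sigma>. \<sigma> permutes {..<length ws}}.
             of_int (sign \<sigma>) * (\<Prod>a<length ws. (ws ! a) $ (sorted_list_of_set I ! \<sigma> a)))
     else 0)"

text \<open>The column \<open>J\<close> is the image \<open>M e\<^bsub>j1\<^esub> \<and> \<dots> \<and> M e\<^bsub>jp\<^esub>\<close> of \<open>e\<^sub>J\<close>.\<close>

definition exterior_rep ::
  "complex^'n::{finite,linorder}^'n::{finite,linorder}
    \<Rightarrow> complex^('n::{finite,linorder} set)^('n::{finite,linorder} set)" where
  "exterior_rep M = (\<chi> I J. wedge (map (\<lambda>j. column j M) (sorted_list_of_set J)) $ I)"

text \<open>For \<open>p = dim W\<close>, the p-th exterior power of \<open>W\<close> is a line in that of \<open>E\<close>, spanned by the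
  wedge product of a basis of \<open>W\<close>.\<close>

definition plucker :: "(complex^'n::{finite,linorder}) set \<Rightarrow> (complex^('n::{finite,linorder} set)) set" where
  "plucker W = vec.span {wedge ws | ws. set ws \<subseteq> W \<and> length ws = vec.dim W}"


section \<open>The sequence and its filtration\<close>

definition incr :: "(nat \<Rightarrow> complex^'n^'n) \<Rightarrow> nat \<Rightarrow> complex^'n^'n" where
  "incr A i = A i ** matrix_inv (A (i - 1))"

definition cond_star :: "(nat \<Rightarrow> complex^'n^'n) \<Rightarrow> complex^'n^'n \<Rightarrow> bool" where
  "cond_star A \<Lambda> \<longleftrightarrow>
     (\<forall>\<alpha> :: nat \<Rightarrow> nat. strict_mono \<alpha> \<longrightarrow> (\<exists>\<beta> :: nat \<Rightarrow> nat. strict_mono \<beta> \<and> (\<exists>g \<in> unitary_group.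
        (\<lambda>j. incr A (\<alpha> (\<beta> j) + 1)) \<longlonglongrightarrow> g ** mexp \<Lambda> ** matrix_inv g \<and>
        (\<lambda>j. incr A (\<alpha> (\<beta> j) + 2)) \<longlonglongrightarrow> g ** mexp \<Lambda> ** matrix_inv g)))"

definition eigenspace :: "complex^'n^'n \<Rightarrow> complex \<Rightarrow> (complex^'n) set" where
  "eigenspace M c = {u. M *v u = c *s u}"

definition filtration ::
  "(nat \<Rightarrow> complex^'n^'n) \<Rightarrow> nat \<Rightarrow> (nat \<Rightarrow> real) \<Rightarrow> nat \<Rightarrow> (complex^'n) set" where
  "filtration A r lam s =
     (if s \<le> r then {u. growth (\<lambda>M. M) A u \<le> ereal (lam s)} else {0})"

definition property_R ::
  "(complex^'n^'n \<Rightarrow> complex^'m^'m) \<Rightarrow> complex^'n^'n \<Rightarrow> (nat \<Rightarrow> complex^'n^'n)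
    \<Rightarrow> (nat \<Rightarrow> complex^'n^'n) \<Rightarrow> complex^'m \<Rightarrow> bool" where
  "property_R \<rho> \<Lambda> A g v \<longleftrightarrow>
     (\<forall>P \<in> Lim_set \<rho> \<Lambda> A g (vec.span {v}).
        reductive (proj_stab \<rho> (G_cent \<Lambda>) P) \<and>
        proj_orbit \<rho> (G_cent \<Lambda>) P = proj_orbit \<rho> (K_cent \<Lambda>) P)"

end

theory Submission
  imports Defs
begin

text \<open>
  Let \<open>M\<^sub>i = g\<^sub>i\<inverse> A\<^sub>i\<close>. Then \<open>M\<^bsub>i+1\<^esub> = E\<^sub>i M\<^sub>i\<close> with \<open>E\<^sub>i \<longlonglongrightarrow> exp \<Lambda>\<close>, and the proof has three parts: it replaces
  the \<open>M\<^sub>i\<close> by elements of \<open>G\<^sub>\<Lambda>\<close>, shows that all limit points are fixed by \<open>G\<^sub>\<Lambda>\<close>, and then that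
  there is only one of them.

  \<^bold>\<open>Reduction to \<open>G\<^sub>\<Lambda>\<close>.\<close> Orbits of a product of matrices that converge to \<open>exp \<Lambda>\<close> are trapped by cones
  around sums of eigenspaces of \<open>\<Lambda>\<close>; so every orbit aligns with one eigenspace, and the eigenvalue
  is its growth rate (\<open>alignment\<close>, \<open>growth_of_aligned\<close>). The nonzero vectors of \<open>W\<^sub>s\<close> have growth rate
  \<open>\<lambda>\<^sub>s\<close>, so \<open>M\<^sub>i W\<^sub>s\<close> approaches \<open>U\<^sub>s = C\<^sub>0 W\<^sub>s\<close>. By compactness this is uniform, and it yields
  \<open>M\<^sub>i = S\<^sub>i D\<^sub>i C\<^sub>0\<close> with \<open>S\<^sub>i \<longlonglongrightarrow> 1\<close> and \<open>D\<^sub>i \<in> G\<^sub>\<Lambda>\<close> (\<open>asymptotic_factorization\<close>). The factors \<open>S\<^sub>i\<close> do not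
  change limits of lines. The \<open>D\<^sub>i\<close> commute with \<open>\<Lambda>\<close>, so they preserve the eigenspaces of \<open>\<Lambda>\<close> in the
  representation, and among the components of \<open>C\<^sub>0 v\<close> the one of the largest eigenvalue outgrows the
  others (\<open>dominant_component\<close>). This component spans the line of \<open>vbar\<close>. Hence \<open>Lim(v)\<close> consists of
  the \<open>K\<^sub>\<Lambda>\<close>-orbits of the limit points of \<open>D\<^sub>i vbar\<close>.

  \<^bold>\<open>Limit points are fixed.\<close> Let \<open>[w]\<close> be a limit point. Its \<open>G\<^sub>\<Lambda>\<close>-orbit is a \<open>K\<^sub>\<Lambda>\<close>-orbit, hence compact,
  hence it contains a highest weight line (\<open>highest_weight_vector\<close>). The stabiliser of such a line is
  block triangular with respect to its highest weight (\<open>stabilizer_parabolic\<close>) and contains the group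
  of all block unitriangular matrices, which is unipotent and normal in it. As the stabiliser is
  reductive, that group is trivial. Therefore the highest weight is constant on each eigenspace of \<open>\<Lambda>\<close>,
  and the line is fixed by \<open>G\<^sub>\<Lambda>\<close> (\<open>reductive_compact_orbit_fixed\<close>). Property (R) thus says much more
  than that the orbits of limit points are closed.

  \<^bold>\<open>There is one limit point.\<close> Let \<open>[w]\<close> be a limit point, and split \<open>vbar = a w + u\<close> with \<open>u\<close> orthogonal
  to \<open>w\<close>. The group \<open>G\<^sub>\<Lambda>\<close> is closed under adjoints and preserves \<open>[w]\<close> and its orthogonal complement.
  Any other limit point is orthogonal to \<open>w\<close>, so the cosine of the angle between \<open>D\<^sub>i vbar\<close> and \<open>w\<close>
  accumulates only at \<open>0\<close> and \<open>1\<close>. It cannot jump between the two: \<open>D\<^bsub>i+1\<^esub> D\<^sub>i\<inverse>\<close> converges to \<open>exp \<Lambda>\<close>,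
  an element of \<open>G\<^sub>\<Lambda>\<close>, which fixes all limit points, so consecutive lines have the same limits. Hence
  it converges to \<open>1\<close> (\<open>unique_limit_line\<close>) and \<open>Lim(v) = {[w]}\<close>. Being fixed by \<open>K\<^sub>\<Lambda>\<close>, the point \<open>[w]\<close>
  is itself unique.

  The same splitting gives the degeneration: for some \<open>i\<close> the element \<open>D\<^sub>i\<close> makes \<open>u\<close> small compared
  with \<open>w\<close>. The logarithm of its positive part is a real one-parameter subgroup that contracts all
  weight components of \<open>u\<close> relative to \<open>w\<close>, and it can be replaced by an integral one
  (\<open>degeneration_to_fixed_line\<close>).
\<close>

section \<open>Hermitian products, adjoints and diagonal matrices\<close>

definition herm :: "complex^'n \<Rightarrow> complex^'n \<Rightarrow> complex" where
  "herm x y = (\<Sum>i\<in>UNIV. x $ i * cnj (y $ i))"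

definition dg :: "('n \<Rightarrow> complex) \<Rightarrow> complex^'n^'n" where
  "dg d = (\<chi> i j. if i = j then d i else 0)"

lemma herm_simps [simp]:
  "herm 0 y = 0" "herm x 0 = 0"
  "herm (c *s x) y = c * herm x y" "herm x (c *s y) = cnj c * herm x y"
  by (simp_all add: herm_def sum_distrib_left mult_ac)

lemma herm_add:
  "herm (x + x') y = herm x y + herm x' y" "herm x (y + y') = herm x y + herm x y'"
  by (simp_all add: herm_def sum.distrib algebra_simps)

lemma herm_diff:
  "herm (x - x') y = herm x y - herm x' y" "herm x (y - y') = herm x y - herm x y'"
  by (simp_all add: herm_def sum_subtractf algebra_simps)

lemma cnj_herm: "cnj (herm x y) = herm y x"
  by (simp add: herm_def mult.commute)

lemma norm_vec_sq: "(norm (x::complex^'n))\<^sup>2 = (\<Sum>i\<in>UNIV. (norm (x $ i))\<^sup>2)"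
  by (simp add: norm_vec_def L2_set_def sum_nonneg)

lemma herm_self: "herm x x = of_real ((norm x)\<^sup>2)"
  by (simp add: herm_def norm_vec_sq complex_norm_square del: of_real_power)

lemma herm_self_eq_0 [simp]: "herm x x = 0 \<longleftrightarrow> x = 0"
  by (simp add: herm_self)

lemma norm_smult [simp]: "norm (c *s (x::complex^'n)) = norm c * norm x"
proof -
  have "(norm (c *s x))\<^sup>2 = (norm c * norm x)\<^sup>2"
    by (simp add: norm_vec_sq power_mult_distrib norm_mult sum_distrib_left)
  then show ?thesis by (simp add: power2_eq_iff_nonneg)
qed

lemma scaleR_smult: "r *\<^sub>R (x::complex^'n) = of_real r *s x"
  by (subst vec_eq_iff) (simp add: complex_eq_iff)

lemma inner_herm: "inner x y = Re (herm x (y::complex^'n))"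
  by (simp add: herm_def inner_vec_def inner_complex_def)

lemma herm_cauchy: "norm (herm x y) \<le> norm x * norm y"
proof (cases "herm x y = 0")
  case False
  define c where "c = cnj (herm x y) / norm (herm x y)"
  have nc: "norm c = 1" using False by (simp add: c_def norm_divide)
  have "of_real (norm (herm x y)) = c * herm x y"
    using False complex_norm_square[of "herm x y"]
    by (simp add: c_def field_simps power2_eq_square)
  also have "\<dots> = herm (c *s x) y" by simp
  finally have "norm (herm x y) = inner (c *s x) y"
    unfolding inner_herm by (metis Re_complex_of_real)
  also have "\<dots> \<le> norm (c *s x) * norm y" by (rule norm_cauchy_schwarz)
  finally show ?thesis using nc by simp
qed simp

lemma adj_nth [simp]: "adj M $ i $ j = cnj (M $ j $ i)"
  by (simp add: adj_def)

lemma adj_adj [simp]: "adj (adj M) = M"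
  by (simp add: vec_eq_iff)

lemma adj_mult: "adj (A ** B) = adj B ** adj A"
  by (simp add: vec_eq_iff matrix_matrix_mult_def mult.commute)

lemma adj_mat1 [simp]: "adj (mat 1) = mat 1"
  by (auto simp: vec_eq_iff mat_def)

lemma herm_adj: "herm (M *v x) y = herm x (adj M *v y)"
proof -
  have "herm (M *v x) y = (\<Sum>i\<in>UNIV. \<Sum>j\<in>UNIV. M $ i $ j * x $ j * cnj (y $ i))"
    by (simp add: herm_def matrix_vector_mult_def sum_distrib_right)
  also have "\<dots> = (\<Sum>j\<in>UNIV. \<Sum>i\<in>UNIV. M $ i $ j * x $ j * cnj (y $ i))"
    by (rule sum.swap)
  also have "\<dots> = herm x (adj M *v y)"
    by (simp add: herm_def matrix_vector_mult_def sum_distrib_left mult_ac)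
  finally show ?thesis .
qed

lemma sum_if_mult:
  "(\<Sum>k\<in>(UNIV::'n::finite set). (if i = k then c k else 0) * f k) = c i * (f i :: complex)"
  "(\<Sum>k\<in>(UNIV::'n::finite set). f k * (if k = i then c k else 0)) = f i * (c i :: complex)"
proof -
  have "(\<Sum>k\<in>(UNIV::'n set). (if i = k then c k else 0) * f k) = (\<Sum>k\<in>UNIV. if i = k then c k * f k else 0)"
    by (rule sum.cong) auto
  then show "(\<Sum>k\<in>(UNIV::'n set). (if i = k then c k else 0) * f k) = c i * f i" by simp
  have "(\<Sum>k\<in>(UNIV::'n set). f k * (if k = i then c k else 0)) = (\<Sum>k\<in>UNIV. if k = i then f k * c k else 0)"
    by (rule sum.cong) auto
  then show "(\<Sum>k\<in>(UNIV::'n set). f k * (if k = i then c k else 0)) = f i * c i" by simp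
qed

lemma dg_mult_nth: "(dg a ** M) $ i $ j = a i * M $ i $ j"
  using sum_if_mult(1)[of i "\<lambda>_. a i" "\<lambda>k. M $ k $ j"] by (simp add: dg_def matrix_matrix_mult_def)

lemma mult_dg_nth: "(M ** dg a) $ i $ j = M $ i $ j * a j"
  using sum_if_mult(2)[of "\<lambda>k. M $ i $ k" j a] by (simp add: dg_def matrix_matrix_mult_def)

lemma dg_nth: "dg a $ i $ j = (if i = j then a i else 0)"
  by (simp add: dg_def)

lemma dg_mult [simp]: "dg a ** dg b = dg (\<lambda>i. a i * b i)"
  by (simp add: vec_eq_iff dg_mult_nth dg_nth)

lemma dg_mv [simp]: "(dg a *v x) $ i = a i * x $ i"
  using sum_if_mult(1)[of i "\<lambda>_. a i" "\<lambda>k. x $ k"] by (simp add: dg_def matrix_vector_mult_def)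

lemma mv_axis: "((M::complex^'n^'m) *v axis j 1) $ i = M $ i $ j"
  using sum_if_mult(2)[of "\<lambda>k. M $ i $ k" j "\<lambda>_. 1"]
  by (simp add: matrix_vector_mult_def axis_def)

lemma dg_1 [simp]: "dg (\<lambda>i. 1) = mat 1"
  by (simp add: dg_def mat_def)

lemma adj_dg [simp]: "adj (dg d) = dg (\<lambda>i. cnj (d i))"
  by (simp add: vec_eq_iff dg_def)

lemma smult_mv: "M *v (c *s x) = c *s (M *v (x::complex^'n))"
  by (simp add: vector_scalar_commute)

section \<open>Invertible and unitary matrices\<close>

lemma mm_left_right: "(A::complex^'n^'n) ** B = mat 1 \<longleftrightarrow> B ** A = mat 1"
  by (rule matrix_left_right_inverse)

lemma GLC_I: "(A::complex^'n^'n) ** B = mat 1 \<Longrightarrow> A \<in> GLC"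
  unfolding GLC_def invertible_def using mm_left_right by auto

lemma GLC_inv: "A \<in> GLC \<Longrightarrow> A ** matrix_inv A = mat 1" "A \<in> GLC \<Longrightarrow> matrix_inv A ** A = mat 1"
  unfolding GLC_def invertible_def matrix_inv_def mem_Collect_eq
  by (metis (mono_tags, lifting) someI_ex)+

lemma GLC_inv_unique: "(A::complex^'n^'n) ** B = mat 1 \<Longrightarrow> matrix_inv A = B"
  by (metis GLC_I GLC_inv(2) matrix_mul_assoc matrix_mul_lid matrix_mul_rid)

lemma GLC_matrix_inv: "A \<in> GLC \<Longrightarrow> matrix_inv A \<in> GLC"
  using GLC_I GLC_inv by blast

lemma GLC_mult: "A \<in> GLC \<Longrightarrow> B \<in> GLC \<Longrightarrow> A ** B \<in> GLC"
  unfolding GLC_def by (simp add: invertible_mult)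

lemma GLC_mat1 [simp]: "mat 1 \<in> GLC"
  by (rule GLC_I[of _ "mat 1"]) simp

lemma matrix_inv_mult: "A \<in> GLC \<Longrightarrow> B \<in> GLC \<Longrightarrow> matrix_inv (A ** B) = matrix_inv B ** matrix_inv A"
  by (rule GLC_inv_unique) (metis GLC_inv(1) matrix_mul_assoc matrix_mul_rid)

lemma GLC_cancel:
  assumes "A \<in> GLC"
  shows "matrix_inv A ** (A ** B) = B" "A ** (matrix_inv A ** B) = B"
    "B ** A ** matrix_inv A = B" "B ** matrix_inv A ** A = B"
    "matrix_inv A *v (A *v x) = x" "A *v (matrix_inv A *v x) = x"
  using GLC_inv[OF assms]
  by (simp_all add: matrix_mul_assoc matrix_vector_mul_assoc)
     (simp_all flip: matrix_mul_assoc)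

lemma GLC_mv_eq_0: "A \<in> GLC \<Longrightarrow> A *v x = 0 \<longleftrightarrow> x = 0"
  by (metis GLC_cancel(5) matrix_vector_mult_0_right)

lemma GLC_iff_inj: "A \<in> GLC \<longleftrightarrow> (\<forall>x. A *v x = 0 \<longrightarrow> x = 0)"
  by (metis GLC_I GLC_mv_eq_0 matrix_left_invertible_ker mm_left_right)

lemma unitaryD: "U \<in> unitary_group \<Longrightarrow> adj U ** U = mat 1" "U \<in> unitary_group \<Longrightarrow> U ** adj U = mat 1"
  by (simp_all add: unitary_group_def)

lemma unitaryI: "adj U ** U = mat 1 \<Longrightarrow> U \<in> unitary_group"
  by (simp add: unitary_group_def mm_left_right[of "adj U"])

lemma unitary_inv: "U \<in> unitary_group \<Longrightarrow> matrix_inv U = adj U"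
  by (rule GLC_inv_unique) (rule unitaryD)

lemma unitary_GLC: "U \<in> unitary_group \<Longrightarrow> U \<in> GLC"
  by (rule GLC_I) (rule unitaryD)

lemma unitary_adj: "U \<in> unitary_group \<Longrightarrow> adj U \<in> unitary_group"
  by (simp add: unitary_group_def)

lemma unitary_mat1 [simp]: "mat 1 \<in> unitary_group"
  by (simp add: unitary_group_def)

lemma unitary_cancel:
  assumes "U \<in> unitary_group"
  shows "adj U ** (U ** B) = B" "U ** (adj U ** B) = B" "B ** U ** adj U = B" "B ** adj U ** U = B"
    "adj U *v (U *v x) = x" "U *v (adj U *v x) = x"
  using GLC_cancel[OF unitary_GLC[OF assms]] unitary_inv[OF assms] by simp_all

lemma unitary_mult:
  assumes "U \<in> unitary_group" "V \<in> unitary_group" shows "U ** V \<in> unitary_group"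
proof (rule unitaryI)
  have "adj (U ** V) ** (U ** V) = adj V ** (adj U ** (U ** V))" by (simp add: adj_mult matrix_mul_assoc)
  then show "adj (U ** V) ** (U ** V) = mat 1" using assms by (simp add: unitary_cancel unitaryD)
qed

lemma herm_unitary: "U \<in> unitary_group \<Longrightarrow> herm (U *v x) (U *v y) = herm x y"
  by (simp add: herm_adj unitary_cancel)

lemma norm_unitary [simp]: "U \<in> unitary_group \<Longrightarrow> norm (U *v x) = norm x"
proof -
  assume U: "U \<in> unitary_group"
  have "(norm (U *v x))\<^sup>2 = (norm x)\<^sup>2"
    using herm_unitary[OF U, of x x] unfolding herm_self by (simp only: of_real_eq_iff)
  then show ?thesis by (simp add: power2_eq_iff_nonneg)
qed

lemma GLC_dg: "(\<And>i. d i \<noteq> 0) \<Longrightarrow> dg d \<in> GLC"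
  by (rule GLC_I[of _ "dg (\<lambda>i. 1 / d i)"]) simp

lemma dg_unitary: "(\<And>i. norm (d i) = 1) \<Longrightarrow> dg d \<in> unitary_group"
proof (rule unitaryI)
  assume a: "\<And>i. norm (d i) = 1"
  have "cnj (d i) * d i = 1" for i using complex_norm_square[of "d i"] a by (simp add: mult.commute)
  then show "adj (dg d) ** dg d = mat 1" by simp
qed

lemma GLC_adj: "A \<in> GLC \<Longrightarrow> adj A \<in> GLC"
  by (metis GLC_I GLC_inv(2) adj_mat1 adj_mult)

subsection \<open>Continuity of the matrix operations\<close>

lemma mm_add_left: "((A::complex^'n^'m) + B) ** C = A ** C + B ** C"
  by (simp add: vec_eq_iff matrix_matrix_mult_def sum.distrib distrib_right)

lemma bounded_bilinear_mm: "bounded_bilinear ((**) :: complex^'n^'n \<Rightarrow> complex^'n^'n \<Rightarrow> _)"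
  unfolding bilinear_conv_bounded_bilinear[symmetric] bilinear_def linear_iff
  by (simp add: matrix_add_ldistrib mm_add_left matrix_scalar_ac scalar_matrix_assoc)

lemma bounded_bilinear_mv: "bounded_bilinear ((*v) :: complex^'n^'m \<Rightarrow> complex^'n \<Rightarrow> _)"
  unfolding bilinear_conv_bounded_bilinear[symmetric] bilinear_def linear_iff
  by (simp add: matrix_vector_mult_add_rdistrib matrix_vector_right_distrib)
     (simp add: vec_eq_iff matrix_vector_mult_def scaleR_sum_right)

lemma bounded_bilinear_smult: "bounded_bilinear ((*s) :: complex \<Rightarrow> complex^'n \<Rightarrow> _)"
  unfolding bilinear_conv_bounded_bilinear[symmetric] bilinear_def linear_iff
  by (simp add: vec_eq_iff distrib_left distrib_right)

lemma bounded_bilinear_herm: "bounded_bilinear (herm :: complex^'n \<Rightarrow> complex^'n \<Rightarrow> _)"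
  unfolding bilinear_conv_bounded_bilinear[symmetric] bilinear_def linear_iff
  by (auto simp: scaleR_smult herm_add scaleR_conv_of_real)

lemma bounded_linear_adj: "bounded_linear (adj :: complex^'n^'m \<Rightarrow> _)"
  unfolding linear_conv_bounded_linear[symmetric] linear_iff
  by (auto simp: vec_eq_iff)

lemmas tendsto_mm [tendsto_intros] = bounded_bilinear.tendsto[OF bounded_bilinear_mm]
lemmas tendsto_mv [tendsto_intros] = bounded_bilinear.tendsto[OF bounded_bilinear_mv]
lemmas tendsto_smult [tendsto_intros] = bounded_bilinear.tendsto[OF bounded_bilinear_smult]
lemmas tendsto_herm [tendsto_intros] = bounded_bilinear.tendsto[OF bounded_bilinear_herm]
lemmas tendsto_adj [tendsto_intros] = bounded_linear.tendsto[OF bounded_linear_adj]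

lemma tendsto_dg [tendsto_intros]:
  "(\<And>i. ((\<lambda>x. f x i) \<longlongrightarrow> d i) F) \<Longrightarrow> ((\<lambda>x. dg (f x)) \<longlongrightarrow> dg d) F"
  unfolding dg_def by (intro vec_tendstoI) (auto intro!: tendsto_intros)

lemma open_GLC: "open (GLC :: (complex^'n^'n) set)"
proof -
  have "continuous_on UNIV (\<lambda>A :: complex^'n^'n. det A)"
    unfolding det_def by (intro continuous_intros)
  then have "open ((\<lambda>A :: complex^'n^'n. det A) -` (- {0}))"
    by (intro open_vimage) auto
  also have "(\<lambda>A :: complex^'n^'n. det A) -` (- {0}) = GLC"
    by (auto simp: GLC_def invertible_det_nz)
  finally show ?thesis .
qed

lemma compact_unitary: "compact (unitary_group :: (complex^'n^'n) set)"
proof -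
  have "closed ((\<lambda>U :: complex^'n^'n. adj U ** U) -` {mat 1})"
    by (intro continuous_closed_vimage)
       (auto intro!: bounded_bilinear.isCont[OF bounded_bilinear_mm] bounded_linear.isCont[OF bounded_linear_adj])
  also have "(\<lambda>U :: complex^'n^'n. adj U ** U) -` {mat 1} = unitary_group"
    by (auto intro: unitaryI unitaryD)
  finally have cl: "closed (unitary_group :: (complex^'n^'n) set)" .
  have "norm U \<le> (\<Sum>i\<in>(UNIV::'n set). \<Sum>j\<in>(UNIV::'n set). (1::real))" if U: "U \<in> unitary_group" for U :: "complex^'n^'n"
  proof -
    have "norm (U $ i $ j) \<le> 1" for i j
    proof -
      have "U $ i $ j = (U *v axis j 1) $ i" 
        by (simp add: mv_axis)
      also have "norm \<dots> \<le> norm (U *v axis j 1)" by (rule Finite_Cartesian_Product.norm_nth_le)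
      finally show ?thesis using U by simp
    qed
    then have "norm (U $ i) \<le> (\<Sum>j\<in>(UNIV::'n set). (1::real))" for i
      unfolding norm_vec_def[of "U $ i"] by (intro order_trans[OF L2_set_le_sum] sum_mono) auto
    then show ?thesis unfolding norm_vec_def[of U]
      by (intro order_trans[OF L2_set_le_sum] sum_mono) simp_all
  qed
  then have "bounded (unitary_group :: (complex^'n^'n) set)" unfolding bounded_iff by blast
  with cl show ?thesis by (simp add: compact_eq_bounded_closed)
qed

text \<open>From \<open>T - 1 = (1 - f x) T\<close> for the inverse \<open>T\<close> of \<open>f x\<close>, the norm of \<open>T\<close> stays bounded, and then
  the same equation shows that \<open>T\<close> tends to \<open>1\<close>.\<close>

lemma tendsto_matrix_inv_1:
  fixes f :: "'a \<Rightarrow> complex^'n^'n"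
  assumes "(f \<longlongrightarrow> mat 1) F"
  shows "((\<lambda>x. matrix_inv (f x)) \<longlongrightarrow> mat 1) F"
proof -
  obtain K where K: "K > 0" "\<And>(a :: complex^'n^'n) (b :: complex^'n^'n). norm (a ** b) \<le> norm a * norm b * K"
    using bounded_bilinear.pos_bounded[OF bounded_bilinear_mm[where 'n='n]] by auto
  have d0: "((\<lambda>x. mat 1 - f x) \<longlongrightarrow> 0) F"
    using tendsto_diff[OF tendsto_const assms, of "mat 1"] by simp
  have ev1: "\<forall>\<^sub>F x in F. f x \<in> GLC"
    using topological_tendstoD[OF assms open_GLC] by simp
  have ev2: "\<forall>\<^sub>F x in F. norm (mat 1 - f x) < 1 / (2 * K)"
    using tendstoD[OF d0, of "1 / (2 * K)"] K by simp
  have lim: "((\<lambda>x. norm (mat 1 - f x) * K * (2 * norm (mat 1 :: complex^'n^'n))) \<longlongrightarrow> 0 * K * (2 * norm (mat 1 :: complex^'n^'n))) F"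
    by (intro tendsto_intros tendsto_norm_zero d0)
  have "\<forall>\<^sub>F x in F. norm (matrix_inv (f x) - mat 1) \<le> norm (mat 1 - f x) * K * (2 * norm (mat 1 :: complex^'n^'n))"
    using ev1 ev2
  proof eventually_elim
    case (elim x)
    define T where "T = matrix_inv (f x)"
    have e: "T - mat 1 = (mat 1 - f x) ** T"
      using GLC_inv[OF elim(1)] by (simp add: T_def bounded_bilinear.diff_left[OF bounded_bilinear_mm])
    then have n: "norm (T - mat 1) \<le> norm (mat 1 - f x) * norm T * K" using K by metis
    have "norm (mat 1 - f x) * K \<le> 1/2" using elim(2) K by (simp add: field_simps)
    then have "norm (mat 1 - f x) * K * norm T \<le> 1/2 * norm T" by (rule mult_right_mono) simp
    moreover have "norm T \<le> norm (T - mat 1) + norm (mat 1 :: complex^'n^'n)"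
      using norm_triangle_ineq[of "T - mat 1" "mat 1"] by simp
    ultimately have T2: "norm T \<le> 2 * norm (mat 1 :: complex^'n^'n)" using n by (simp add: mult_ac)
    have "norm (mat 1 - f x) * K * norm T \<le> norm (mat 1 - f x) * K * (2 * norm (mat 1 :: complex^'n^'n))"
      by (intro mult_left_mono[OF T2] mult_nonneg_nonneg norm_ge_zero less_imp_le[OF K(1)])
    moreover have "norm (mat 1 - f x) * norm T * K = norm (mat 1 - f x) * K * norm T" by (simp only: mult_ac)
    ultimately show ?case using n unfolding T_def by linarith
  qed
  then have "((\<lambda>x. matrix_inv (f x) - mat 1) \<longlongrightarrow> 0) F"
    by (rule Lim_null_comparison) (use lim in simp)
  then show ?thesis by (simp add: LIM_zero_iff)
qed

section \<open>Commuting Hermitian matrices\<close>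

lemma vec_subspace_closed:
  assumes "vec.subspace (S :: (complex^'n) set)"
  shows "closed S"
proof -
  have "subspace S"
    using assms unfolding vec.subspace_def subspace_def by (auto simp: scaleR_smult)
  then show ?thesis by (rule closed_subspace)
qed

text \<open>The quadratic form of \<open>H\<close> attains its maximum \<open>M\<close> on the unit sphere of \<open>S\<close>. The form of \<open>M - H\<close> is
  nonnegative and vanishes at a maximiser \<open>x0\<close>; looking at \<open>x0 + t y\<close> with \<open>y = (M - H) x0\<close> for small
  negative \<open>t\<close> shows that \<open>y = 0\<close>.\<close>

lemma hermitian_eigenvector:
  fixes S :: "(complex^'n) set"
  assumes H: "hermitian H" and S: "vec.subspace S" "S \<noteq> {0}" and inv: "\<And>x. x \<in> S \<Longrightarrow> H *v x \<in> S"
  obtains x and c :: real where "x \<in> S" "x \<noteq> 0" "H *v x = of_real c *s x"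
proof -
  define T where "T = S \<inter> sphere 0 1"
  have zS: "0 \<in> S" using S(1) by (simp add: vec.subspace_0)
  then obtain s where s: "s \<in> S" "s \<noteq> 0" using S(2) by auto
  have normal: "(1 / of_real (norm y)) *s y \<in> T" if "y \<in> S" "y \<noteq> 0" for y
    using that S(1) by (auto simp: T_def norm_divide vec.subspace_scale)
  define q where "q x = Re (herm (H *v x) x)" for x
  have "compact T" unfolding T_def
    by (intro closed_Int_compact compact_sphere vec_subspace_closed S)
  moreover have "T \<noteq> {}" using normal[OF s] by auto
  moreover have "continuous_on T q"
    unfolding q_def continuous_on_def by (intro ballI tendsto_intros)
  ultimately obtain x0 where x0: "x0 \<in> T" "\<And>y. y \<in> T \<Longrightarrow> q y \<le> q x0"
    using continuous_attains_sup[of T q] by blast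
  define M where "M = q x0"
  define B where "B = dg (\<lambda>_. of_real M) - H"
  have dgM: "dg (\<lambda>_. of_real M) *v x = of_real M *s x" for x :: "complex^'n"
    by (simp add: vec_eq_iff)
  have Bx: "B *v x = of_real M *s x - H *v x" for x
    unfolding B_def by (simp add: matrix_vector_mult_diff_rdistrib dgM)
  have adjB: "adj B = B"
    using H unfolding hermitian_def B_def by (simp add: vec_eq_iff dg_nth)
  define b where "b x = Re (herm (B *v x) x)" for x
  have b_eq: "b x = M * (norm x)\<^sup>2 - q x" for x
    by (simp add: b_def Bx herm_diff herm_self q_def del: of_real_power)
  have b_nonneg: "b y \<ge> 0" if y: "y \<in> S" for y
  proof (cases "y = 0")
    case False
    have "q ((1 / of_real (norm y)) *s y) = q y / (norm y)\<^sup>2"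
      by (simp add: q_def smult_mv power2_eq_square field_simps flip: of_real_mult)
    then have "q y / (norm y)\<^sup>2 \<le> M" using x0(2)[OF normal[OF y False]] by (simp add: M_def)
    then show ?thesis using False by (simp add: b_eq field_simps)
  qed (simp add: b_def)
  have x0S: "x0 \<in> S" "norm x0 = 1" using x0(1) by (auto simp: T_def)
  have b0: "b x0 = 0" by (simp add: b_eq x0S M_def)
  define y where "y = B *v x0"
  have yS: "y \<in> S" unfolding y_def Bx
    by (intro vec.subspace_diff vec.subspace_scale S(1) inv x0S)
  have quad: "0 \<le> 2 * t * (norm y)\<^sup>2 + t\<^sup>2 * b y" for t :: real
  proof -
    have "herm (B *v y) x0 = herm y y" by (simp add: herm_adj adjB y_def)
    then have "b (x0 + of_real t *s y) = b x0 + 2 * t * (norm y)\<^sup>2 + t\<^sup>2 * b y"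
      by (simp add: b_def matrix_vector_right_distrib herm_add smult_mv y_def[symmetric] herm_self
          power2_eq_square algebra_simps flip: of_real_mult)
    moreover have "x0 + of_real t *s y \<in> S"
      by (intro vec.subspace_add vec.subspace_scale S(1) yS x0S)
    ultimately show ?thesis using b_nonneg b0 by fastforce
  qed
  have "y = 0"
  proof (rule ccontr)
    assume "y \<noteq> 0"
    define n where "n = (norm y)\<^sup>2"
    have n: "n > 0" using \<open>y \<noteq> 0\<close> by (simp add: n_def)
    have by0: "b y \<ge> 0" using b_nonneg[OF yS] .
    define t where "t = - n / (b y + 1)"
    have "t * (b y + 1) = - n" using by0 by (simp add: t_def)
    then have "t * b y = - n - t" by (simp add: algebra_simps)
    then have "2 * t * n + t\<^sup>2 * b y = 2 * t * n + t * (- n - t)" by (simp add: power2_eq_square)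
    also have "\<dots> = t * n - t\<^sup>2" by (simp add: algebra_simps power2_eq_square)
    also have "\<dots> < 0"
    proof -
      have "t < 0" using n by0 by (simp add: t_def divide_neg_pos)
      then have "t * n < 0" using n by (simp add: mult_neg_pos)
      then show ?thesis by (smt (verit) zero_le_power2)
    qed
    finally show False using quad[of t] by (simp add: n_def)
  qed
  then have "H *v x0 = of_real M *s x0" by (simp add: y_def Bx)
  then show ?thesis using that x0S by (metis norm_zero zero_neq_one)
qed

text \<open>If some \<open>H\<close> in \<open>F\<close> is not scalar on \<open>S\<close>, its eigenspaces in \<open>S\<close> are smaller, and they are invariant
  under all of \<open>F\<close> because \<open>F\<close> is commutative.\<close>

lemma common_eigenvector:
  fixes F :: "(complex^'n^'n) set"
  assumes F: "\<And>H. H \<in> F \<Longrightarrow> hermitian H" "\<And>H H'. H \<in> F \<Longrightarrow> H' \<in> F \<Longrightarrow> H ** H' = H' ** H"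
    and "vec.subspace S" "S \<noteq> {0}" "\<And>H x. H \<in> F \<Longrightarrow> x \<in> S \<Longrightarrow> H *v x \<in> S"
  shows "\<exists>x\<in>S. x \<noteq> 0 \<and> (\<forall>H\<in>F. \<exists>c::real. H *v x = of_real c *s x)"
  using assms(3-)
proof (induction "vec.dim S" arbitrary: S rule: less_induct)
  case less
  show ?case
  proof (cases "\<forall>H\<in>F. \<exists>c::real. \<forall>x\<in>S. H *v x = of_real c *s x")
    case True
    have "0 \<in> S" using less.prems(1) by (simp add: vec.subspace_0)
    then obtain x where "x \<in> S" "x \<noteq> 0" using less.prems(2) by auto
    with True show ?thesis by blast
  next
    case False
    then obtain H where H: "H \<in> F" "\<And>c::real. \<exists>x\<in>S. H *v x \<noteq> of_real c *s x" by blast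
    obtain x and c :: real where x: "x \<in> S" "x \<noteq> 0" "H *v x = of_real c *s x"
      using hermitian_eigenvector[OF F(1)[OF H(1)] less.prems(1,2) less.prems(3)[OF H(1)]] by blast
    define S' where "S' = {x \<in> S. H *v x = of_real c *s x}"
    have sub: "vec.subspace S'"
      using less.prems(1) unfolding S'_def vec.subspace_def
      by (auto simp: matrix_vector_right_distrib smult_mv vector_add_ldistrib mult.commute)
    have "S' \<subset> S" using H(2)[of c] by (auto simp: S'_def)
    then have dim: "vec.dim S' < vec.dim S"
      by (metis less.prems(1) sub vec.dim_subset vec.subspace_dim_equal order.strict_iff_order psubset_eq)
    have inv: "H' *v x \<in> S'" if "H' \<in> F" "x \<in> S'" for H' x
    proof -
      have "H *v (H' *v x) = H' *v (H *v x)"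
        using F(2)[OF H(1) that(1)] by (simp add: matrix_vector_mul_assoc)
      then show ?thesis using that less.prems(3) by (auto simp: S'_def smult_mv)
    qed
    have "S' \<noteq> {0}" using x by (auto simp: S'_def)
    from less.hyps[OF dim sub this inv] show ?thesis by (auto simp: S'_def)
  qed
qed

text \<open>Orthogonality to \<open>b\<close> for the Hermitian product is orthogonality to \<open>b\<close> and \<open>\<i> b\<close> for the real inner
  product, so this is a count of real dimensions.\<close>

lemma perp_exists:
  fixes B :: "(complex^'n) set"
  assumes "finite B" "card B < CARD('n)"
  shows "\<exists>x. x \<noteq> 0 \<and> (\<forall>b\<in>B. herm x b = 0)"
proof -
  define T where "T = B \<union> (\<lambda>b. \<i> *s b) ` B"
  have fT: "finite T" using assms by (simp add: T_def)
  have "card T \<le> card B + card ((\<lambda>b. \<i> *s b) ` B)" unfolding T_def by (rule card_Un_le)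
  also have "\<dots> \<le> 2 * card B" using card_image_le[OF assms(1), of "\<lambda>b. \<i> *s b"] by simp
  finally have "dim T \<le> 2 * card B" using dim_le_card'[OF fT] by linarith
  also have "\<dots> < DIM(complex^'n)" using assms by simp
  finally obtain x where x: "x \<noteq> 0" "\<And>y. y \<in> span T \<Longrightarrow> orthogonal x y"
    using orthogonal_to_subspace_exists by blast
  have "herm x b = 0" if "b \<in> B" for b
  proof -
    have "inner x b = 0" "inner x (\<i> *s b) = 0"
      using x(2) span_base[of _ T] that by (auto simp: T_def orthogonal_def)
    then show ?thesis by (simp add: inner_herm complex_eq_iff)
  qed
  with x show ?thesis by blast
qed

text \<open>The orthogonal complement of a set of common eigenvectors is again invariant, so that common
  eigenvectors can be collected one by one into an orthonormal basis.\<close>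

theorem simultaneous_diagonalization:
  fixes F :: "(complex^'n^'n) set"
  assumes F: "\<And>H. H \<in> F \<Longrightarrow> hermitian H" "\<And>H H'. H \<in> F \<Longrightarrow> H' \<in> F \<Longrightarrow> H ** H' = H' ** H"
  obtains U where "U \<in> unitary_group"
    "\<And>H. H \<in> F \<Longrightarrow> \<exists>d :: 'n \<Rightarrow> real. H = U ** dg (\<lambda>i. of_real (d i)) ** adj U"
proof -
  have "\<exists>B. finite B \<and> card B = k \<and> (\<forall>x\<in>B. \<forall>y\<in>B. herm x y = (if x = y then 1 else 0)) \<and>
    (\<forall>x\<in>B. \<forall>H\<in>F. \<exists>c::real. H *v x = of_real c *s x)" if "k \<le> CARD('n)" for k
    using that
  proof (induction k)
    case (Suc k)
    then obtain B where B: "finite B" "card B = k" "\<And>x y. x \<in> B \<Longrightarrow> y \<in> B \<Longrightarrow> herm x y = (if x = y then 1 else 0)"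
      "\<And>x H. x \<in> B \<Longrightarrow> H \<in> F \<Longrightarrow> \<exists>c::real. H *v x = of_real c *s x" by auto
    define S where "S = {x. \<forall>b\<in>B. herm x b = 0}"
    have S: "vec.subspace S" by (auto simp: S_def vec.subspace_def herm_add)
    have S0: "S \<noteq> {0}" using perp_exists[OF B(1)] B(2) Suc.prems by (auto simp: S_def)
    have Sinv: "H *v x \<in> S" if "H \<in> F" "x \<in> S" for H x
    proof -
      have "herm (H *v x) b = 0" if bB: "b \<in> B" for b
      proof -
        obtain c :: real where "H *v b = of_real c *s b" using B(4)[OF bB \<open>H \<in> F\<close>] by blast
        then show ?thesis using F(1)[OF \<open>H \<in> F\<close>] bB \<open>x \<in> S\<close> by (simp add: herm_adj hermitian_def S_def)
      qed
      then show ?thesis by (simp add: S_def)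
    qed
    have "\<exists>x\<in>S. x \<noteq> 0 \<and> (\<forall>H\<in>F. \<exists>c::real. H *v x = of_real c *s x)"
      by (rule common_eigenvector) (fact F S S0 Sinv)+
    then obtain x where x: "x \<in> S" "x \<noteq> 0" "\<And>H. H \<in> F \<Longrightarrow> \<exists>c::real. H *v x = of_real c *s x"
      by auto
    define y where "y = (1 / of_real (norm x)) *s x"
    have y1: "herm y y = 1" using x(2) by (simp add: herm_self y_def norm_divide)
    have yS: "herm y b = 0" "herm b y = 0" if "b \<in> B" for b
      using x(1) that cnj_herm[of x b] by (auto simp: y_def S_def)
    have "y \<notin> B" using yS(1)[of y] y1 by auto
    moreover have "\<exists>c::real. H *v y = of_real c *s y" if "H \<in> F" for H
    proof -
      obtain c :: real where "H *v x = of_real c *s x" using x(3)[OF \<open>H \<in> F\<close>] by blast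
      then have "H *v y = of_real c *s y" by (simp add: y_def smult_mv mult.commute)
      then show ?thesis by blast
    qed
    ultimately show ?case
      using B yS y1 by (intro exI[of _ "insert y B"]) (auto simp: card_insert_if)
  qed (intro exI[of _ "{}"], simp)
  from this[of "CARD('n)"] obtain B where B: "finite B" "card B = CARD('n)"
    "\<And>x y. x \<in> B \<Longrightarrow> y \<in> B \<Longrightarrow> herm x y = (if x = y then 1 else 0)"
    "\<And>x H. x \<in> B \<Longrightarrow> H \<in> F \<Longrightarrow> \<exists>c::real. H *v x = of_real c *s x" by auto
  obtain e where e: "bij_betw e (UNIV :: 'n set) B"
    using finite_same_card_bij[of "UNIV :: 'n set" B] B(1,2) by auto
  have eB: "e j \<in> B" for j using e by (auto simp: bij_betw_def)
  have einj: "e i = e j \<longleftrightarrow> i = j" for i j using e by (auto simp: bij_betw_def inj_on_def)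
  define U :: "complex^'n^'n" where "U = (\<chi> i j. e j $ i)"
  have "(adj U ** U) $ i $ j = herm (e j) (e i)" for i j
    by (simp add: U_def matrix_matrix_mult_def herm_def mult.commute)
  then have "(adj U ** U) $ i $ j = mat 1 $ i $ j" for i j
    unfolding B(3)[OF eB eB] einj by (simp add: mat_def)
  then have "adj U ** U = mat 1" by (subst vec_eq_iff)+ blast
  then have U: "U \<in> unitary_group" by (rule unitaryI)
  have "\<exists>d :: 'n \<Rightarrow> real. H = U ** dg (\<lambda>i. of_real (d i)) ** adj U" if H: "H \<in> F" for H
  proof -
    obtain d :: "'n \<Rightarrow> real" where d: "\<And>j. H *v e j = of_real (d j) *s e j"
      using B(4)[OF eB H] by metis
    have "(H ** U) $ i $ j = (H *v e j) $ i" for i j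
      by (simp add: matrix_matrix_mult_def matrix_vector_mult_def U_def)
    then have "H ** U = U ** dg (\<lambda>i. of_real (d i))"
      by (simp add: vec_eq_iff d mult_dg_nth U_def mult.commute)
    then have "H = U ** dg (\<lambda>i. of_real (d i)) ** adj U"
      using unitary_cancel(3)[OF U, of H] by simp
    then show ?thesis by blast
  qed
  with U show ?thesis using that by blast
qed

section \<open>The centraliser of a Hermitian matrix\<close>

lemma G_cent_iff: "h \<in> G_cent \<Lambda> \<longleftrightarrow> h \<in> GLC \<and> h ** \<Lambda> = \<Lambda> ** h"
  unfolding G_cent_def mem_Collect_eq by (metis GLC_cancel(3,4))

lemma K_cent_iff: "h \<in> K_cent \<Lambda> \<longleftrightarrow> h \<in> unitary_group \<and> h ** \<Lambda> = \<Lambda> ** h"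
  using G_cent_iff[of h \<Lambda>] unitary_GLC unfolding G_cent_def K_cent_def by blast

lemma K_cent_subset_G_cent: "h \<in> K_cent \<Lambda> \<Longrightarrow> h \<in> G_cent \<Lambda>"
  by (simp add: K_cent_iff G_cent_iff unitary_GLC)

lemma G_cent_mat1 [simp]: "mat 1 \<in> G_cent \<Lambda>"
  by (simp add: G_cent_iff)

lemma K_cent_mat1 [simp]: "mat 1 \<in> K_cent \<Lambda>"
  by (simp add: K_cent_iff)

lemma G_cent_mult: "a \<in> G_cent \<Lambda> \<Longrightarrow> b \<in> G_cent \<Lambda> \<Longrightarrow> a ** b \<in> G_cent \<Lambda>"
  unfolding G_cent_iff by (metis GLC_mult matrix_mul_assoc)

lemma G_cent_inv: "a \<in> G_cent \<Lambda> \<Longrightarrow> matrix_inv a \<in> G_cent \<Lambda>"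
  unfolding G_cent_iff by (metis GLC_cancel(1,3) GLC_matrix_inv matrix_mul_assoc)

lemma G_cent_adj: "hermitian \<Lambda> \<Longrightarrow> a \<in> G_cent \<Lambda> \<Longrightarrow> adj a \<in> G_cent \<Lambda>"
  unfolding G_cent_iff hermitian_def by (metis GLC_adj adj_mult)

lemma compact_K_cent: "compact (K_cent \<Lambda>)"
proof -
  have "closed ((\<lambda>h. h ** \<Lambda> - \<Lambda> ** h) -` {0})"
    by (intro continuous_closed_vimage closed_singleton isCont_diff
        bounded_bilinear.isCont[OF bounded_bilinear_mm] continuous_const continuous_ident)
  moreover have "K_cent \<Lambda> = unitary_group \<inter> ((\<lambda>h. h ** \<Lambda> - \<Lambda> ** h) -` {0})"
    by (auto simp: K_cent_iff)
  ultimately show ?thesis by (simp add: compact_Int_closed compact_unitary)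
qed

lemma G_cent_conj:
  assumes "V \<in> unitary_group"
  shows "h \<in> G_cent (V ** X ** adj V) \<longleftrightarrow> adj V ** h ** V \<in> G_cent X"
    "h \<in> K_cent (V ** X ** adj V) \<longleftrightarrow> adj V ** h ** V \<in> K_cent X"
proof -
  have c: "h ** (V ** X ** adj V) = (V ** X ** adj V) ** h \<longleftrightarrow> (adj V ** h ** V) ** X = X ** (adj V ** h ** V)"
    (is "?l \<longleftrightarrow> ?r")
  proof
    assume ?l
    then have "adj V ** (h ** (V ** X ** adj V)) ** V = adj V ** ((V ** X ** adj V) ** h) ** V" by simp
    then show ?r using assms by (simp add: matrix_mul_assoc unitary_cancel unitaryD)
  next
    assume ?r
    then have "V ** ((adj V ** h ** V) ** X) ** adj V = V ** (X ** (adj V ** h ** V)) ** adj V" by simp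
    then show ?l using assms by (simp add: matrix_mul_assoc unitary_cancel unitaryD)
  qed
  have r: "h = V ** (adj V ** h ** V) ** adj V"
    using assms by (simp add: matrix_mul_assoc unitary_cancel unitaryD)
  have "h \<in> GLC \<longleftrightarrow> adj V ** h ** V \<in> GLC"
    by (metis r assms GLC_mult unitary_GLC unitary_adj)
  with c show "h \<in> G_cent (V ** X ** adj V) \<longleftrightarrow> adj V ** h ** V \<in> G_cent X" by (simp add: G_cent_iff)
  have "h \<in> unitary_group \<longleftrightarrow> adj V ** h ** V \<in> unitary_group"
    by (metis r assms unitary_mult unitary_adj)
  with c show "h \<in> K_cent (V ** X ** adj V) \<longleftrightarrow> adj V ** h ** V \<in> K_cent X" by (simp add: K_cent_iff)
qed

lemma conj_dg_in_G_cent: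
  assumes "V \<in> unitary_group" "\<Lambda> = V ** dg l ** adj V" "\<And>a. d a \<noteq> 0"
  shows "V ** dg d ** adj V \<in> G_cent \<Lambda>"
proof -
  have "adj V ** (V ** dg d ** adj V) ** V = dg d"
    using assms(1) by (simp add: matrix_mul_assoc unitary_cancel unitaryD)
  moreover have "dg d \<in> G_cent (dg l)" using assms(3) by (simp add: G_cent_iff GLC_dg mult.commute)
  ultimately show ?thesis unfolding assms(2) G_cent_conj(1)[OF assms(1)] by simp
qed

text \<open>The matrix \<open>P = M\<^sup>* M\<close> commutes with \<open>\<Lambda>\<close>. Diagonalising \<open>P\<close> and \<open>\<Lambda>\<close> together, the square root of \<open>P\<close> is
  the second factor.\<close>

lemma polar_decomposition:
  fixes M :: "complex^'n^'n"
  assumes "hermitian \<Lambda>" "M \<in> G_cent \<Lambda>"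
  obtains k V and s l :: "'n \<Rightarrow> real" where "k \<in> K_cent \<Lambda>" "V \<in> unitary_group" "\<And>a. s a > 0"
    "\<Lambda> = V ** dg (\<lambda>a. of_real (l a)) ** adj V"
    "M = k ** (V ** dg (\<lambda>a. of_real (s a)) ** adj V)"
proof -
  have adjL: "adj \<Lambda> = \<Lambda>" and M: "M \<in> GLC" "M ** \<Lambda> = \<Lambda> ** M"
    using assms by (auto simp: G_cent_iff hermitian_def)
  define P where "P = adj M ** M"
  have "adj M ** \<Lambda> = \<Lambda> ** adj M" by (metis M(2) adjL adj_mult)
  then have com: "P ** \<Lambda> = \<Lambda> ** P"
    unfolding P_def using M(2) by (metis matrix_mul_assoc)
  have hP: "hermitian P" by (simp add: hermitian_def P_def adj_mult)
  obtain V where V: "V \<in> unitary_group"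
    "\<And>H. H \<in> {\<Lambda>, P} \<Longrightarrow> \<exists>d :: 'n \<Rightarrow> real. H = V ** dg (\<lambda>i. of_real (d i)) ** adj V"
    by (rule simultaneous_diagonalization[of "{\<Lambda>, P}"]) (use assms(1) hP com in auto)
  obtain l :: "'n \<Rightarrow> real" where l: "\<Lambda> = V ** dg (\<lambda>i. of_real (l i)) ** adj V" using V(2) by blast
  obtain d :: "'n \<Rightarrow> real" where d: "P = V ** dg (\<lambda>i. of_real (d i)) ** adj V" using V(2) by blast
  have dpos: "d a > 0" for a
  proof -
    define x where "x = V *v axis a 1"
    have x0: "x \<noteq> 0" unfolding x_def using V(1) by (simp add: GLC_mv_eq_0 unitary_GLC axis_eq_0_iff)
    have "herm (P *v x) x = of_real ((norm (M *v x))\<^sup>2)"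
      using herm_adj[of "adj M" "M *v x" x]
      by (simp add: P_def herm_self flip: matrix_vector_mul_assoc del: of_real_power)
    moreover have "P *v x = of_real (d a) *s x"
    proof -
      have "dg (\<lambda>i. of_real (d i)) *v axis a 1 = of_real (d a) *s (axis a 1 :: complex^'n)"
        by (simp add: vec_eq_iff axis_def)
      then show ?thesis unfolding d x_def using V(1)
        by (simp add: unitary_cancel smult_mv flip: matrix_vector_mul_assoc)
    qed
    ultimately have "d a * (norm x)\<^sup>2 = (norm (M *v x))\<^sup>2"
      by (simp add: herm_self flip: of_real_mult of_real_power)
    moreover have "(norm (M *v x))\<^sup>2 > 0" using GLC_mv_eq_0[OF M(1)] x0 by simp
    ultimately show ?thesis by (metis zero_less_mult_pos2 x0 zero_less_norm_iff zero_less_power)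
  qed
  define s where "s a = sqrt (d a)" for a
  have s: "s a > 0" for a using dpos by (simp add: s_def)
  define p where "p = V ** dg (\<lambda>a. of_real (s a)) ** adj V"
  have pG: "p \<in> G_cent \<Lambda>" unfolding p_def
    by (rule conj_dg_in_G_cent[OF V(1) l]) (metis s less_irrefl of_real_eq_0_iff)
  then have pGL: "p \<in> GLC" by (simp add: G_cent_iff)
  have adjp: "adj p = p" by (simp add: p_def adj_mult matrix_mul_assoc)
  have pp: "p ** p = P"
  proof -
    have "p ** p = V ** (dg (\<lambda>a. of_real (s a)) ** (adj V ** (V ** (dg (\<lambda>a. of_real (s a)) ** adj V))))"
      by (simp add: p_def matrix_mul_assoc)
    also have "\<dots> = V ** (dg (\<lambda>a. of_real (s a)) ** dg (\<lambda>a. of_real (s a))) ** adj V"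
      using V(1) by (simp only: unitary_cancel matrix_mul_assoc)
    also have "\<dots> = P" unfolding d dg_mult using dpos by (simp add: s_def less_imp_le flip: of_real_mult)
    finally show ?thesis .
  qed
  define k where "k = M ** matrix_inv p"
  have Mkp: "M = k ** p" by (simp add: k_def GLC_cancel[OF pGL])
  have "adj k ** k = mat 1"
  proof -
    have "p ** (adj k ** k) ** p = adj (k ** p) ** (k ** p)" by (simp add: adj_mult adjp matrix_mul_assoc)
    also have "\<dots> = p ** p" unfolding Mkp[symmetric] pp P_def ..
    finally have "matrix_inv p ** (p ** (adj k ** k) ** p) ** matrix_inv p = matrix_inv p ** (p ** p) ** matrix_inv p"
      by simp
    then show ?thesis using GLC_cancel[OF pGL] GLC_inv[OF pGL] by (metis matrix_mul_assoc)
  qed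
  then have "k \<in> unitary_group" by (rule unitaryI)
  moreover have "k \<in> G_cent \<Lambda>" unfolding k_def by (intro G_cent_mult assms G_cent_inv pG)
  ultimately have "k \<in> K_cent \<Lambda>" by (simp add: K_cent_iff G_cent_iff)
  then show ?thesis using that V(1) s l Mkp[unfolded p_def] by blast
qed

text \<open>The matrix \<open>k\<close> is a combination of the Hermitian matrices \<open>k + k\<^sup>*\<close> and \<open>\<i> (k - k\<^sup>*)\<close>, which commute with
  each other and with \<open>\<Lambda>\<close>.\<close>

lemma K_cent_diagonalization:
  fixes k :: "complex^'n^'n"
  assumes "hermitian \<Lambda>" "k \<in> K_cent \<Lambda>"
  obtains V u and l :: "'n \<Rightarrow> real" where "V \<in> unitary_group" "\<And>a. norm (u a) = 1"
    "\<Lambda> = V ** dg (\<lambda>a. of_real (l a)) ** adj V" "k = V ** dg u ** adj V"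
proof -
  have k: "k \<in> unitary_group" "k ** \<Lambda> = \<Lambda> ** k" and adjL: "adj \<Lambda> = \<Lambda>"
    using assms by (auto simp: K_cent_iff hermitian_def)
  have k': "adj k ** \<Lambda> = \<Lambda> ** adj k" by (metis k(2) adjL adj_mult)
  define I where "I = dg (\<lambda>_::'n. \<i>)"
  have I: "I ** X = X ** I" for X by (simp add: I_def vec_eq_iff dg_mult_nth mult_dg_nth mult.commute)
  define H1 where "H1 = k + adj k"
  define H2 where "H2 = I ** (k - adj k)"
  have diff: "(A - B) ** C = A ** C - B ** C" "C ** (A - B) = C ** A - C ** B" for A B C :: "complex^'n^'n"
    by (simp_all add: bounded_bilinear.diff_left[OF bounded_bilinear_mm] bounded_bilinear.diff_right[OF bounded_bilinear_mm])
  have "hermitian H1" "hermitian H2"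
    by (simp_all add: hermitian_def H1_def H2_def vec_eq_iff I_def dg_mult_nth algebra_simps)
  moreover have "H1 ** \<Lambda> = \<Lambda> ** H1" using k(2) k' by (simp add: H1_def mm_add_left matrix_add_ldistrib)
  moreover have "H2 ** \<Lambda> = \<Lambda> ** H2"
  proof -
    have "(k - adj k) ** \<Lambda> = \<Lambda> ** (k - adj k)" using k(2) k' by (simp add: diff)
    then show ?thesis unfolding H2_def by (metis I matrix_mul_assoc)
  qed
  moreover have "H1 ** H2 = H2 ** H1"
  proof -
    have "(k + adj k) ** (k - adj k) = (k - adj k) ** (k + adj k)"
      using k(1) by (simp add: mm_add_left matrix_add_ldistrib diff unitaryD algebra_simps)
    then show ?thesis unfolding H1_def H2_def by (metis I matrix_mul_assoc)
  qed
  ultimately obtain V where V: "V \<in> unitary_group"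
    "\<And>H. H \<in> {\<Lambda>, H1, H2} \<Longrightarrow> \<exists>d :: 'n \<Rightarrow> real. H = V ** dg (\<lambda>i. of_real (d i)) ** adj V"
    using assms(1) by (rule_tac simultaneous_diagonalization[of "{\<Lambda>, H1, H2}"]) auto
  obtain l :: "'n \<Rightarrow> real" where l: "\<Lambda> = V ** dg (\<lambda>i. of_real (l i)) ** adj V" using V(2) by blast
  obtain a :: "'n \<Rightarrow> real" where a: "H1 = V ** dg (\<lambda>i. of_real (a i)) ** adj V" using V(2) by blast
  obtain b :: "'n \<Rightarrow> real" where b: "H2 = V ** dg (\<lambda>i. of_real (b i)) ** adj V" using V(2) by blast
  define N where "N = adj V ** k ** V"
  have kN: "k = V ** N ** adj V" using V(1) by (simp add: N_def matrix_mul_assoc unitary_cancel unitaryD)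
  have N: "N \<in> unitary_group" unfolding N_def using V(1) k(1) by (intro unitary_mult unitary_adj)
  have "N + adj N = adj V ** H1 ** V"
    by (simp add: N_def H1_def adj_mult mm_add_left matrix_add_ldistrib matrix_mul_assoc)
  also have "\<dots> = dg (\<lambda>i. of_real (a i))" using V(1) by (simp add: a matrix_mul_assoc unitary_cancel unitaryD)
  finally have NA: "N + adj N = dg (\<lambda>i. of_real (a i))" .
  have "I ** (N - adj N) = adj V ** H2 ** V"
    by (simp add: N_def H2_def adj_mult diff) (metis I matrix_mul_assoc)
  also have "\<dots> = dg (\<lambda>i. of_real (b i))" using V(1) by (simp add: b matrix_mul_assoc unitary_cancel unitaryD)
  finally have NB: "I ** (N - adj N) = dg (\<lambda>i. of_real (b i))" .
  have off: "N $ i $ j = 0" if "i \<noteq> j" for i j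
  proof -
    have "N $ i $ j + cnj (N $ j $ i) = 0" "\<i> * (N $ i $ j - cnj (N $ j $ i)) = 0"
      using arg_cong[OF NA, of "\<lambda>M. M $ i $ j"] arg_cong[OF NB, of "\<lambda>M. M $ i $ j"] that
      by (simp_all add: I_def dg_mult_nth dg_nth)
    then show ?thesis by simp
  qed
  define u where "u i = N $ i $ i" for i
  have Nd: "N = dg u" using off by (simp add: vec_eq_iff dg_nth u_def)
  have "norm (u i) = 1" for i
  proof -
    have "dg (\<lambda>i. cnj (u i) * u i) = mat 1"
      using unitaryD(1)[OF N] unfolding Nd adj_dg dg_mult .
    from arg_cong[OF this, of "\<lambda>M. M $ i $ i"] have "cnj (u i) * u i = 1"
      by (simp add: dg_nth mat_def)
    then have "norm (cnj (u i) * u i) = 1" by simp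
    then have "(norm (u i))\<^sup>2 = 1" by (simp add: norm_mult power2_eq_square)
    then show ?thesis by (simp add: power2_eq_1_iff)
        (metis norm_ge_zero not_one_le_zero neg_0_le_iff_le)
  qed
  then show ?thesis using that[OF V(1) _ l, of u] kN Nd by simp
qed

text \<open>Both factors of the polar decomposition are exponentials of matrices that are diagonal in
  a unitary basis of eigenvectors of \<open>\<Lambda>\<close>; so these exponentials generate the centraliser.\<close>

lemma G_cent_induct:
  fixes h :: "complex^'n^'n"
  assumes h: "h \<in> G_cent \<Lambda>" "hermitian \<Lambda>"
    and torus: "\<And>V z l. V \<in> unitary_group \<Longrightarrow> \<Lambda> = V ** dg l ** adj V \<Longrightarrow>
      P (V ** dg (\<lambda>a. exp (z a)) ** adj V)"
    and mult: "\<And>a b. a \<in> G_cent \<Lambda> \<Longrightarrow> b \<in> G_cent \<Lambda> \<Longrightarrow> P a \<Longrightarrow> P b \<Longrightarrow> P (a ** b)"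
  shows "P h"
proof -
  have torus': "P (V ** dg u ** adj V)" if "V \<in> unitary_group" "\<Lambda> = V ** dg l ** adj V" "\<And>a. u a \<noteq> 0" for V u l
  proof -
    have "u = (\<lambda>a. exp (Ln (u a)))" using that(3) by simp
    then show ?thesis using torus[OF that(1,2)] by metis
  qed
  obtain k V and s l :: "'n \<Rightarrow> real" where k: "k \<in> K_cent \<Lambda>" "V \<in> unitary_group" "\<And>a. s a > 0"
    "\<Lambda> = V ** dg (\<lambda>a. of_real (l a)) ** adj V" "h = k ** (V ** dg (\<lambda>a. of_real (s a)) ** adj V)"
    using polar_decomposition[OF h(2,1)] by blast
  obtain V' u and l' :: "'n \<Rightarrow> real" where V': "V' \<in> unitary_group" "\<And>a. norm (u a) = 1"
    "\<Lambda> = V' ** dg (\<lambda>a. of_real (l' a)) ** adj V'" "k = V' ** dg u ** adj V'"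
    using K_cent_diagonalization[OF h(2) k(1)] by blast
  have s0: "\<And>a. complex_of_real (s a) \<noteq> 0" using k(3) by (metis less_irrefl of_real_eq_0_iff)
  have u0: "\<And>a. u a \<noteq> 0" using V'(2) by (metis norm_zero zero_neq_one)
  have "P k" unfolding V'(4) by (rule torus'[OF V'(1,3) u0])
  moreover have "P (V ** dg (\<lambda>a. of_real (s a)) ** adj V)" by (rule torus'[OF k(2,4) s0])
  moreover have "V ** dg (\<lambda>a. of_real (s a)) ** adj V \<in> G_cent \<Lambda>"
    by (rule conj_dg_in_G_cent[OF k(2,4) s0])
  ultimately show ?thesis unfolding k(5)
    using mult[OF K_cent_subset_G_cent[OF k(1)]] by blast
qed

section \<open>The exponential of a diagonalisable matrix\<close>

lemma mpow_conj_dg: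
  fixes S :: "complex^'n^'n"
  assumes "S ** S' = mat 1"
  shows "mpow (S ** dg d ** S') k = S ** dg (\<lambda>i. d i ^ k) ** S'"
proof (induction k)
  case 0
  then show ?case using assms by (simp add: mpow_def)
next
  case (Suc k)
  have "mpow (S ** dg d ** S') (Suc k) = (S ** dg d ** S') ** (S ** dg (\<lambda>i. d i ^ k) ** S')"
    using Suc by (simp add: mpow_def)
  also have "\<dots> = S ** (dg d ** (S' ** S) ** dg (\<lambda>i. d i ^ k)) ** S'" by (simp add: matrix_mul_assoc)
  also have "\<dots> = S ** dg (\<lambda>i. d i ^ Suc k) ** S'" using assms mm_left_right[of S S'] by simp
  finally show ?case .
qed

lemma mexp_conj_dg:
  fixes S :: "complex^'n^'n"
  assumes "S ** S' = mat 1"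
  shows "mexp (S ** dg d ** S') = S ** dg (\<lambda>i. exp (d i)) ** S'"
proof -
  have 1: "(\<lambda>N. \<Sum>k<N. d i ^ k /\<^sub>R fact k) \<longlonglongrightarrow> exp (d i)" for i
    using exp_converges[of "d i"] unfolding sums_def .
  have 2: "(\<Sum>k<N. (1 / fact k) *\<^sub>R mpow (S ** dg d ** S') k) = S ** dg (\<lambda>i. \<Sum>k<N. d i ^ k /\<^sub>R fact k) ** S'" for N
  proof (induction N)
    case 0
    have "dg (\<lambda>i. 0) = (0 :: complex^'n^'n)" by (simp add: vec_eq_iff dg_nth)
    then show ?case by simp
  next
    case (Suc N)
    have e: "dg (\<lambda>i. \<Sum>k<Suc N. d i ^ k /\<^sub>R fact k) =
      dg (\<lambda>i. \<Sum>k<N. d i ^ k /\<^sub>R fact k) + (1 / fact N) *\<^sub>R dg (\<lambda>i. d i ^ N)"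
      by (simp add: vec_eq_iff dg_nth divide_inverse)
    show ?case unfolding e using Suc by (simp add: mpow_conj_dg[OF assms] matrix_add_ldistrib mm_add_left
        matrix_scalar_ac scalar_matrix_assoc)
  qed
  have "(\<lambda>k. (1 / fact k) *\<^sub>R mpow (S ** dg d ** S') k) sums (S ** dg (\<lambda>i. exp (d i)) ** S')"
    unfolding sums_def 2 by (intro tendsto_intros 1)
  then show ?thesis unfolding mexp_def by (rule sums_unique[symmetric])
qed

section \<open>Convergence in projective space\<close>

lemma span1: "vec.span {v :: complex^'m} = range (\<lambda>c. c *s v)"
  by (rule vec.span_singleton)

lemma span_eqI: "c \<noteq> 0 \<Longrightarrow> vec.span {c *s v :: complex^'m} = vec.span {v}"
proof -
  assume c: "c \<noteq> 0"
  have "d *s v \<in> range (\<lambda>e. e *s (c *s v))" for d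
    using c by (intro range_eqI[of _ _ "d / c"]) simp
  moreover have "d *s (c *s v) \<in> range (\<lambda>e. e *s v)" for d
    by (intro range_eqI[of _ _ "d * c"]) simp
  ultimately show ?thesis unfolding span1 by blast
qed

lemma span_eqD:
  assumes "vec.span {v :: complex^'m} = vec.span {w}" "v \<noteq> 0"
  obtains c where "c \<noteq> 0" "v = c *s w"
proof -
  have "v \<in> vec.span {w}" using assms(1) vec.span_base[of v "{v}"] by simp
  then obtain c where c: "v = c *s w" unfolding span1 by blast
  with assms(2) have "c \<noteq> 0" by auto
  with c that show ?thesis by blast
qed

lemma act_span: "act M (vec.span {v}) = vec.span {M *v v}"
  by (auto simp: act_def span1 image_iff smult_mv)

lemma proj_spaceE:
  assumes "P \<in> proj_space"
  obtains w where "w \<noteq> 0" "P = vec.span {w}"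
  using assms by (auto simp: proj_space_def)

lemma proj_space_span: "w \<noteq> 0 \<Longrightarrow> vec.span {w} \<in> proj_space"
  by (auto simp: proj_space_def)

text \<open>The cosine of the angle between two lines measures their distance.\<close>

definition cosang :: "complex^'m \<Rightarrow> complex^'m \<Rightarrow> real" where
  "cosang y w = norm (herm y w) / (norm y * norm w)"

lemma cosang_scale: "c \<noteq> 0 \<Longrightarrow> cosang (c *s y) w = cosang y w"
  by (simp add: cosang_def norm_mult)

lemma cosang_le_1: "cosang y w \<le> 1"
  using herm_cauchy[of y w] by (auto simp: cosang_def divide_le_eq_1 less_le)

text \<open>The multiple of \<open>y\<close> that has the length of \<open>w\<close> and a positive product with \<open>w\<close> is close to \<open>w\<close> when the
  cosine is close to \<open>1\<close>.\<close>

lemma align: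
  assumes "y \<noteq> 0" "w \<noteq> 0" "cosang y w \<noteq> 0"
  obtains c where "c \<noteq> 0" "(norm (c *s y - w))\<^sup>2 = 2 * (norm w)\<^sup>2 * (1 - cosang y w)"
proof -
  define h where "h = herm y w"
  have h: "h \<noteq> 0" using assms(3) by (auto simp: cosang_def h_def)
  define c where "c = of_real (norm w / norm y) * (cnj h / of_real (norm h))"
  have c0: "c \<noteq> 0" using h assms by (simp add: c_def)
  have nc: "norm (c *s y) = norm w" using h assms(1) by (simp add: c_def norm_mult norm_divide)
  have "cnj h * h = of_real ((norm h)\<^sup>2)" by (simp add: complex_norm_square mult.commute del: of_real_power)
  then have "herm (c *s y) w = of_real (norm w / norm y) * (of_real ((norm h)\<^sup>2) / of_real (norm h))"
    by (simp add: c_def h_def[symmetric] mult.assoc)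
  also have "\<dots> = of_real ((norm w)\<^sup>2 * cosang y w)"
    using h assms by (simp add: cosang_def h_def[symmetric] power2_eq_square field_simps)
  finally have hz: "herm (c *s y) w = of_real ((norm w)\<^sup>2 * cosang y w)" .
  have "(norm (c *s y - w))\<^sup>2 = inner (c *s y - w) (c *s y - w)" by (rule power2_norm_eq_inner)
  also have "\<dots> = (norm (c *s y))\<^sup>2 + (norm w)\<^sup>2 - 2 * inner (c *s y) w"
    unfolding power2_norm_eq_inner by (simp add: inner_diff_left inner_diff_right inner_commute)
  also have "inner (c *s y) w = (norm w)\<^sup>2 * cosang y w" unfolding inner_herm hz by (rule Re_complex_of_real)
  finally have "(norm (c *s y - w))\<^sup>2 = 2 * (norm w)\<^sup>2 * (1 - cosang y w)"
    unfolding nc by (simp add: algebra_simps)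
  with c0 that show ?thesis by blast
qed

lemma cosang_1D:
  assumes "y \<noteq> 0" "w \<noteq> 0" "cosang y w = 1"
  shows "vec.span {y} = vec.span {w}"
proof -
  obtain c where c: "c \<noteq> 0" "(norm (c *s y - w))\<^sup>2 = 2 * (norm w)\<^sup>2 * (1 - cosang y w)"
    using align[OF assms(1,2)] assms(3) by auto
  then have "c *s y = w" using assms(3) by simp
  then show ?thesis using span_eqI[OF c(1), of y] by simp
qed

lemma tendsto_cosang [tendsto_intros]:
  "(f \<longlongrightarrow> a) F \<Longrightarrow> (g \<longlongrightarrow> b) F \<Longrightarrow> a \<noteq> 0 \<Longrightarrow> b \<noteq> 0 \<Longrightarrow> ((\<lambda>x. cosang (f x) (g x)) \<longlongrightarrow> cosang a b) F"
  unfolding cosang_def by (intro tendsto_intros) auto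

lemma limitin_span_tendsto:
  assumes "(y \<longlongrightarrow> w) F" "w \<noteq> 0"
  shows "limitin proj_top (\<lambda>i. vec.span {y i}) (vec.span {w}) F"
  unfolding limitin_def topspace_proj_top
proof (intro conjI allI impI)
  show "vec.span {w} \<in> proj_space" using assms(2) by (rule proj_space_span)
  fix U assume "openin proj_top U \<and> vec.span {w} \<in> U"
  then have "open {v. v \<noteq> 0 \<and> vec.span {v} \<in> U}" "w \<in> {v. v \<noteq> 0 \<and> vec.span {v} \<in> U}"
    using assms(2) by (auto simp: openin_proj_top)
  from topological_tendstoD[OF assms(1) this] show "\<forall>\<^sub>F i in F. vec.span {y i} \<in> U"
    by (auto elim: eventually_mono)
qed

lemma align_tendsto:
  fixes y :: "'a \<Rightarrow> complex^'m"
  assumes y: "\<forall>\<^sub>F i in F. y i \<noteq> 0" and w: "w \<noteq> 0" and A: "((\<lambda>i. cosang (y i) w) \<longlongrightarrow> 1) F"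
  obtains c where "((\<lambda>i. c i *s y i) \<longlongrightarrow> w) F" "\<forall>\<^sub>F i in F. c i \<noteq> 0"
proof -
  have ev: "\<forall>\<^sub>F i in F. cosang (y i) w > 0" using order_tendstoD(1)[OF A, of 0] by simp
  have "\<exists>c. y i \<noteq> 0 \<and> cosang (y i) w > 0 \<longrightarrow>
      c \<noteq> 0 \<and> (norm (c *s y i - w))\<^sup>2 = 2 * (norm w)\<^sup>2 * (1 - cosang (y i) w)" for i
    using align[OF _ w, of "y i"] by (metis less_irrefl)
  then obtain c where c: "\<And>i. y i \<noteq> 0 \<Longrightarrow> cosang (y i) w > 0 \<Longrightarrow>
      c i \<noteq> 0 \<and> (norm (c i *s y i - w))\<^sup>2 = 2 * (norm w)\<^sup>2 * (1 - cosang (y i) w)" by metis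
  have "((\<lambda>i. sqrt (2 * (norm w)\<^sup>2 * (1 - cosang (y i) w))) \<longlongrightarrow> sqrt (2 * (norm w)\<^sup>2 * (1 - 1))) F"
    by (intro tendsto_intros A)
  moreover have "\<forall>\<^sub>F i in F. norm (c i *s y i - w) = sqrt (2 * (norm w)\<^sup>2 * (1 - cosang (y i) w))"
    using ev y
  proof eventually_elim
    case (elim i)
    then have "(norm (c i *s y i - w))\<^sup>2 = 2 * (norm w)\<^sup>2 * (1 - cosang (y i) w)" using c by blast
    from arg_cong[OF this, of sqrt] show ?case by simp
  qed
  ultimately have "((\<lambda>i. norm (c i *s y i - w)) \<longlongrightarrow> 0) F"
    by (simp add: tendsto_cong)
  then have "((\<lambda>i. c i *s y i) \<longlongrightarrow> w) F"
    by (simp add: tendsto_norm_zero_iff LIM_zero_iff)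
  moreover have "\<forall>\<^sub>F i in F. c i \<noteq> 0" using ev y by eventually_elim (simp add: c)
  ultimately show ?thesis using that by blast
qed

text \<open>The lines whose cosine with \<open>w\<close> exceeds a constant form an open set of the quotient topology. In the
  other direction, representatives rescaled as in \<open>align\<close> converge to \<open>w\<close>.\<close>

lemma limitin_span_iff:
  fixes y :: "'a \<Rightarrow> complex^'m"
  assumes "\<forall>\<^sub>F i in F. y i \<noteq> 0" "w \<noteq> 0"
  shows "limitin proj_top (\<lambda>i. vec.span {y i}) (vec.span {w}) F \<longleftrightarrow> ((\<lambda>i. cosang (y i) w) \<longlongrightarrow> 1) F"
proof
  assume L: "limitin proj_top (\<lambda>i. vec.span {y i}) (vec.span {w}) F"
  show "((\<lambda>i. cosang (y i) w) \<longlongrightarrow> 1) F"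
  proof (rule order_tendstoI)
    fix a :: real assume a: "a < 1"
    define U where "U = {vec.span {v} |v. v \<noteq> 0 \<and> a < cosang v w}"
    have "vec.span {v} \<in> U \<longleftrightarrow> a < cosang v w" if v0: "v \<noteq> 0" for v
    proof
      assume "vec.span {v} \<in> U"
      then obtain u where u: "vec.span {v} = vec.span {u}" "u \<noteq> 0" "a < cosang u w" by (auto simp: U_def)
      obtain c where "c \<noteq> 0" "v = c *s u" using span_eqD[OF u(1) v0] .
      then show "a < cosang v w" using u(3) by (simp add: cosang_scale)
    qed (use v0 in \<open>auto simp: U_def\<close>)
    note memU = this
    have "{v. v \<noteq> 0 \<and> vec.span {v} \<in> U} = {v. v \<noteq> 0} \<inter> {v. a * (norm v * norm w) < norm (herm v w)}"
      using assms(2) by (auto simp: memU cosang_def field_simps)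
    moreover have "open {v :: complex^'m. v \<noteq> 0}"
      by (metis Collect_neg_eq open_Compl closed_singleton singleton_conv)
    moreover have "open {v :: complex^'m. a * (norm v * norm w) < norm (herm v w)}"
      by (intro open_Collect_less) (auto simp: continuous_on_def intro!: tendsto_intros)
    ultimately have "openin proj_top U" by (auto simp: openin_proj_top U_def proj_space_def)
    moreover have "vec.span {w} \<in> U"
      using memU[OF assms(2)] assms(2) a by (simp add: cosang_def herm_self norm_mult power2_eq_square)
    ultimately have "\<forall>\<^sub>F i in F. vec.span {y i} \<in> U" using L by (simp add: limitin_def)
    then show "\<forall>\<^sub>F i in F. a < cosang (y i) w"
      using assms(1) by eventually_elim (simp add: memU)
  next
    fix a :: real assume "1 < a"
    then show "\<forall>\<^sub>F i in F. cosang (y i) w < a"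
      by (intro always_eventually allI) (rule le_less_trans[OF cosang_le_1])
  qed
next
  assume A: "((\<lambda>i. cosang (y i) w) \<longlongrightarrow> 1) F"
  from align_tendsto[OF assms this] obtain c where
    c: "((\<lambda>i. c i *s y i) \<longlongrightarrow> w) F" "\<forall>\<^sub>F i in F. c i \<noteq> 0" .
  from limitin_span_tendsto[OF c(1) assms(2)]
  have "limitin proj_top (\<lambda>i. vec.span {c i *s y i}) (vec.span {w}) F" .
  moreover have "\<forall>\<^sub>F i in F. vec.span {c i *s y i} = vec.span {y i}"
    using c(2) by eventually_elim (simp add: span_eqI)
  ultimately show "limitin proj_top (\<lambda>i. vec.span {y i}) (vec.span {w}) F"
    by (rule limitin_transform_eventually[rotated])
qed

text \<open>The Hausdorff property of projective space.\<close>

lemma limitin_span_unique: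
  fixes y :: "'a \<Rightarrow> complex^'m"
  assumes y: "\<forall>\<^sub>F i in F. y i \<noteq> 0" and "F \<noteq> bot"
    and P: "limitin proj_top (\<lambda>i. vec.span {y i}) P F" and Q: "limitin proj_top (\<lambda>i. vec.span {y i}) Q F"
  shows "P = Q"
proof -
  have "P \<in> proj_space" "Q \<in> proj_space"
    using P Q by (auto simp: limitin_def topspace_proj_top)
  then obtain p q where p: "p \<noteq> 0" "P = vec.span {p}" and q: "q \<noteq> 0" "Q = vec.span {q}"
    by (metis proj_spaceE)
  have A: "((\<lambda>i. cosang (y i) p) \<longlongrightarrow> 1) F" and B: "((\<lambda>i. cosang (y i) q) \<longlongrightarrow> 1) F"
    using P Q limitin_span_iff[OF y] p q by auto
  from align_tendsto[OF y p(1) A] obtain c where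
    c: "((\<lambda>i. c i *s y i) \<longlongrightarrow> p) F" "\<forall>\<^sub>F i in F. c i \<noteq> 0" .
  from c(1) have "((\<lambda>i. cosang (c i *s y i) q) \<longlongrightarrow> cosang p q) F"
    using p q by (intro tendsto_intros)
  moreover have "\<forall>\<^sub>F i in F. cosang (c i *s y i) q = cosang (y i) q"
    using c(2) by eventually_elim (simp add: cosang_scale)
  ultimately have "((\<lambda>i. cosang (y i) q) \<longlongrightarrow> cosang p q) F" by (simp add: tendsto_cong)
  then have "cosang p q = 1" using tendsto_unique[OF assms(2) B] by simp
  then show ?thesis using cosang_1D p q by simp
qed

lemma proj_lim_span:
  fixes y :: "'a \<Rightarrow> complex^'m"
  assumes "\<forall>\<^sub>F i in F. y i \<noteq> 0" "F \<noteq> bot" "limitin proj_top (\<lambda>i. vec.span {y i}) P F"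
  shows "proj_lim (\<lambda>i. vec.span {y i}) F = P"
  unfolding proj_lim_def
  by (rule the_equality, rule assms(3), rule limitin_span_unique[OF assms(1,2) _ assms(3)], assumption)

section \<open>Unitary representations\<close>

text \<open>The Hermitian metric invariant under the unitary group is the standard one of \<open>\<complex>\<^sup>m\<close>.\<close>

locale unitary_rep =
  fixes \<rho> :: "complex^'n^'n \<Rightarrow> complex^'m^'m"
  assumes rep: "complex_rep \<rho>"
    and unitary: "\<And>k. k \<in> unitary_group \<Longrightarrow> \<rho> k \<in> unitary_group"
begin

lemma rho_GLC: "M \<in> GLC \<Longrightarrow> \<rho> M \<in> GLC"
  and rho_mult: "M \<in> GLC \<Longrightarrow> N \<in> GLC \<Longrightarrow> \<rho> (M ** N) = \<rho> M ** \<rho> N"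
  using rep by (simp_all add: complex_rep_def)

lemma rho_1 [simp]: "\<rho> (mat 1) = mat 1"
proof -
  have "\<rho> (mat 1) ** \<rho> (mat 1) = \<rho> (mat 1)" using rho_mult[of "mat 1" "mat 1"] by simp
  then show ?thesis using GLC_cancel(1)[OF rho_GLC[OF GLC_mat1], of "\<rho> (mat 1)"] GLC_inv(2)[OF rho_GLC[OF GLC_mat1]] by simp
qed

lemma rho_inv: "M \<in> GLC \<Longrightarrow> \<rho> (matrix_inv M) = matrix_inv (\<rho> M)"
  by (rule GLC_inv_unique[symmetric]) (simp flip: rho_mult add: GLC_matrix_inv GLC_inv)

lemma rho_adj_unitary: "U \<in> unitary_group \<Longrightarrow> \<rho> (adj U) = adj (\<rho> U)"
  using rho_inv[OF unitary_GLC] unitary_inv unitary by metis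

lemma rho_nz: "M \<in> GLC \<Longrightarrow> w \<noteq> 0 \<Longrightarrow> \<rho> M *v w \<noteq> 0"
  using GLC_mv_eq_0[OF rho_GLC] by blast

lemma tendsto_rho:
  assumes "(f \<longlongrightarrow> M) F" "M \<in> GLC"
  shows "((\<lambda>x. \<rho> (f x)) \<longlongrightarrow> \<rho> M) F"
proof -
  obtain D where "(\<rho> has_derivative D) (at M)" using rep assms(2) by (auto simp: complex_rep_def)
  then have "isCont \<rho> M" by (rule has_derivative_continuous)
  then show ?thesis by (rule isCont_tendsto_compose) (rule assms)
qed

subsection \<open>The derivative at the identity\<close>

text \<open>The infinitesimal representation of the Lie algebra of all matrices.\<close>

definition D :: "complex^'n^'n \<Rightarrow> complex^'m^'m" where
  "D = (SOME D. (\<rho> has_derivative D) (at (mat 1)) \<and> (\<forall>c X. D (mat c ** X) = mat c ** D X))"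

lemma D_deriv: "(\<rho> has_derivative D) (at (mat 1))" and D_mat: "D (mat c ** X) = mat c ** D X"
proof -
  have "\<exists>D. (\<rho> has_derivative D) (at (mat 1)) \<and> (\<forall>c X. D (mat c ** X) = mat c ** D X)"
    using rep GLC_mat1 unfolding complex_rep_def by blast
  from someI_ex[OF this] show "(\<rho> has_derivative D) (at (mat 1))" "D (mat c ** X) = mat c ** D X"
    unfolding D_def[symmetric] by blast+
qed

lemma D_linear: "linear D"
  using D_deriv has_derivative_linear by blast

lemma D_curve:
  assumes "(\<gamma> has_vector_derivative X) (at 0)" "\<gamma> 0 = mat 1"
  shows "((\<lambda>t. \<rho> (\<gamma> t)) has_vector_derivative D X) (at (0::real))"
proof -
  have "(\<rho> has_derivative D) (at (\<gamma> 0))" unfolding assms(2) by (rule D_deriv)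
  from diff_chain_at[OF assms(1)[unfolded has_vector_derivative_def] this]
  show ?thesis unfolding has_vector_derivative_def o_def by (simp add: linear_cmul[OF D_linear])
qed

lemma line_deriv: "((\<lambda>t. mat 1 + t *\<^sub>R X) has_vector_derivative (X :: complex^'n^'n)) (at 0)"
  by (auto intro!: derivative_eq_intros simp: has_vector_derivative_def)

lemma D_line: "((\<lambda>t. \<rho> (mat 1 + t *\<^sub>R X)) has_vector_derivative D X) (at 0)"
  by (rule D_curve[OF line_deriv]) simp

lemma open_line_GLC: "open {t::real. mat 1 + t *\<^sub>R X \<in> (GLC :: (complex^'n^'n) set)}"
proof -
  have "open ((\<lambda>t::real. mat 1 + t *\<^sub>R X) -` (GLC :: (complex^'n^'n) set))"
    by (intro open_vimage open_GLC continuous_intros)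
  then show ?thesis by (simp add: vimage_def)
qed

lemma D_conj:
  assumes g: "g \<in> GLC"
  shows "D (g ** X ** matrix_inv g) = \<rho> g ** D X ** matrix_inv (\<rho> g)"
proof -
  have e: "mat 1 + t *\<^sub>R (g ** X ** matrix_inv g) = g ** (mat 1 + t *\<^sub>R X) ** matrix_inv g" for t
    using GLC_inv[OF g] by (simp add: matrix_add_ldistrib mm_add_left matrix_scalar_ac scalar_matrix_assoc)
  have "bounded_linear (\<lambda>Y. \<rho> g ** Y ** matrix_inv (\<rho> g))"
    by (rule bounded_linear_compose[OF bounded_bilinear.bounded_linear_left[OF bounded_bilinear_mm]
        bounded_bilinear.bounded_linear_right[OF bounded_bilinear_mm]])
  from bounded_linear.has_vector_derivative[OF this D_line]
  have "((\<lambda>t. \<rho> g ** \<rho> (mat 1 + t *\<^sub>R X) ** matrix_inv (\<rho> g)) has_vector_derivative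
      \<rho> g ** D X ** matrix_inv (\<rho> g)) (at 0)" .
  then have "((\<lambda>t. \<rho> (mat 1 + t *\<^sub>R (g ** X ** matrix_inv g))) has_vector_derivative
      \<rho> g ** D X ** matrix_inv (\<rho> g)) (at 0)"
  proof (rule has_vector_derivative_transform_within_open[OF _ open_line_GLC[of X]])
    fix t assume "t \<in> {t. mat 1 + t *\<^sub>R X \<in> GLC}"
    then show "\<rho> g ** \<rho> (mat 1 + t *\<^sub>R X) ** matrix_inv (\<rho> g) = \<rho> (mat 1 + t *\<^sub>R (g ** X ** matrix_inv g))"
      unfolding e using g by (simp add: rho_mult GLC_mult GLC_matrix_inv rho_inv)
  qed simp
  from vector_derivative_unique_at[OF D_line this] show ?thesis .
qed

lemma D_commute:
  assumes "g \<in> GLC" "g ** X = X ** g"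
  shows "\<rho> g ** D X = D X ** \<rho> g"
proof -
  have "g ** X ** matrix_inv g = X" by (simp add: assms GLC_cancel)
  then have "\<rho> g ** D X ** matrix_inv (\<rho> g) ** \<rho> g = D X ** \<rho> g" using D_conj[OF assms(1), of X] by simp
  then show ?thesis by (simp add: GLC_cancel rho_GLC assms(1))
qed

text \<open>Differentiate \<open>D (g Y g\<inverse>) = \<rho> g D Y \<rho> g\<inverse>\<close> at \<open>s = 0\<close> for \<open>g = 1 + s X\<close>. When \<open>X\<^sup>2 = 0\<close> the inverse is
  \<open>1 - s X\<close>, so that the conjugate is a polynomial in \<open>s\<close>; the elementary matrices off the diagonal are
  of this kind.\<close>

lemma D_bracket:
  assumes X: "X ** X = 0"
  shows "D X ** D Y = D Y ** D X + D (X ** Y - Y ** X)"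
proof -
  have inv: "(mat 1 + s *\<^sub>R X) ** (mat 1 - s *\<^sub>R X) = mat 1" for s
    by (simp add: matrix_add_ldistrib mm_add_left matrix_scalar_ac bounded_bilinear.diff_right[OF bounded_bilinear_mm]
        scalar_matrix_assoc[symmetric] X)
  have e: "\<rho> (mat 1 + s *\<^sub>R X) ** D Y =
      (D Y + s *\<^sub>R D (X ** Y - Y ** X) - (s * s) *\<^sub>R D (X ** Y ** X)) ** \<rho> (mat 1 + s *\<^sub>R X)" for s
  proof -
    let ?g = "mat 1 + s *\<^sub>R X"
    have g: "?g \<in> GLC" using GLC_I[OF inv] .
    have "?g ** Y ** matrix_inv ?g = Y + s *\<^sub>R (X ** Y - Y ** X) - (s * s) *\<^sub>R (X ** Y ** X)"
      unfolding GLC_inv_unique[OF inv]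
      by (simp add: matrix_add_ldistrib mm_add_left matrix_scalar_ac bounded_bilinear.diff_right[OF bounded_bilinear_mm]
        scalar_matrix_assoc[symmetric] algebra_simps)
    then have "D (?g ** Y ** matrix_inv ?g) = D Y + s *\<^sub>R D (X ** Y - Y ** X) - (s * s) *\<^sub>R D (X ** Y ** X)"
      by (simp only: linear_add[OF D_linear] linear_diff[OF D_linear] linear_cmul[OF D_linear])
    then have "\<rho> ?g ** D Y ** matrix_inv (\<rho> ?g) ** \<rho> ?g =
      (D Y + s *\<^sub>R D (X ** Y - Y ** X) - (s * s) *\<^sub>R D (X ** Y ** X)) ** \<rho> ?g"
      using D_conj[OF g, of Y] by simp
    then show ?thesis by (simp add: GLC_cancel rho_GLC g)
  qed
  have 1: "((\<lambda>s. \<rho> (mat 1 + s *\<^sub>R X) ** D Y) has_vector_derivative D X ** D Y) (at 0)"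
    by (rule bounded_linear.has_vector_derivative[OF bounded_bilinear.bounded_linear_left[OF bounded_bilinear_mm] D_line])
  have "((\<lambda>s::real. D Y + s *\<^sub>R D (X ** Y - Y ** X) - (s * s) *\<^sub>R D (X ** Y ** X)) has_vector_derivative D (X ** Y - Y ** X)) (at 0)"
    by (auto intro!: derivative_eq_intros simp: has_vector_derivative_def)
  from bounded_bilinear.has_vector_derivative[OF bounded_bilinear_mm this D_line[of X]]
  have 2: "((\<lambda>s. \<rho> (mat 1 + s *\<^sub>R X) ** D Y) has_vector_derivative D Y ** D X + D (X ** Y - Y ** X)) (at 0)"
    unfolding e by simp
  from vector_derivative_unique_at[OF 1 2] show ?thesis .
qed

end

subsection \<open>Weights\<close>

definition Emat :: "'n \<Rightarrow> 'n \<Rightarrow> complex^'n^'n" where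
  "Emat a b = (\<chi> i j. if i = a \<and> j = b then 1 else 0)"

lemma Emat_nth: "Emat a b $ i $ j = (if i = a \<and> j = b then 1 else 0)"
  by (simp add: Emat_def)

lemma mat_nth: "mat c $ i $ j = (if i = j then c else 0)"
  by (simp add: mat_def)

lemma mat_dg: "(mat c :: complex^'n^'n) = dg (\<lambda>_. c)"
  by (simp add: vec_eq_iff mat_nth dg_nth)

lemma mat_mult_nth: "((mat c :: complex^'n^'n) ** M) $ i $ j = c * M $ i $ j"
  by (simp add: mat_dg dg_mult_nth)

lemma mat_mult_mv: "((mat c :: complex^'n^'n) ** M) *v x = c *s (M *v x)"
  by (simp add: vec_eq_iff matrix_vector_mult_def mat_mult_nth sum_distrib_left mult_ac)

lemma mat_commute: "(mat c :: complex^'n^'n) ** M = M ** mat c"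
  by (simp add: mat_dg vec_eq_iff dg_mult_nth mult_dg_nth mult.commute)

lemma adj_Emat [simp]: "adj (Emat a b) = Emat b a"
  by (auto simp: vec_eq_iff Emat_nth)

lemma Emat_mult: "Emat a b ** Emat c d = (if b = c then Emat a d else 0)"
proof -
  have "(Emat a b ** Emat c d) $ i $ j = (if b = c then Emat a d else 0) $ i $ j" for i j
  proof -
    have "(Emat a b ** Emat c d) $ i $ j = (\<Sum>k\<in>UNIV. Emat a b $ i $ k * Emat c d $ k $ j)"
      by (simp add: matrix_matrix_mult_def)
    also have "\<dots> = (\<Sum>k\<in>UNIV. if k = b then (if i = a \<and> b = c \<and> j = d then 1 else 0) else 0)"
      by (rule sum.cong) (auto simp: Emat_nth)
    finally show ?thesis by (auto simp: Emat_nth)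
  qed
  then show ?thesis by (subst vec_eq_iff)+ blast
qed

lemma matrix_Emat_sum: "X = (\<Sum>a\<in>UNIV. \<Sum>b\<in>UNIV. mat (X $ a $ b) ** Emat a b)"
proof -
  have "(\<Sum>a\<in>UNIV. \<Sum>b\<in>UNIV. mat (X $ a $ b) ** Emat a b) $ i $ j = X $ i $ j" for i j
  proof -
    have "(\<Sum>a\<in>UNIV. \<Sum>b\<in>UNIV. mat (X $ a $ b) ** Emat a b) $ i $ j
      = (\<Sum>a\<in>UNIV. \<Sum>b\<in>UNIV. X $ a $ b * Emat a b $ i $ j)"
      by (simp add: mat_mult_nth)
    also have "\<dots> = (\<Sum>a\<in>UNIV. if a = i then X $ i $ j else 0)"
    proof (rule sum.cong[OF refl])
      fix a
      have "(\<Sum>b\<in>UNIV. X $ a $ b * Emat a b $ i $ j) = (\<Sum>b\<in>UNIV. if b = j then (if a = i then X $ i $ j else 0) else 0)"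
        by (rule sum.cong) (auto simp: Emat_nth)
      then show "(\<Sum>b\<in>UNIV. X $ a $ b * Emat a b $ i $ j) = (if a = i then X $ i $ j else 0)" by simp
    qed
    finally show ?thesis by simp
  qed
  then show ?thesis by (subst vec_eq_iff)+ metis
qed

text \<open>The one-parameter groups \<open>s \<mapsto> exp (s E\<^bsub>aa\<^esub>)\<close>, which generate the torus of diagonal matrices.\<close>

definition one_par :: "'n \<Rightarrow> complex \<Rightarrow> complex^'n^'n" where
  "one_par a s = dg (\<lambda>i. if i = a then exp s else 1)"

lemma one_par_GLC: "one_par a s \<in> GLC"
  unfolding one_par_def by (rule GLC_dg) simp

lemma one_par_0 [simp]: "one_par a 0 = mat 1"
  by (simp add: one_par_def cong: if_cong)

lemma one_par_add: "one_par a (s + t) = one_par a s ** one_par a t"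
  by (simp add: one_par_def vec_eq_iff dg_nth exp_add)

lemma bounded_linear_mat_mult: "bounded_linear (\<lambda>c. mat c ** (X :: complex^'n^'n))"
  unfolding linear_conv_bounded_linear[symmetric] linear_iff
  by (auto simp: vec_eq_iff mat_mult_nth algebra_simps)

lemma one_par_deriv: "(one_par a has_derivative (\<lambda>h. mat h ** Emat a a)) (at 0)"
proof -
  have e: "one_par a = (\<lambda>s. mat 1 + mat (exp s - 1) ** Emat a a)"
    by (auto simp: fun_eq_iff vec_eq_iff one_par_def dg_nth mat_mult_nth Emat_nth mat_nth[of 1])
  have "((\<lambda>s::complex. exp s - 1) has_derivative (\<lambda>h. h)) (at 0)"
    by (auto intro!: derivative_eq_intros)
  from bounded_linear.has_derivative[OF bounded_linear_mat_mult this, of "Emat a a"]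
  have "((\<lambda>s. mat 1 + mat (exp s - 1) ** Emat a a) has_derivative (\<lambda>h. 0 + mat h ** Emat a a)) (at 0)"
    by (intro has_derivative_add has_derivative_const)
  then show ?thesis unfolding e by simp
qed

context unitary_rep
begin

lemma rho_one_par_deriv: "((\<lambda>s. \<rho> (one_par a s)) has_derivative (\<lambda>h. mat h ** D (Emat a a))) (at 0)"
proof -
  have "(\<rho> has_derivative D) (at (one_par a 0))" by (simp add: D_deriv)
  from diff_chain_at[OF one_par_deriv this] show ?thesis by (simp add: o_def D_mat)
qed

text \<open>The curve \<open>t \<mapsto> \<rho> (exp (\<i> t E\<^bsub>aa\<^esub>))\<close> is unitary, so its derivative \<open>\<i> D E\<^bsub>aa\<^esub>\<close> is skew-Hermitian.\<close>

lemma hermitian_D_Emat: "hermitian (D (Emat a a))"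
proof -
  define H where "H = D (Emat a a)"
  define R where "R t = \<rho> (one_par a (\<i> * of_real t))" for t
  have "((\<lambda>t::real. \<i> * of_real t) has_derivative (\<lambda>h. \<i> * of_real h)) (at 0)"
    by (auto intro!: derivative_eq_intros)
  moreover have "((\<lambda>s. \<rho> (one_par a s)) has_derivative (\<lambda>h. mat h ** H)) (at (\<i> * of_real 0))"
    using rho_one_par_deriv by (simp add: H_def)
  ultimately have "((\<lambda>s. \<rho> (one_par a s)) \<circ> (\<lambda>t::real. \<i> * of_real t) has_derivative (\<lambda>h. mat h ** H) \<circ> (\<lambda>h. \<i> * of_real h)) (at 0)"
    by (rule diff_chain_at)
  moreover have "mat (\<i> * of_real h) ** H = h *\<^sub>R (mat \<i> ** H)" for h
    by (simp add: vec_eq_iff mat_mult_nth scaleR_conv_of_real[where 'a=complex] mult_ac)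
  ultimately have R': "(R has_vector_derivative mat \<i> ** H) (at 0)"
    by (simp add: has_vector_derivative_def o_def R_def[abs_def])
  have R0: "R 0 = mat 1" by (simp add: R_def)
  have "one_par a (\<i> * of_real t) \<in> unitary_group" for t
    unfolding one_par_def by (rule dg_unitary) (simp add: norm_exp_eq_Re)
  then have "adj (R t) ** R t = mat 1" for t unfolding R_def by (intro unitaryD unitary)
  then have "((\<lambda>t. mat 1) has_vector_derivative adj (R 0) ** (mat \<i> ** H) + adj (mat \<i> ** H) ** R 0) (at 0)"
    using bounded_bilinear.has_vector_derivative[OF bounded_bilinear_mm
        bounded_linear.has_vector_derivative[OF bounded_linear_adj R'] R'] by simp
  then have "adj (R 0) ** (mat \<i> ** H) + adj (mat \<i> ** H) ** R 0 = 0"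
    using vector_derivative_unique_at has_vector_derivative_const by blast
  then have z: "mat \<i> ** H + adj (mat \<i> ** H) = 0" by (simp add: R0)
  have "adj H $ i $ j = H $ i $ j" for i j
  proof -
    have "(mat \<i> ** H + adj (mat \<i> ** H)) $ i $ j = 0" by (simp add: z)
    then have "\<i> * (H $ i $ j - cnj (H $ j $ i)) = 0" by (simp add: mat_mult_nth algebra_simps)
    then show ?thesis by simp
  qed
  then have "adj H = H" by (subst vec_eq_iff)+ blast
  then show ?thesis by (simp add: hermitian_def H_def)
qed

lemma D_Emat_commute: "D (Emat a a) ** D (Emat b b) = D (Emat b b) ** D (Emat a a)"
proof (cases "a = b")
  case False
  have e: "\<rho> (mat 1 + t *\<^sub>R Emat a a) ** D (Emat b b) = D (Emat b b) ** \<rho> (mat 1 + t *\<^sub>R Emat a a)"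
    if "t \<in> {t. mat 1 + t *\<^sub>R Emat a a \<in> GLC}" for t
    using that False by (intro D_commute)
      (simp_all add: mm_add_left matrix_add_ldistrib matrix_scalar_ac scalar_matrix_assoc[symmetric] Emat_mult)
  have 1: "((\<lambda>t. \<rho> (mat 1 + t *\<^sub>R Emat a a) ** D (Emat b b)) has_vector_derivative D (Emat a a) ** D (Emat b b)) (at 0)"
    by (rule bounded_linear.has_vector_derivative[OF bounded_bilinear.bounded_linear_left[OF bounded_bilinear_mm] D_line])
  have "((\<lambda>t. D (Emat b b) ** \<rho> (mat 1 + t *\<^sub>R Emat a a)) has_vector_derivative D (Emat b b) ** D (Emat a a)) (at 0)"
    by (rule bounded_linear.has_vector_derivative[OF bounded_bilinear.bounded_linear_right[OF bounded_bilinear_mm] D_line])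
  then have 2: "((\<lambda>t. \<rho> (mat 1 + t *\<^sub>R Emat a a) ** D (Emat b b)) has_vector_derivative D (Emat b b) ** D (Emat a a)) (at 0)"
    by (rule has_vector_derivative_transform_within_open[OF _ open_line_GLC[of "Emat a a"]]) (simp_all add: e)
  show ?thesis by (rule vector_derivative_unique_at[OF 1 2])
qed simp

text \<open>The coordinates of the left hand side satisfy the differential equation \<open>c' = m c\<close> in the complex
  variable \<open>s\<close>.\<close>

lemma rho_one_par_eigenvector:
  assumes f: "D (Emat a a) *v f = m *s f"
  shows "\<rho> (one_par a s) *v f = exp (s * m) *s f"
proof -
  define c where "c s = \<rho> (one_par a s) *v f" for s
  have bl: "bounded_linear (\<lambda>M. (N *v (M *v f)) $ i)" for N :: "complex^'m^'m" and i
    by (rule bounded_linear_compose[OF bounded_linear_vec_nth bounded_linear_compose[OF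
      bounded_bilinear.bounded_linear_right[OF bounded_bilinear_mv]
      bounded_bilinear.bounded_linear_left[OF bounded_bilinear_mv]]])
  have dc: "((\<lambda>s. c s $ i) has_field_derivative m * c s $ i) (at s)" for i s
  proof -
    have "((\<lambda>h. (\<rho> (one_par a s) *v (\<rho> (one_par a h) *v f)) $ i) has_derivative
        (\<lambda>h. (\<rho> (one_par a s) *v ((mat h ** D (Emat a a)) *v f)) $ i)) (at 0)"
      by (rule bounded_linear.has_derivative[OF bl rho_one_par_deriv])
    moreover have "\<rho> (one_par a s) *v (\<rho> (one_par a h) *v f) = c (h + s)" for h
      by (simp add: c_def add.commute[of h s] one_par_add rho_mult one_par_GLC matrix_vector_mul_assoc)
    moreover have "(\<rho> (one_par a s) *v ((mat h ** D (Emat a a)) *v f)) $ i = m * c s $ i * h" for h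
      by (simp add: mat_mult_mv f smult_mv c_def)
    ultimately have "((\<lambda>h. c (h + s) $ i) has_field_derivative m * c s $ i) (at 0)"
      by (simp add: has_field_derivative_def)
    then show ?thesis using DERIV_shift[of "\<lambda>s. c s $ i" _ 0 s] by simp
  qed
  have "exp (- (s * m)) * c s $ i = exp (- (0 * m)) * c 0 $ i" for i
  proof -
    have "\<exists>k. \<forall>s\<in>UNIV. exp (- (s * m)) * c s $ i = k"
    proof (rule has_field_derivative_zero_constant)
      show "((\<lambda>s. exp (- (s * m)) * c s $ i) has_field_derivative 0) (at x within UNIV)" for x
        by (auto intro!: derivative_eq_intros dc simp: algebra_simps)
    qed simp
    then show ?thesis by (metis UNIV_I)
  qed
  then have "exp (s * m) * (exp (- (s * m)) * c s $ i) = exp (s * m) * f $ i" for i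
    by (simp add: c_def)
  then have "c s $ i = exp (s * m) * f $ i" for i
    by (simp add: mult.assoc[symmetric] exp_minus)
  then show ?thesis by (simp add: vec_eq_iff c_def)
qed

text \<open>The operators \<open>D E\<^bsub>aa\<^esub>\<close> are Hermitian and commute, so they have a common orthonormal eigenbasis, the
  columns of \<open>W\<close>. Their eigenvalues are integers because \<open>exp (2 \<pi> \<i> E\<^bsub>aa\<^esub>) = 1\<close>.\<close>

lemma weights_exist:
  "\<exists>(W :: complex^'m^'m) (wt :: 'm \<Rightarrow> 'n \<Rightarrow> int). W \<in> unitary_group \<and>
     (\<forall>z. \<rho> (dg (\<lambda>a. exp (z a))) = W ** dg (\<lambda>j. exp (\<Sum>a\<in>UNIV. z a * of_int (wt j a))) ** adj W) \<and>
     (\<forall>x. D (dg x) = W ** dg (\<lambda>j. \<Sum>a\<in>UNIV. x a * of_int (wt j a)) ** adj W)"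
proof -
  obtain W where W: "W \<in> unitary_group" "\<And>H. H \<in> range (\<lambda>a. D (Emat a a)) \<Longrightarrow>
      \<exists>d :: 'm \<Rightarrow> real. H = W ** dg (\<lambda>i. of_real (d i)) ** adj W"
    by (rule simultaneous_diagonalization[of "range (\<lambda>a. D (Emat a a))"])
      (auto intro: hermitian_D_Emat D_Emat_commute)
  obtain d :: "'n \<Rightarrow> 'm \<Rightarrow> real" where d: "\<And>a. D (Emat a a) = W ** dg (\<lambda>j. of_real (d a j)) ** adj W"
  proof -
    have "\<forall>a. \<exists>d :: 'm \<Rightarrow> real. D (Emat a a) = W ** dg (\<lambda>j. of_real (d j)) ** adj W"
      using W(2) by blast
    from choice[OF this] show ?thesis using that by blast
  qed
  define f where "f j = W *v axis j 1" for j
  have f0: "f j \<noteq> 0" for j unfolding f_def using W(1) by (simp add: GLC_mv_eq_0 unitary_GLC axis_eq_0_iff)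
  have dgax: "dg x *v axis j 1 = x j *s (axis j 1 :: complex^'m)" for x j
    by (simp add: vec_eq_iff axis_def)
  have Df: "D (Emat a a) *v f j = of_real (d a j) *s f j" for a j
    unfolding d f_def by (simp add: unitary_cancel[OF W(1)] dgax smult_mv flip: matrix_vector_mul_assoc)
  have "\<exists>n::int. d a j = of_int n" for a j
  proof -
    have "one_par a (2 * of_real pi * \<i>) = mat 1"
      by (simp add: one_par_def exp_two_pi_i cong: if_cong)
    then have e: "f j = exp (2 * of_real pi * \<i> * of_real (d a j)) *s f j"
      using rho_one_par_eigenvector[OF Df, of a "2 * of_real pi * \<i>" j] by simp
    obtain i where i: "f j $ i \<noteq> 0" using f0[of j] by (auto simp: vec_eq_iff)
    have "exp (2 * of_real pi * \<i> * of_real (d a j)) * f j $ i = 1 * f j $ i"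
      using arg_cong[OF e[symmetric], of "\<lambda>v. v $ i"] by (simp only: vector_smult_component mult_1_left)
    then have "exp (2 * of_real pi * \<i> * of_real (d a j)) = 1"
      unfolding mult_right_cancel[OF i] .
    then obtain n :: int where "2 * pi * d a j = of_int (2 * n) * pi" by (auto simp: exp_eq_1)
    then have "d a j = of_int n" by simp
    then show ?thesis by blast
  qed
  note int_d = this
  define wt where "wt j a = \<lfloor>d a j\<rfloor>" for j a
  have wt: "d a j = of_int (wt j a)" for a j unfolding wt_def using int_d[of a j] by auto
  have inW: "M = W ** dg x ** adj W" if "\<And>j. M *v f j = x j *s f j" for M x
  proof -
    have "(M ** W) $ i $ j = (W ** dg x) $ i $ j" for i j
    proof -
      have "(M ** W) $ i $ j = (M *v f j) $ i"
        unfolding f_def matrix_vector_mul_assoc by (simp add: mv_axis)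
      also have "\<dots> = (x j *s f j) $ i" unfolding that ..
      also have "\<dots> = W $ i $ j * x j" by (simp add: f_def mv_axis)
      finally show ?thesis by (simp add: mult_dg_nth)
    qed
    then have "M ** W = W ** dg x" by (subst vec_eq_iff)+ blast
    then show ?thesis using unitary_cancel(3)[OF W(1), of M] by simp
  qed
  have T: "\<rho> (dg (\<lambda>i. if i \<in> A then exp (z i) else 1)) *v f j = exp (\<Sum>a\<in>A. z a * of_int (wt j a)) *s f j"
    if "finite A" for A z j
    using that
  proof induction
    case (insert a A)
    have "dg (\<lambda>i. if i \<in> insert a A then exp (z i) else 1) = one_par a (z a) ** dg (\<lambda>i. if i \<in> A then exp (z i) else 1)"
      using insert(2) by (auto simp: one_par_def vec_eq_iff dg_nth)
    moreover have "dg (\<lambda>i. if i \<in> A then exp (z i) else 1) \<in> GLC" by (rule GLC_dg) simp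
    ultimately have "\<rho> (dg (\<lambda>i. if i \<in> insert a A then exp (z i) else 1)) *v f j =
        \<rho> (one_par a (z a)) *v (exp (\<Sum>a\<in>A. z a * of_int (wt j a)) *s f j)"
      using insert.IH by (simp add: rho_mult one_par_GLC flip: matrix_vector_mul_assoc)
    also have "\<dots> = exp (\<Sum>a\<in>insert a A. z a * of_int (wt j a)) *s f j"
      using insert(1,2) rho_one_par_eigenvector[OF Df, of a "z a" j]
      by (simp add: smult_mv wt exp_add mult.commute)
    finally show ?case .
  qed simp
  have "\<rho> (dg (\<lambda>a. exp (z a))) *v f j = exp (\<Sum>a\<in>UNIV. z a * of_int (wt j a)) *s f j" for z j
    using T[of UNIV z j] by simp
  then have "\<rho> (dg (\<lambda>a. exp (z a))) = W ** dg (\<lambda>j. exp (\<Sum>a\<in>UNIV. z a * of_int (wt j a))) ** adj W" for z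
    by (rule inW)
  moreover have "D (dg x) = W ** dg (\<lambda>j. \<Sum>a\<in>UNIV. x a * of_int (wt j a)) ** adj W" for x
  proof (rule inW)
    fix j
    have "dg x = (\<Sum>a\<in>UNIV. mat (x a) ** Emat a a)"
    proof -
      have "dg x $ i $ k = (\<Sum>a\<in>UNIV. mat (x a) ** Emat a a) $ i $ k" for i k
      proof -
        have "(\<Sum>a\<in>UNIV. mat (x a) ** Emat a a) $ i $ k = (\<Sum>a\<in>UNIV. x a * Emat a a $ i $ k)"
          by (simp add: mat_mult_nth)
        also have "\<dots> = (\<Sum>a\<in>UNIV. if a = i then (if k = i then x i else 0) else 0)"
          by (rule sum.cong) (auto simp: Emat_nth)
        finally show ?thesis by (auto simp: dg_nth)
      qed
      then show ?thesis by (subst vec_eq_iff)+ blast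
    qed
    then have "D (dg x) = (\<Sum>a\<in>UNIV. mat (x a) ** D (Emat a a))"
      by (simp add: linear_sum[OF D_linear] D_mat)
    then have "D (dg x) *v f j = (\<Sum>a\<in>UNIV. (mat (x a) ** D (Emat a a)) *v f j)"
      by (simp add: bounded_bilinear.sum_left[OF bounded_bilinear_mv])
    also have "\<dots> = (\<Sum>a\<in>UNIV. (x a * of_int (wt j a)) *s f j)"
      by (simp add: mat_mult_mv Df wt)
    also have "\<dots> = (\<Sum>a\<in>UNIV. x a * of_int (wt j a)) *s f j"
      by (simp add: vec_eq_iff sum_distrib_right)
    finally show "D (dg x) *v f j = (\<Sum>a\<in>UNIV. x a * of_int (wt j a)) *s f j" .
  qed
  ultimately show ?thesis using W(1) by blast
qed

definition weight_data :: "(complex^'m^'m) \<times> ('m \<Rightarrow> 'n \<Rightarrow> int)" where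
  "weight_data = (SOME p. fst p \<in> unitary_group \<and>
     (\<forall>z. \<rho> (dg (\<lambda>a. exp (z a))) = fst p ** dg (\<lambda>j. exp (\<Sum>a\<in>UNIV. z a * of_int (snd p j a))) ** adj (fst p)) \<and>
     (\<forall>x. D (dg x) = fst p ** dg (\<lambda>j. \<Sum>a\<in>UNIV. x a * of_int (snd p j a)) ** adj (fst p)))"

text \<open>The columns of \<open>W\<close> are an orthonormal basis of weight vectors of the diagonal torus, and \<open>wt j\<close> is
  the weight of the \<open>j\<close>-th one.\<close>

definition "W = fst weight_data"
definition "wt = snd weight_data"

lemma W_unitary: "W \<in> unitary_group"
  and rho_dg_exp: "\<rho> (dg (\<lambda>a. exp (z a))) = W ** dg (\<lambda>j. exp (\<Sum>a\<in>UNIV. z a * of_int (wt j a))) ** adj W"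
  and D_dg: "D (dg x) = W ** dg (\<lambda>j. \<Sum>a\<in>UNIV. x a * of_int (wt j a)) ** adj W"
proof -
  have "\<exists>p :: (complex^'m^'m) \<times> ('m \<Rightarrow> 'n \<Rightarrow> int). fst p \<in> unitary_group \<and>
     (\<forall>z. \<rho> (dg (\<lambda>a. exp (z a))) = fst p ** dg (\<lambda>j. exp (\<Sum>a\<in>UNIV. z a * of_int (snd p j a))) ** adj (fst p)) \<and>
     (\<forall>x. D (dg x) = fst p ** dg (\<lambda>j. \<Sum>a\<in>UNIV. x a * of_int (snd p j a)) ** adj (fst p))"
    using weights_exist by simp
  from someI_ex[OF this, folded weight_data_def, folded W_def wt_def]
  show "W \<in> unitary_group"
    "\<rho> (dg (\<lambda>a. exp (z a))) = W ** dg (\<lambda>j. exp (\<Sum>a\<in>UNIV. z a * of_int (wt j a))) ** adj W"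
    "D (dg x) = W ** dg (\<lambda>j. \<Sum>a\<in>UNIV. x a * of_int (wt j a)) ** adj W" by blast+
qed

definition coord :: "'m \<Rightarrow> complex^'m \<Rightarrow> complex" where
  "coord j v = (adj W *v v) $ j"

lemma coord_eqI: "(\<And>j. coord j u = coord j v) \<Longrightarrow> u = v"
proof -
  assume "\<And>j. coord j u = coord j v"
  then have "adj W *v u = adj W *v v" by (simp add: vec_eq_iff coord_def)
  then have "W *v (adj W *v u) = W *v (adj W *v v)" by simp
  then show "u = v" by (simp add: unitary_cancel W_unitary)
qed

lemma coord_simps [simp]:
  "coord j 0 = 0" "coord j (c *s v) = c * coord j v" "coord j (u + v) = coord j u + coord j v"
  by (simp_all add: coord_def smult_mv matrix_vector_right_distrib)

lemma coord_W [simp]: "coord j (W *v x) = x $ j"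
  by (simp add: coord_def unitary_cancel W_unitary)

lemma coord_nonzero: "v \<noteq> 0 \<Longrightarrow> \<exists>j. coord j v \<noteq> 0"
  using coord_eqI[of v 0] by auto

lemma tendsto_coord [tendsto_intros]: "(f \<longlongrightarrow> v) F \<Longrightarrow> ((\<lambda>x. coord j (f x)) \<longlongrightarrow> coord j v) F"
  unfolding coord_def by (intro tendsto_intros)

lemma coord_rho_dg: "coord j (\<rho> (dg (\<lambda>a. exp (z a))) *v v) = exp (\<Sum>a\<in>UNIV. z a * of_int (wt j a)) * coord j v"
  by (simp add: coord_def rho_dg_exp unitary_cancel W_unitary flip: matrix_vector_mul_assoc)

lemma coord_D_dg: "coord j (D (dg x) *v v) = (\<Sum>a\<in>UNIV. x a * of_int (wt j a)) * coord j v"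
  by (simp add: coord_def D_dg unitary_cancel W_unitary flip: matrix_vector_mul_assoc)

subsection \<open>Adjoints\<close>

text \<open>By the polar decomposition it is enough to know this for unitary matrices and for positive diagonal
  ones; the latter act by real diagonal matrices in the weight basis.\<close>

lemma rho_adj:
  assumes "h \<in> GLC"
  shows "\<rho> (adj h) = adj (\<rho> h)"
proof -
  have "h \<in> G_cent (mat 1)" using assms by (simp add: G_cent_iff)
  moreover have "hermitian (mat 1 :: complex^'n^'n)" by (simp add: hermitian_def)
  ultimately obtain k V and s :: "'n \<Rightarrow> real" where k: "k \<in> K_cent (mat 1)" "V \<in> unitary_group" "\<And>a. s a > 0"
    "h = k ** (V ** dg (\<lambda>a. of_real (s a)) ** adj V)"
    using polar_decomposition[of "mat 1" h] by metis
  define S where "S = dg (\<lambda>a. exp (complex_of_real (ln (s a))))"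
  have Sdef: "S = dg (\<lambda>a. of_real (s a))" unfolding S_def by (simp add: k(3) exp_of_real)
  have SG: "S \<in> GLC" unfolding S_def by (rule GLC_dg) simp
  have kU: "k \<in> unitary_group" using k(1) by (simp add: K_cent_iff)
  have adjS: "adj (\<rho> S) = \<rho> S"
    unfolding S_def rho_dg_exp by (simp add: adj_mult matrix_mul_assoc exp_cnj)
  have G: "k \<in> GLC" "V \<in> GLC" "adj V \<in> GLC" "adj k \<in> GLC" using kU k(2) by (auto intro: unitary_GLC unitary_adj)
  have h: "h = k ** (V ** S ** adj V)" unfolding Sdef by (rule k)
  have "adj h = V ** S ** adj V ** adj k" unfolding h by (simp add: adj_mult matrix_mul_assoc Sdef)
  then have "\<rho> (adj h) = \<rho> V ** \<rho> S ** \<rho> (adj V) ** \<rho> (adj k)"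
    using G SG by (simp add: rho_mult GLC_mult)
  also have "\<dots> = adj (\<rho> k ** (\<rho> V ** \<rho> S ** \<rho> (adj V)))"
    using kU k(2) by (simp add: adj_mult rho_adj_unitary adjS matrix_mul_assoc)
  also have "\<rho> k ** (\<rho> V ** \<rho> S ** \<rho> (adj V)) = \<rho> h"
    unfolding h using G SG by (simp add: rho_mult GLC_mult)
  finally show ?thesis .
qed

lemma D_adj: "D (adj X) = adj (D X)"
proof -
  have e: "adj (\<rho> (mat 1 + t *\<^sub>R X)) = \<rho> (mat 1 + t *\<^sub>R adj X)" if "t \<in> {t. mat 1 + t *\<^sub>R X \<in> GLC}" for t
  proof -
    have "adj (mat 1 + t *\<^sub>R X) = mat 1 + t *\<^sub>R adj X" by (simp add: vec_eq_iff mat_def)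
    then show ?thesis using rho_adj[of "mat 1 + t *\<^sub>R X"] that by simp
  qed
  have "((\<lambda>t. adj (\<rho> (mat 1 + t *\<^sub>R X))) has_vector_derivative adj (D X)) (at 0)"
    by (rule bounded_linear.has_vector_derivative[OF bounded_linear_adj D_line])
  then have "((\<lambda>t. \<rho> (mat 1 + t *\<^sub>R adj X)) has_vector_derivative adj (D X)) (at 0)"
    by (rule has_vector_derivative_transform_within_open[OF _ open_line_GLC[of X]]) (simp_all add: e)
  from vector_derivative_unique_at[OF D_line this] show ?thesis .
qed

end

section \<open>Closed orbits in projective space\<close>

text \<open>With \<open>\<xi>\<close> given by distinct powers of a number \<open>s\<close>, each of the sums is a nonzero polynomial in \<open>s\<close>. A
  linear form \<open>\<xi>\<close> of this kind takes distinct values on distinct weights, and orders the coordinates.\<close>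

lemma generic_weights:
  fixes X :: "('n::finite \<Rightarrow> int) set"
  assumes "finite X" "\<And>x. x \<in> X \<Longrightarrow> x \<noteq> (\<lambda>_. 0)"
  shows "\<exists>\<xi> :: 'n \<Rightarrow> real. inj \<xi> \<and> (\<forall>x\<in>X. (\<Sum>a\<in>UNIV. \<xi> a * of_int (x a)) \<noteq> 0)"
proof -
  obtain idx :: "'n \<Rightarrow> nat" where idx: "inj idx"
    using finite_imp_inj_to_nat_seg[of "UNIV :: 'n set"] by auto
  define p :: "('n \<Rightarrow> int) \<Rightarrow> real poly" where "p x = (\<Sum>a\<in>UNIV. monom (of_int (x a)) (idx a))" for x
  have p0: "p x \<noteq> 0" if xX: "x \<in> X" for x
  proof -
    obtain a where a: "x a \<noteq> 0" using assms(2)[OF xX] by auto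
    have "coeff (p x) (idx a) = (\<Sum>b\<in>UNIV. if b = a then of_int (x a) else 0)"
      unfolding p_def coeff_sum by (rule sum.cong) (auto simp: inj_eq[OF idx])
    then show ?thesis using a by auto
  qed
  have "finite (\<Union>x\<in>X. {s. poly (p x) s = 0})"
    using assms(1) p0 by (intro finite_UN_I poly_roots_finite)
  then have "\<not> {1<..} \<subseteq> (\<Union>x\<in>X. {s. poly (p x) s = 0})"
    using infinite_Ioi finite_subset by blast
  then obtain s :: real where s: "s > 1" "\<And>x. x \<in> X \<Longrightarrow> poly (p x) s \<noteq> 0" by auto
  show ?thesis
  proof (intro exI conjI ballI)
    show "inj (\<lambda>a. s ^ idx a)"
      using s(1) idx by (auto simp: inj_def)
    fix x assume "x \<in> X"
    from s(2)[OF this] show "(\<Sum>a\<in>UNIV. s ^ idx a * of_int (x a)) \<noteq> 0"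
      by (simp add: p_def poly_sum poly_monom mult.commute)
  qed
qed

lemma G_cent_dg: "M \<in> G_cent (dg l) \<longleftrightarrow> M \<in> GLC \<and> (\<forall>a b. M $ a $ b \<noteq> 0 \<longrightarrow> l a = l b)"
proof -
  have "M ** dg l = dg l ** M \<longleftrightarrow> (\<forall>a b. M $ a $ b * l b = l a * M $ a $ b)"
    by (simp add: vec_eq_iff mult_dg_nth dg_mult_nth)
  also have "\<dots> \<longleftrightarrow> (\<forall>a b. M $ a $ b \<noteq> 0 \<longrightarrow> l a = l b)"
  proof -
    have "M $ a $ b * l b = l a * M $ a $ b \<longleftrightarrow> (M $ a $ b \<noteq> 0 \<longrightarrow> l a = l b)" for a b
      by (cases "M $ a $ b = 0") (auto simp: mult.commute)
    then show ?thesis by presburger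
  qed
  finally show ?thesis by (simp add: G_cent_iff)
qed

context unitary_rep
begin

text \<open>The orbit is the image of the compact group \<open>K\<^sub>\<Lambda>\<close>.\<close>

lemma compact_orbit_closed:
  assumes w: "w \<noteq> 0"
    and orb: "\<And>h. h \<in> G_cent \<Lambda> \<Longrightarrow> \<exists>k\<in>K_cent \<Lambda>. vec.span {\<rho> h *v w} = vec.span {\<rho> k *v w}"
    and h: "\<And>n. h n \<in> G_cent \<Lambda>" and lim: "(\<lambda>n::nat. c n *s (\<rho> (h n) *v w)) \<longlonglongrightarrow> w1"
    and c: "\<And>n. c n \<noteq> 0" and w1: "w1 \<noteq> 0"
  shows "\<exists>k\<in>K_cent \<Lambda>. vec.span {w1} = vec.span {\<rho> k *v w}"
proof -
  obtain k where k: "\<And>n. k n \<in> K_cent \<Lambda>" "\<And>n. vec.span {\<rho> (h n) *v w} = vec.span {\<rho> (k n) *v w}"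
    using orb[OF h] by metis
  obtain k0 r where k0: "k0 \<in> K_cent \<Lambda>" "strict_mono (r :: nat \<Rightarrow> nat)" "(k \<circ> r) \<longlonglongrightarrow> k0"
    using compact_K_cent[of \<Lambda>] k(1) unfolding compact_def by metis
  have k0G: "k0 \<in> GLC" using k0(1) by (simp add: K_cent_iff unitary_GLC)
  have nz: "\<rho> ((k \<circ> r) n) *v w \<noteq> 0" for n
    using k(1)[of "r n"] by (intro rho_nz w) (simp add: K_cent_iff unitary_GLC)
  have "limitin proj_top (\<lambda>n. vec.span {\<rho> ((k \<circ> r) n) *v w}) (vec.span {\<rho> k0 *v w}) sequentially"
    by (intro limitin_span_tendsto tendsto_intros tendsto_rho k0 k0G rho_nz w)
  moreover have "limitin proj_top (\<lambda>n. vec.span {c (r n) *s (\<rho> (h (r n)) *v w)}) (vec.span {w1}) sequentially"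
    using limitin_span_tendsto[OF LIMSEQ_subseq_LIMSEQ[OF lim k0(2)] w1] by (simp add: o_def)
  then have "limitin proj_top (\<lambda>n. vec.span {\<rho> ((k \<circ> r) n) *v w}) (vec.span {w1}) sequentially"
    by (simp add: span_eqI c k(2))
  ultimately have "vec.span {w1} = vec.span {\<rho> k0 *v w}"
    by (intro limitin_span_unique[of "\<lambda>n. \<rho> ((k \<circ> r) n) *v w" sequentially]) (simp_all add: nz[unfolded o_apply])
  with k0(1) show ?thesis by blast
qed

text \<open>Choose a generic \<open>\<xi>\<close>, and among the weights that occur in vectors of the \<open>G\<^sub>L\<close>-orbit of \<open>w\<close> one on which
  \<open>\<xi>\<close> is maximal. The one-parameter group \<open>T t = exp (t \<xi>)\<close> moves the line of a vector with this weight to a weight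
  line \<open>[w1]\<close> as \<open>t\<close> tends to infinity. Since the orbit is closed, \<open>[w1]\<close> belongs to it. A matrix \<open>n\<close>
  that is unitriangular for the order given by \<open>\<xi>\<close> satisfies \<open>T (-t) n T t \<longlonglongrightarrow> 1\<close>; comparing
  coordinates, \<open>n\<close> changes only coordinates of weights on which \<open>\<xi>\<close> is larger, and there are none.\<close>

lemma highest_weight_vector:
  fixes l :: "'n \<Rightarrow> real"
  defines "L \<equiv> dg (\<lambda>a. of_real (l a))"
  assumes w: "w \<noteq> 0"
    and orb: "\<And>h. h \<in> G_cent L \<Longrightarrow> \<exists>k\<in>K_cent L. vec.span {\<rho> h *v w} = vec.span {\<rho> k *v w}"
  obtains k \<xi> \<eta> where "k \<in> K_cent L" "inj (\<xi> :: 'n \<Rightarrow> real)"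
    "\<And>x. D (dg x) *v (\<rho> k *v w) = (\<Sum>a\<in>UNIV. x a * of_int (\<eta> a)) *s (\<rho> k *v w)"
    "\<And>n. n \<in> G_cent L \<Longrightarrow> (\<And>a b. n $ a $ b \<noteq> mat 1 $ a $ b \<Longrightarrow> \<xi> a > \<xi> b) \<Longrightarrow> \<rho> n *v (\<rho> k *v w) = \<rho> k *v w"
proof -
  \<comment> \<open>differences of weights, which \<open>\<xi>\<close> has to separate\<close>
  define X where "X = {\<lambda>a. wt i a - wt j a | i j. wt i \<noteq> wt j}"
  have Xfin: "finite X"
    by (rule finite_subset[of _ "range (\<lambda>(i, j) a. wt i a - wt j a)"]) (auto simp: X_def)
  have Xnz: "x \<noteq> (\<lambda>_. 0)" if "x \<in> X" for x using that by (auto simp: X_def fun_eq_iff)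
  obtain \<xi> :: "'n \<Rightarrow> real" where \<xi>: "inj \<xi>" "\<And>x. x \<in> X \<Longrightarrow> (\<Sum>a\<in>UNIV. \<xi> a * of_int (x a)) \<noteq> 0"
    using generic_weights[of X] Xfin Xnz by blast
  define \<mu> where "\<mu> j = (\<Sum>a\<in>UNIV. \<xi> a * of_int (wt j a))" for j
  have sep: "wt i = wt j" if "\<mu> i = \<mu> j" for i j
  proof (rule ccontr)
    assume "wt i \<noteq> wt j"
    then have "(\<Sum>a\<in>UNIV. \<xi> a * of_int (wt i a - wt j a)) \<noteq> 0" by (intro \<xi>(2)) (auto simp: X_def)
    then show False using that by (simp add: \<mu>_def algebra_simps sum_subtractf)
  qed
  define T where "T t = dg (\<lambda>a. exp (of_real (t * \<xi> a)))" for t :: real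
  have T: "T t \<in> G_cent L" for t
    unfolding L_def G_cent_dg T_def by (auto simp: dg_nth intro!: GLC_dg split: if_splits)
  have TG: "T t \<in> GLC" for t using T[of t] by (simp add: G_cent_iff)
  have coordT: "coord j (\<rho> (T t) *v v) = exp (of_real (t * \<mu> j)) * coord j v" for t j v
    unfolding T_def coord_rho_dg \<mu>_def by (simp add: sum_distrib_left mult.assoc)
  define J where "J = {j. \<exists>h\<in>G_cent L. coord j (\<rho> h *v w) \<noteq> 0}"
  obtain j' where "coord j' w \<noteq> 0" using coord_nonzero[OF w] by blast
  then have "j' \<in> J" by (auto simp: J_def intro!: bexI[of _ "mat 1"])
  then have "Max (\<mu> ` J) \<in> \<mu> ` J" by (intro Max_in) auto
  then obtain j0 where j0: "j0 \<in> J" "\<mu> j0 = Max (\<mu> ` J)" by auto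
  define \<mu>0 where "\<mu>0 = \<mu> j0"
  have J: "\<mu> j \<le> \<mu>0" if "j \<in> J" for j unfolding \<mu>0_def j0(2) using that by (intro Max_ge) auto
  obtain h0 where h0: "h0 \<in> G_cent L" "coord j0 (\<rho> h0 *v w) \<noteq> 0" using j0(1) by (auto simp: J_def)
  have h0G: "h0 \<in> GLC" using h0(1) by (simp add: G_cent_iff)
  define y where "y = \<rho> h0 *v w"
  define w1 where "w1 = W *v (\<chi> j. if \<mu> j = \<mu>0 then coord j y else 0)"
  have c1: "coord j w1 = (if \<mu> j = \<mu>0 then coord j y else 0)" for j by (simp add: w1_def)
  have w1: "w1 \<noteq> 0" using c1[of j0] h0(2) by (auto simp: \<mu>0_def y_def)
  define Y where "Y n = exp (of_real (- (real n * \<mu>0))) *s (\<rho> (T (real n) ** h0) *v w)" for n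
  have cY: "coord j (Y n) = of_real (exp (real n * (\<mu> j - \<mu>0))) * coord j y" for j n
  proof -
    have "coord j (Y n) = exp (of_real (- (real n * \<mu>0))) * exp (of_real (real n * \<mu> j)) * coord j y"
      by (simp add: Y_def rho_mult TG h0G coordT y_def flip: matrix_vector_mul_assoc)
    also have "exp (of_real (- (real n * \<mu>0))) * exp (of_real (real n * \<mu> j)) = (of_real (exp (real n * (\<mu> j - \<mu>0))) :: complex)"
      by (simp only: exp_of_real of_real_mult[symmetric] exp_add[symmetric]) (simp add: algebra_simps)
    finally show ?thesis .
  qed
  have "(\<lambda>n. coord j (Y n)) \<longlonglongrightarrow> coord j w1" for j
  proof (cases "coord j y = 0")
    case False
    then have "\<mu> j \<le> \<mu>0" using h0(1) by (intro J) (auto simp: J_def y_def)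
    then consider "\<mu> j = \<mu>0" | "\<mu> j < \<mu>0" by linarith
    then show ?thesis
    proof cases
      case 2
      have "(\<lambda>n. exp (real n * (\<mu> j - \<mu>0))) = (\<lambda>n. (exp (\<mu> j - \<mu>0)) ^ n)" by (simp add: exp_of_nat_mult)
      moreover have "(\<lambda>n. (exp (\<mu> j - \<mu>0)) ^ n) \<longlonglongrightarrow> 0" using 2 by (intro LIMSEQ_realpow_zero) auto
      ultimately have "(\<lambda>n. of_real (exp (real n * (\<mu> j - \<mu>0))) * coord j y) \<longlonglongrightarrow> of_real 0 * coord j y"
        by (intro tendsto_intros) simp
      then show ?thesis using 2 by (simp add: cY c1)
    qed (simp add: cY c1)
  qed (simp add: cY c1)
  then have "(\<lambda>n. (\<chi> j. coord j (Y n)) $ j) \<longlonglongrightarrow> (\<chi> j. coord j w1) $ j" for j by simp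
  then have "(\<lambda>n. \<chi> j. coord j (Y n)) \<longlonglongrightarrow> (\<chi> j. coord j w1)" by (rule vec_tendstoI)
  then have "(\<lambda>n. W *v (\<chi> j. coord j (Y n))) \<longlonglongrightarrow> W *v (\<chi> j. coord j w1)"
    by (rule tendsto_mv[OF tendsto_const])
  moreover have Wc: "W *v (\<chi> j. coord j v) = v" for v by (rule coord_eqI) simp
  ultimately have "Y \<longlonglongrightarrow> w1" by simp
  then have Ylim: "(\<lambda>n. exp (of_real (- (real n * \<mu>0))) *s (\<rho> (T (real n) ** h0) *v w)) \<longlonglongrightarrow> w1"
    unfolding Y_def .
  have "\<exists>k\<in>K_cent L. vec.span {w1} = vec.span {\<rho> k *v w}"
    by (rule compact_orbit_closed[OF w _ _ Ylim _ w1]) (auto intro: orb G_cent_mult T h0(1))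
  then obtain k where k: "k \<in> K_cent L" "vec.span {w1} = vec.span {\<rho> k *v w}" by blast
  define w0 where "w0 = \<rho> k *v w"
  have kG: "k \<in> G_cent L" "k \<in> GLC" using k(1) K_cent_subset_G_cent by (auto simp: K_cent_iff unitary_GLC)
  have w0: "w0 \<noteq> 0" unfolding w0_def by (intro rho_nz kG w)
  obtain e where e: "e \<noteq> 0" "w0 = e *s w1" using span_eqD[OF k(2)[symmetric]] w0 unfolding w0_def by metis
  have c0: "\<mu> j = \<mu>0" if "coord j w0 \<noteq> 0" for j using that by (simp add: e c1 split: if_splits)
  define \<eta> where "\<eta> = wt j0"
  have c0': "wt j = \<eta>" if "coord j w0 \<noteq> 0" for j unfolding \<eta>_def by (rule sep) (simp add: c0[OF that] \<mu>0_def)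
  have cJ: "\<mu> j \<le> \<mu>0" if "h \<in> G_cent L" "coord j (\<rho> h *v w0) \<noteq> 0" for h j
  proof (rule J)
    have "\<rho> h *v w0 = \<rho> (h ** k) *v w"
      using that(1) kG by (simp add: w0_def rho_mult G_cent_iff matrix_vector_mul_assoc)
    then show "j \<in> J" using that G_cent_mult[OF that(1) kG(1)] by (auto simp: J_def)
  qed
  show thesis
  proof (rule that[OF k(1) \<xi>(1)])
    show "D (dg x) *v (\<rho> k *v w) = (\<Sum>a\<in>UNIV. x a * of_int (\<eta> a)) *s (\<rho> k *v w)" for x
      unfolding w0_def[symmetric]
    proof (rule coord_eqI)
      fix j show "coord j (D (dg x) *v w0) = coord j ((\<Sum>a\<in>UNIV. x a * of_int (\<eta> a)) *s w0)"
        using c0'[of j] by (cases "coord j w0 = 0") (simp_all add: coord_D_dg)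
    qed
    fix n assume n: "n \<in> G_cent L" and up: "\<And>a b. n $ a $ b \<noteq> mat 1 $ a $ b \<Longrightarrow> \<xi> a > \<xi> b"
    have nG: "n \<in> GLC" using n by (simp add: G_cent_iff)
    define N where "N i = T (- real i) ** n ** T (real i)" for i
    have "(\<lambda>i. N i $ a $ b) \<longlonglongrightarrow> mat 1 $ a $ b" for a b
    proof -
      have Ni: "N i $ a $ b = of_real (exp (- (real i * (\<xi> a - \<xi> b)))) * n $ a $ b" for i
      proof -
        have "N i $ a $ b = exp (of_real (- real i * \<xi> a)) * n $ a $ b * exp (of_real (real i * \<xi> b))"
          by (simp add: N_def T_def mult_dg_nth dg_mult_nth)
        also have "\<dots> = (exp (of_real (- real i * \<xi> a)) * exp (of_real (real i * \<xi> b))) * n $ a $ b" by (simp only: mult_ac)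
        also have "exp (of_real (- real i * \<xi> a)) * exp (of_real (real i * \<xi> b)) = (of_real (exp (- (real i * (\<xi> a - \<xi> b)))) :: complex)"
          by (simp only: exp_of_real of_real_mult[symmetric] exp_add[symmetric]) (simp add: algebra_simps)
        finally show ?thesis .
      qed
      show ?thesis
      proof (cases "n $ a $ b = mat 1 $ a $ b")
        case True
        show ?thesis unfolding Ni True by (cases "a = b") (simp_all add: mat_nth)
      next
        case False
        then have gt: "\<xi> a > \<xi> b" by (rule up)
        have "(\<lambda>i. exp (- (real i * (\<xi> a - \<xi> b)))) = (\<lambda>i. (exp (\<xi> b - \<xi> a)) ^ i)"
          by (simp add: exp_of_nat_mult[symmetric] algebra_simps)
        moreover have "(\<lambda>i. (exp (\<xi> b - \<xi> a)) ^ i) \<longlonglongrightarrow> 0" using gt by (intro LIMSEQ_realpow_zero) auto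
        ultimately have "(\<lambda>i. of_real (exp (- (real i * (\<xi> a - \<xi> b)))) * n $ a $ b) \<longlonglongrightarrow> of_real 0 * n $ a $ b"
          by (intro tendsto_intros) simp
        moreover have "mat 1 $ a $ b = (0::complex)" using gt by (auto simp: mat_nth)
        ultimately show ?thesis unfolding Ni by simp
      qed
    qed
    then have "N \<longlonglongrightarrow> mat 1" by (intro vec_tendstoI)
    then have "(\<lambda>i. \<rho> (N i) *v w0) \<longlonglongrightarrow> \<rho> (mat 1) *v w0"
      by (intro tendsto_intros tendsto_rho) simp_all
    then have limN: "(\<lambda>i. coord j (\<rho> (N i) *v w0)) \<longlonglongrightarrow> coord j w0" for j
      by (intro tendsto_intros) simp
    have Tw0: "\<rho> (T t) *v w0 = exp (of_real (t * \<mu>0)) *s w0" for t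
    proof (rule coord_eqI)
      fix j show "coord j (\<rho> (T t) *v w0) = coord j (exp (of_real (t * \<mu>0)) *s w0)"
        using c0[of j] by (cases "coord j w0 = 0") (simp_all add: coordT)
    qed
    have cN: "coord j (\<rho> (N i) *v w0) = of_real (exp (- (real i * (\<mu> j - \<mu>0)))) * coord j (\<rho> n *v w0)" for i j
    proof -
      have "\<rho> (N i) *v w0 = \<rho> (T (- real i)) *v (\<rho> n *v (\<rho> (T (real i)) *v w0))"
        by (simp add: N_def rho_mult TG nG GLC_mult matrix_vector_mul_assoc matrix_mul_assoc)
      then have "coord j (\<rho> (N i) *v w0) = (exp (of_real (- real i * \<mu> j)) * exp (of_real (real i * \<mu>0))) * coord j (\<rho> n *v w0)"
        by (simp add: coordT Tw0 smult_mv)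
      also have "exp (of_real (- real i * \<mu> j)) * exp (of_real (real i * \<mu>0)) = (of_real (exp (- (real i * (\<mu> j - \<mu>0)))) :: complex)"
        by (simp only: exp_of_real of_real_mult[symmetric] exp_add[symmetric]) (simp add: algebra_simps)
      finally show ?thesis .
    qed
    show "\<rho> n *v (\<rho> k *v w) = \<rho> k *v w"
      unfolding w0_def[symmetric]
    proof (rule coord_eqI)
      fix j
      \<comment> \<open>by \<open>cN\<close> and \<open>limN\<close>; the second case contradicts the maximality of \<open>\<mu>0\<close>\<close>
      consider "\<mu> j = \<mu>0" | "\<mu> j > \<mu>0" | "\<mu> j < \<mu>0" by linarith
      then show "coord j (\<rho> n *v w0) = coord j w0"
      proof cases
        case 1
        then show ?thesis using limN[of j] by (simp add: cN LIMSEQ_const_iff)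
      next
        case 2
        then show ?thesis using cJ[OF n, of j] c0[of j] by fastforce
      next
        case 3
        then have z: "coord j w0 = 0" using c0[of j] by fastforce
        have "(\<lambda>i. of_real ((exp (\<mu> j - \<mu>0)) ^ i) * coord j (\<rho> (N i) *v w0)) \<longlonglongrightarrow> of_real 0 * coord j w0"
          using 3 by (intro tendsto_intros limN LIMSEQ_realpow_zero) auto
        moreover have "of_real ((exp (\<mu> j - \<mu>0)) ^ i) * coord j (\<rho> (N i) *v w0) = coord j (\<rho> n *v w0)" for i
        proof -
          have "(exp (\<mu> j - \<mu>0)) ^ i * exp (- (real i * (\<mu> j - \<mu>0))) = 1"
            by (simp add: exp_of_nat_mult[symmetric] exp_minus)
          then show ?thesis unfolding cN mult.assoc[symmetric] of_real_mult[symmetric] by simp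
        qed
        ultimately show ?thesis using z by (simp add: LIMSEQ_const_iff)
      qed
    qed
  qed
qed

end

lemma Emat_diag: "Emat a a = dg (\<lambda>i. if i = a then 1 else 0)"
  by (simp add: vec_eq_iff Emat_nth dg_nth)

lemma mm_nonzero:
  assumes "((A :: complex^'n^'m) ** B) $ i $ j \<noteq> 0"
  shows "\<exists>k. A $ i $ k \<noteq> 0 \<and> B $ k $ j \<noteq> 0"
proof (rule ccontr)
  assume "\<not> ?thesis"
  then have "(\<Sum>k\<in>UNIV. A $ i $ k * B $ k $ j) = 0" by (intro sum.neutral) auto
  then show False using assms by (simp add: matrix_matrix_mult_def)
qed

lemma Emat_line_inverse: "a \<noteq> b \<Longrightarrow> (mat 1 + t *\<^sub>R Emat a b) ** (mat 1 - t *\<^sub>R Emat a b) = mat 1"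
  by (simp add: matrix_add_ldistrib mm_add_left matrix_scalar_ac bounded_bilinear.diff_right[OF bounded_bilinear_mm]
      scalar_matrix_assoc[symmetric] Emat_mult)

context unitary_rep
begin

lemma herm_D_adj: "herm (D X *v u) v = herm u (D (adj X) *v v)"
  by (simp add: herm_adj D_adj)

text \<open>In the following \<open>w0\<close> is a weight vector of weight \<open>\<eta>\<close> that is fixed by the matrices of \<open>G\<^sub>L\<close> which are
  unitriangular for the order given by \<open>\<xi>\<close>, as provided by \<open>highest_weight_vector\<close>.\<close>

context
  fixes l \<xi> :: "'n \<Rightarrow> real" and \<eta> :: "'n \<Rightarrow> int" and w0 :: "complex^'m" and L
  defines "L \<equiv> dg (\<lambda>a. of_real (l a))"
  assumes w0: "w0 \<noteq> 0" and inj: "inj \<xi>"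
    and weight: "\<And>x. D (dg x) *v w0 = (\<Sum>a\<in>UNIV. x a * of_int (\<eta> a)) *s w0"
    and upper_fixes: "\<forall>n\<in>G_cent L. (\<forall>a b. n $ a $ b \<noteq> mat 1 $ a $ b \<longrightarrow> \<xi> a > \<xi> b) \<longrightarrow> \<rho> n *v w0 = w0"
begin

lemma upper: "n \<in> G_cent L \<Longrightarrow> (\<And>a b. n $ a $ b \<noteq> mat 1 $ a $ b \<Longrightarrow> \<xi> a > \<xi> b) \<Longrightarrow> \<rho> n *v w0 = w0"
  using upper_fixes by blast

lemma D_Emat_diag: "D (Emat a a) *v w0 = of_int (\<eta> a) *s w0"
proof -
  have "(\<Sum>i\<in>UNIV. (if i = a then 1 else 0) * of_int (\<eta> i)) = (of_int (\<eta> a) :: complex)"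
    using sum_if_mult(2)[of "\<lambda>i. of_int (\<eta> i)" a "\<lambda>_. 1"] by (simp add: mult.commute)
  then show ?thesis unfolding Emat_diag weight by simp
qed

lemma D_Emat_upper:
  assumes "l a = l b" "\<xi> a > \<xi> b"
  shows "D (Emat a b) *v w0 = 0"
proof -
  have ab: "a \<noteq> b" using assms(2) by auto
  have "\<rho> (mat 1 + t *\<^sub>R Emat a b) *v w0 = w0" for t
  proof (rule upper)
    have "mat 1 + t *\<^sub>R Emat a b \<in> GLC" by (rule GLC_I[OF Emat_line_inverse[OF ab]])
    then show "mat 1 + t *\<^sub>R Emat a b \<in> G_cent L"
      using assms(1) unfolding L_def G_cent_dg by (auto simp: mat_nth Emat_nth split: if_splits)
    show "\<xi> i > \<xi> j" if "(mat 1 + t *\<^sub>R Emat a b) $ i $ j \<noteq> mat 1 $ i $ j" for i j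
      using that assms(2) by (auto simp: mat_nth Emat_nth split: if_splits)
  qed
  moreover have "((\<lambda>t. \<rho> (mat 1 + t *\<^sub>R Emat a b) *v w0) has_vector_derivative D (Emat a b) *v w0) (at 0)"
    by (rule bounded_linear.has_vector_derivative[OF bounded_bilinear.bounded_linear_left[OF bounded_bilinear_mv] D_line])
  ultimately have "((\<lambda>t::real. w0) has_vector_derivative D (Emat a b) *v w0) (at 0)" by simp
  from vector_derivative_unique_at[OF this has_vector_derivative_const] show ?thesis .
qed

text \<open>The raising operator \<open>D E\<^bsub>ab\<^esub>\<close> kills \<open>w0\<close>, is the adjoint of the lowering operator \<open>D E\<^bsub>ba\<^esub>\<close>, and the
  commutator of the two is \<open>D E\<^bsub>aa\<^esub> - D E\<^bsub>bb\<^esub>\<close>.\<close>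

lemma norm_D_Emat_lower:
  assumes "l a = l b" "\<xi> a > \<xi> b"
  shows "(norm (D (Emat b a) *v w0))\<^sup>2 = (of_int (\<eta> a) - of_int (\<eta> b)) * (norm w0)\<^sup>2"
proof -
  have ab: "a \<noteq> b" using assms(2) by auto
  have "D (Emat a b) ** D (Emat b a) = D (Emat b a) ** D (Emat a b) + D (Emat a a - Emat b b)"
    using D_bracket[of "Emat a b" "Emat b a"] ab by (simp add: Emat_mult)
  then have "D (Emat a b) *v (D (Emat b a) *v w0) = D (Emat a a - Emat b b) *v w0"
    using D_Emat_upper[OF assms]
    by (simp add: matrix_vector_mult_add_rdistrib matrix_vector_mul_assoc flip: matrix_vector_mul_assoc[of "D (Emat b a)"])
  also have "\<dots> = (of_int (\<eta> a) - of_int (\<eta> b)) *s w0"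
    by (simp add: linear_diff[OF D_linear] matrix_vector_mult_diff_rdistrib D_Emat_diag vec_eq_iff algebra_simps)
  finally have "herm (D (Emat a b) *v (D (Emat b a) *v w0)) w0 = (of_int (\<eta> a) - of_int (\<eta> b)) * herm w0 w0"
    by (simp add: herm_diff left_diff_distrib)
  then have "herm (D (Emat b a) *v w0) (D (Emat b a) *v w0) = (of_int (\<eta> a) - of_int (\<eta> b)) * herm w0 w0"
    by (simp add: herm_D_adj)
  then have "complex_of_real ((norm (D (Emat b a) *v w0))\<^sup>2) = of_real ((of_int (\<eta> a) - of_int (\<eta> b)) * (norm w0)\<^sup>2)"
    by (simp add: herm_self)
  then show ?thesis by (simp only: of_real_eq_iff)
qed

lemma dominant:
  assumes "l a = l b" "\<xi> a > \<xi> b"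
  shows "\<eta> a \<ge> \<eta> b"
proof -
  have "0 \<le> (of_int (\<eta> a) - of_int (\<eta> b)) * (norm w0)\<^sup>2"
    using norm_D_Emat_lower[OF assms] by (metis zero_le_power2)
  then have "of_int (\<eta> a) - of_int (\<eta> b) \<ge> (0::real)" using w0 by (simp add: zero_le_mult_iff)
  then show ?thesis by simp
qed

lemma D_sum: "D X = (\<Sum>a\<in>UNIV. \<Sum>b\<in>UNIV. mat (X $ a $ b) ** D (Emat a b))"
  by (subst matrix_Emat_sum[of X]) (simp add: linear_sum[OF D_linear] D_mat)

text \<open>Off the diagonal, elementary matrices act by raising operators, which kill \<open>w0\<close>, or by their
  adjoints.\<close>

lemma herm_D:
  assumes "\<And>a b. X $ a $ b \<noteq> 0 \<Longrightarrow> l a = l b"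
  shows "herm (D X *v w0) w0 = (\<Sum>a\<in>UNIV. of_int (\<eta> a) * X $ a $ a) * herm w0 w0"
proof -
  have off: "herm (D (Emat a b) *v w0) w0 = 0" if ab: "a \<noteq> b" and lab: "l a = l b" for a b
  proof -
    have "\<xi> a \<noteq> \<xi> b" using inj ab by (simp add: inj_eq)
    then consider "\<xi> a > \<xi> b" | "\<xi> b > \<xi> a" by linarith
    then show ?thesis
    proof cases
      case 1
      then show ?thesis using D_Emat_upper[OF lab] by simp
    next
      case 2
      then show ?thesis using D_Emat_upper[of b a] lab by (simp add: herm_D_adj)
    qed
  qed
  have "herm (D X *v w0) w0 = (\<Sum>a\<in>UNIV. \<Sum>b\<in>UNIV. X $ a $ b * herm (D (Emat a b) *v w0) w0)"
    by (subst D_sum) (simp add: bounded_bilinear.sum_left[OF bounded_bilinear_mv]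
        bounded_bilinear.sum_left[OF bounded_bilinear_herm] mat_mult_mv)
  also have "\<dots> = (\<Sum>a\<in>UNIV. \<Sum>b\<in>UNIV. if b = a then X $ a $ a * (of_int (\<eta> a) * herm w0 w0) else 0)"
  proof (intro sum.cong refl)
    fix a b
    show "X $ a $ b * herm (D (Emat a b) *v w0) w0 = (if b = a then X $ a $ a * (of_int (\<eta> a) * herm w0 w0) else 0)"
      using off[of a b] assms[of a b] by (cases "X $ a $ b = 0"; cases "a = b") (auto simp: D_Emat_diag)
  qed
  also have "\<dots> = (\<Sum>a\<in>UNIV. of_int (\<eta> a) * X $ a $ a) * herm w0 w0"
    by (simp add: sum_distrib_left mult_ac)
  finally show ?thesis .
qed

text \<open>If \<open>w0\<close> is an eigenvector of \<open>D Y\<close>, it is one of \<open>D (h Y h\<inverse>)\<close> for the same eigenvalue, and by \<open>herm_D\<close>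
  this eigenvalue can be read off from the diagonal of \<open>h Y h\<inverse>\<close>. For elementary matrices \<open>Y\<close> this
  determines entries of \<open>Z = h\<inverse> diag(\<eta>) h\<close>: its diagonal is \<open>\<eta>\<close>, and the entries on one side of the
  diagonal vanish. Then \<open>h Z = diag(\<eta>) h\<close> gives \<open>(\<eta> a - \<eta> b) h\<^bsub>ab\<^esub> = 0\<close> for \<open>\<eta> a < \<eta> b\<close>, by induction on \<open>b\<close>
  along the order of \<open>\<xi>\<close>.\<close>

lemma stabilizer_parabolic:
  assumes h: "h \<in> G_cent L" and hw: "\<rho> h *v w0 = c *s w0"
  shows "h $ a $ b \<noteq> 0 \<Longrightarrow> \<eta> a \<ge> \<eta> b"
proof -
  have hG: "h \<in> GLC" and hl: "\<And>a b. h $ a $ b \<noteq> 0 \<Longrightarrow> l a = l b"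
    using h unfolding L_def G_cent_dg by auto
  define hi where "hi = matrix_inv h"
  have "hi \<in> G_cent L" unfolding hi_def by (rule G_cent_inv[OF h])
  then have hil: "\<And>a b. hi $ a $ b \<noteq> 0 \<Longrightarrow> l a = l b" unfolding L_def G_cent_dg by auto
  have c: "c \<noteq> 0" using rho_nz[OF hG w0] hw by auto
  have "matrix_inv (\<rho> h) *v (\<rho> h *v w0) = w0" by (simp add: GLC_cancel rho_GLC hG)
  then have "matrix_inv (\<rho> h) *v w0 = (1 / c) *s w0"
    unfolding hw using c by (metis smult_mv vector_smult_assoc vector_smult_lid nonzero_divide_eq_eq)
  note inv_fix = this
  have tr: "(\<Sum>i\<in>UNIV. of_int (\<eta> i) * (h ** Y ** hi) $ i $ i) = \<kappa>"
    if Y: "D Y *v w0 = \<kappa> *s w0" and Yl: "\<And>a b. Y $ a $ b \<noteq> 0 \<Longrightarrow> l a = l b" for Y \<kappa>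
  proof -
    have "D (h ** Y ** hi) *v w0 = \<rho> h *v (D Y *v (matrix_inv (\<rho> h) *v w0))"
      unfolding hi_def D_conj[OF hG] by (simp add: matrix_vector_mul_assoc matrix_mul_assoc)
    also have "\<dots> = \<kappa> *s w0" using c by (simp add: inv_fix smult_mv Y hw)
    finally have "herm (D (h ** Y ** hi) *v w0) w0 = \<kappa> * herm w0 w0" by simp
    moreover have "l a = l b" if nz: "(h ** Y ** hi) $ a $ b \<noteq> 0" for a b
    proof -
      obtain j where j: "(h ** Y) $ a $ j \<noteq> 0" "hi $ j $ b \<noteq> 0"
        using mm_nonzero[OF nz] by blast
      obtain i where i: "h $ a $ i \<noteq> 0" "Y $ i $ j \<noteq> 0"
        using mm_nonzero[OF j(1)] by blast
      show ?thesis using hl[OF i(1)] Yl[OF i(2)] hil[OF j(2)] by simp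
    qed
    ultimately have "(\<Sum>i\<in>UNIV. of_int (\<eta> i) * (h ** Y ** hi) $ i $ i) * herm w0 w0 = \<kappa> * herm w0 w0"
      using herm_D by simp
    then show ?thesis using w0 by simp
  qed
  define Z where "Z = hi ** dg (\<lambda>i. of_int (\<eta> i)) ** h"
  have Zdc: "Z $ d $ c' = (\<Sum>i\<in>UNIV. of_int (\<eta> i) * (h ** Emat c' d ** hi) $ i $ i)" for d c'
  proof -
    have "(h ** Emat c' d ** hi) $ i $ i = h $ i $ c' * hi $ d $ i" for i
    proof -
      have "(h ** Emat c' d) $ i $ k = (if k = d then h $ i $ c' else 0)" for k
      proof -
        have "(h ** Emat c' d) $ i $ k = (\<Sum>j\<in>UNIV. h $ i $ j * Emat c' d $ j $ k)" by (simp add: matrix_matrix_mult_def)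
        also have "\<dots> = (\<Sum>j\<in>UNIV. if j = c' then (if k = d then h $ i $ c' else 0) else 0)"
          by (rule sum.cong) (auto simp: Emat_nth)
        finally show ?thesis by simp
      qed
      then have "(h ** Emat c' d ** hi) $ i $ i = (\<Sum>k\<in>UNIV. (if k = d then h $ i $ c' else 0) * hi $ k $ i)"
        unfolding matrix_matrix_mult_def[of "h ** Emat c' d"] by simp
      also have "\<dots> = (\<Sum>k\<in>UNIV. if k = d then h $ i $ c' * hi $ d $ i else 0)" by (rule sum.cong) auto
      finally show ?thesis by simp
    qed
    moreover have "Z $ d $ c' = (\<Sum>i\<in>UNIV. (hi $ d $ i * of_int (\<eta> i)) * h $ i $ c')"
      unfolding Z_def matrix_matrix_mult_def[of "hi ** dg (\<lambda>i. of_int (\<eta> i))"] by (simp add: mult_dg_nth)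
    ultimately show ?thesis by (simp add: mult_ac)
  qed
  have Zdiag: "Z $ j $ j = of_int (\<eta> j)" for j
    unfolding Zdc by (rule tr[OF D_Emat_diag]) (auto simp: Emat_nth split: if_splits)
  have Zlow: "Z $ d $ c' = 0" if "\<xi> c' > \<xi> d" "l c' = l d" for c' d
    unfolding Zdc by (rule tr) (use D_Emat_upper[OF that(2,1)] that in \<open>auto simp: Emat_nth split: if_splits\<close>)
  have Zl: "l d = l c'" if nz: "Z $ d $ c' \<noteq> 0" for d c'
  proof -
    obtain i where "(hi ** dg (\<lambda>i. of_int (\<eta> i))) $ d $ i \<noteq> 0" "h $ i $ c' \<noteq> 0"
      using mm_nonzero[OF nz[unfolded Z_def]] by blast
    then show ?thesis using hil[of d i] hl[of i c'] by (simp add: mult_dg_nth)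
  qed
  have hZ: "h ** Z = dg (\<lambda>i. of_int (\<eta> i)) ** h"
    unfolding Z_def hi_def by (simp add: matrix_mul_assoc GLC_inv hG)
  have "\<forall>a. \<eta> a < \<eta> b \<longrightarrow> h $ a $ b = 0" for b
  proof (induction "card {i. \<xi> i > \<xi> b}" arbitrary: b rule: less_induct)
    case less
    show ?case
    proof (intro allI impI)
      fix a assume ab: "\<eta> a < \<eta> b"
      have "of_int (\<eta> a) * h $ a $ b = (h ** Z) $ a $ b" by (simp add: hZ dg_mult_nth)
      also have "\<dots> = (\<Sum>i\<in>UNIV. h $ a $ i * Z $ i $ b)" by (simp add: matrix_matrix_mult_def)
      also have "\<dots> = (\<Sum>i\<in>UNIV. if i = b then h $ a $ b * of_int (\<eta> b) else 0)"
      proof (rule sum.cong[OF refl])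
        fix i
        show "h $ a $ i * Z $ i $ b = (if i = b then h $ a $ b * of_int (\<eta> b) else 0)"
        proof (cases "i = b \<or> Z $ i $ b = 0")
          case False
          then have lib: "l i = l b" using Zl by blast
          have "\<not> \<xi> b > \<xi> i" using Zlow[of i b] False lib by auto
          then have xi: "\<xi> i > \<xi> b" using False inj by (metis injD linorder_neqE)
          have "{k. \<xi> k > \<xi> i} \<subset> {k. \<xi> k > \<xi> b}" using xi by auto
          then have "card {k. \<xi> k > \<xi> i} < card {k. \<xi> k > \<xi> b}" by (intro psubset_card_mono) auto
          from less[OF this] have "h $ a $ i = 0" using ab dominant[OF lib xi] by auto
          then show ?thesis using False by simp
        qed (auto simp: Zdiag)
      qed
      also have "\<dots> = h $ a $ b * of_int (\<eta> b)" by simp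
      finally have "(of_int (\<eta> a) - of_int (\<eta> b)) * h $ a $ b = 0" by (simp add: algebra_simps)
      then show "h $ a $ b = 0" using ab by simp
    qed
  qed
  then show "h $ a $ b \<noteq> 0 \<Longrightarrow> \<eta> a \<ge> \<eta> b" by (meson not_le)
qed

text \<open>By \<open>dominant\<close>, indices of a common eigenvalue of \<open>L\<close> that differ in \<open>\<eta>\<close> are ordered by \<open>\<xi>\<close> in the same
  way.\<close>

lemma unipotent_fixes:
  assumes n: "n \<in> G_cent L" and "\<And>a b. n $ a $ b \<noteq> mat 1 $ a $ b \<Longrightarrow> \<eta> a > \<eta> b"
  shows "\<rho> n *v w0 = w0"
proof (rule upper[OF n])
  fix a b assume ne: "n $ a $ b \<noteq> mat 1 $ a $ b"
  then have gt: "\<eta> a > \<eta> b" by (rule assms)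
  then have ab: "a \<noteq> b" by auto
  then have "n $ a $ b \<noteq> 0" using ne by (simp add: mat_nth)
  then have "l a = l b" using n unfolding L_def G_cent_dg by auto
  then have "\<not> \<xi> b > \<xi> a" using dominant[of b a] gt by auto
  then show "\<xi> a > \<xi> b" using ab inj by (metis injD linorder_neqE)
qed

text \<open>By \<open>norm_D_Emat_lower\<close> the lowering operators kill \<open>w0\<close> as well, so the Lie algebra of \<open>G\<^sub>L\<close> acts on \<open>w0\<close> by
  scalars, and \<open>G\<^sub>L\<close> is generated by exponentials.\<close>

lemma central_weight_fixed:
  assumes eq: "\<And>a b. l a = l b \<Longrightarrow> \<eta> a = \<eta> b" and h: "h \<in> G_cent L"
  shows "\<exists>c. \<rho> h *v w0 = c *s w0"
proof -
  have off: "D (Emat a b) *v w0 = 0" if ab: "a \<noteq> b" and lab: "l a = l b" for a b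
  proof -
    have "\<xi> a \<noteq> \<xi> b" using inj ab by (simp add: inj_eq)
    then consider "\<xi> a > \<xi> b" | "\<xi> b > \<xi> a" by linarith
    then show ?thesis
    proof cases
      case 1
      then show ?thesis using D_Emat_upper[OF lab] by simp
    next
      case 2
      then show ?thesis using norm_D_Emat_lower[OF lab[symmetric] 2] eq[OF lab] by simp
    qed
  qed
  have DX: "D X *v w0 = (\<Sum>a\<in>UNIV. X $ a $ a * of_int (\<eta> a)) *s w0" if "\<And>a b. X $ a $ b \<noteq> 0 \<Longrightarrow> l a = l b" for X
  proof -
    have "D X *v w0 = (\<Sum>a\<in>UNIV. \<Sum>b\<in>UNIV. X $ a $ b *s (D (Emat a b) *v w0))"
      by (subst D_sum) (simp add: bounded_bilinear.sum_left[OF bounded_bilinear_mv] mat_mult_mv)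
    also have "\<dots> = (\<Sum>a\<in>UNIV. \<Sum>b\<in>UNIV. if b = a then (X $ a $ a * of_int (\<eta> a)) *s w0 else 0)"
    proof (intro sum.cong refl)
      fix a b
      show "X $ a $ b *s (D (Emat a b) *v w0) = (if b = a then (X $ a $ a * of_int (\<eta> a)) *s w0 else 0)"
        using off[of a b] that[of a b] by (cases "X $ a $ b = 0"; cases "a = b") (auto simp: D_Emat_diag)
    qed
    also have "\<dots> = (\<Sum>a\<in>UNIV. X $ a $ a * of_int (\<eta> a)) *s w0"
      by (simp add: vec_eq_iff sum_distrib_right)
    finally show ?thesis .
  qed
  have hL: "hermitian L" by (simp add: hermitian_def L_def)
  show ?thesis
  proof (rule G_cent_induct[OF h hL, of "\<lambda>h. \<exists>c. \<rho> h *v w0 = c *s w0"])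
    fix V z l' assume V: "V \<in> unitary_group" and LV: "L = V ** dg l' ** adj V"
    define X where "X = V ** dg z ** adj V"
    have "X ** L = V ** (dg z ** dg l') ** adj V" and "L ** X = V ** (dg l' ** dg z) ** adj V"
      unfolding LV X_def using V by (simp_all only: matrix_mul_assoc unitary_cancel)
    then have XL: "X ** L = L ** X" by (simp add: mult.commute)
    have "l a = l b" if "X $ a $ b \<noteq> 0" for a b
    proof -
      have "X $ a $ b * of_real (l b) = of_real (l a) * X $ a $ b"
        using arg_cong[OF XL, of "\<lambda>M. M $ a $ b"] by (simp add: L_def mult_dg_nth dg_mult_nth)
      then show ?thesis using that by simp
    qed
    then obtain \<kappa> where \<kappa>: "D X *v w0 = \<kappa> *s w0" using DX by blast
    have VG: "V \<in> GLC" using V by (rule unitary_GLC)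
    have "matrix_inv V = adj V" "matrix_inv (\<rho> V) = \<rho> (adj V)"
      using unitary_inv[OF V] rho_inv[OF VG] by simp_all
    then have DXe: "D X = \<rho> V ** D (dg z) ** \<rho> (adj V)" using D_conj[OF VG, of "dg z"] by (simp add: X_def)
    define y where "y = \<rho> (adj V) *v w0"
    have AG: "adj V \<in> GLC" using V by (intro unitary_GLC unitary_adj)
    have VA: "\<rho> (adj V) ** \<rho> V = mat 1" "\<rho> V ** \<rho> (adj V) = mat 1"
      using V by (simp_all flip: rho_mult add: VG AG unitaryD)
    have "D (dg z) *v y = \<rho> (adj V) *v (D X *v w0)"
      unfolding DXe y_def by (simp add: matrix_vector_mul_assoc matrix_mul_assoc VA)
    then have Dy: "D (dg z) *v y = \<kappa> *s y" by (simp add: \<kappa> smult_mv y_def)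
    have "\<rho> (dg (\<lambda>a. exp (z a))) *v y = exp \<kappa> *s y"
    proof (rule coord_eqI)
      fix j
      have "(\<Sum>a\<in>UNIV. z a * of_int (wt j a)) * coord j y = \<kappa> * coord j y"
        using arg_cong[OF Dy, of "coord j"] by (simp add: coord_D_dg)
      then show "coord j (\<rho> (dg (\<lambda>a. exp (z a))) *v y) = coord j (exp \<kappa> *s y)"
        by (cases "coord j y = 0") (simp_all add: coord_rho_dg)
    qed
    moreover have "dg (\<lambda>a. exp (z a)) \<in> GLC" by (rule GLC_dg) simp
    ultimately have "\<rho> (V ** dg (\<lambda>a. exp (z a)) ** adj V) *v w0 = exp \<kappa> *s (\<rho> V *v y)"
      by (simp add: rho_mult GLC_mult VG AG smult_mv y_def flip: matrix_vector_mul_assoc)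
    also have "\<rho> V *v y = w0" by (simp add: y_def matrix_vector_mul_assoc VA)
    finally show "\<exists>c. \<rho> (V ** dg (\<lambda>a. exp (z a)) ** adj V) *v w0 = c *s w0" by blast
  next
    fix a b assume ab: "a \<in> G_cent L" "b \<in> G_cent L" and "\<exists>c. \<rho> a *v w0 = c *s w0" "\<exists>c. \<rho> b *v w0 = c *s w0"
    then obtain c d where "\<rho> a *v w0 = c *s w0" "\<rho> b *v w0 = d *s w0" by blast
    then have "\<rho> (a ** b) *v w0 = (d * c) *s w0"
      using ab by (simp add: rho_mult G_cent_iff smult_mv flip: matrix_vector_mul_assoc)
    then show "\<exists>c. \<rho> (a ** b) *v w0 = c *s w0" by blast
  qed
qed

end

end

section \<open>Unitriangular groups\<close>

text \<open>For a strict order \<open>R\<close> these are the matrices with ones on the diagonal and all other nonzero entries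
  at places \<open>(a, b)\<close> with \<open>R a b\<close>.\<close>

definition unitriangular :: "('n \<Rightarrow> 'n \<Rightarrow> bool) \<Rightarrow> (complex^'n^'n) set" where
  "unitriangular R = {n. \<forall>a b. \<not> R a b \<longrightarrow> n $ a $ b = mat 1 $ a $ b}"

lemma mpow_simps [simp]: "mpow X 0 = mat 1" "mpow X (Suc k) = X ** mpow X k"
  by (simp_all add: mpow_def)

lemma mpow_conj:
  fixes V :: "complex^'n^'n"
  assumes "V \<in> unitary_group"
  shows "mpow (V ** X ** adj V) k = V ** mpow X k ** adj V"
proof (induction k)
  case 0
  then show ?case by (simp add: unitaryD[OF assms])
next
  case (Suc k)
  then show ?case by (simp add: matrix_mul_assoc unitary_cancel[OF assms])
qed

lemma poly_fun_sum:
  assumes "finite A" "\<And>a. a \<in> A \<Longrightarrow> f a \<in> poly_fun"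
  shows "(\<lambda>M. \<Sum>a\<in>A. f a M) \<in> poly_fun"
  using assms by (induction A) (auto intro: poly_fun.intros)

context
  fixes R :: "'n::finite \<Rightarrow> 'n \<Rightarrow> bool"
  assumes transp: "transp R" and irreflp: "irreflp R"
begin

lemma trans: "R a b \<Longrightarrow> R b c \<Longrightarrow> R a c" and irrefl: "\<not> R a a"
  using transp irreflp by (auto dest: transpD irreflpD)

lemma height_less: "R a b \<Longrightarrow> card {c. R b c} < card {c. R a c}"
proof (rule psubset_card_mono)
  assume ab: "R a b"
  then have "{c. R b c} \<subseteq> {c. R a c}" using trans by blast
  moreover have "b \<in> {c. R a c}" "b \<notin> {c. R b c}" using ab irrefl by auto
  ultimately show "{c. R b c} \<subset> {c. R a c}" by blast
qed simp

text \<open>A nonzero entry of the \<open>k\<close>-th power comes from a chain of length \<open>k\<close> for \<open>R\<close>.\<close>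

lemma strictly_triangular_nilpotent:
  assumes X: "\<And>a b. (X :: complex^'n^'n) $ a $ b \<noteq> 0 \<Longrightarrow> R a b"
  shows "mpow X (Suc CARD('n)) = 0"
proof -
  have H: "card {c. R b c} + k \<le> card {c. R a c}" if "mpow X k $ a $ b \<noteq> 0" for k a b
    using that
  proof (induction k arbitrary: a)
    case 0
    then show ?case by (auto simp: mat_nth split: if_splits)
  next
    case (Suc k)
    then obtain c where c: "X $ a $ c \<noteq> 0" "mpow X k $ c $ b \<noteq> 0"
      using mm_nonzero[of X "mpow X k" a b] by auto
    then show ?case using Suc.IH[OF c(2)] height_less[OF X[OF c(1)]] by linarith
  qed
  have "mpow X (Suc CARD('n)) $ a $ b = 0" for a b
  proof (rule ccontr)
    assume "mpow X (Suc CARD('n)) $ a $ b \<noteq> 0"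
    from H[OF this] have "Suc CARD('n) \<le> card {c. R a c}" by linarith
    moreover have "card {c. R a c} \<le> CARD('n)" by (rule card_mono) auto
    ultimately show False by linarith
  qed
  then show ?thesis by (simp only: vec_eq_iff zero_index) blast
qed

lemma unitriangular_entries:
  "n \<in> unitriangular R \<Longrightarrow> (n - mat 1) $ a $ b \<noteq> 0 \<Longrightarrow> R a b"
  by (auto simp: unitriangular_def)

lemma unitriangular_GLC:
  assumes n: "n \<in> unitriangular R"
  shows "n \<in> GLC"
  unfolding GLC_iff_inj
proof (intro allI impI)
  fix v assume v: "n *v v = 0"
  have "v $ a = 0" for a
  proof (induction "card {c. R a c}" arbitrary: a rule: less_induct)
    case less
    have "v + (n - mat 1) *v v = 0" using v by (simp add: matrix_vector_mult_diff_rdistrib)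
    then have "v $ a + (\<Sum>b\<in>UNIV. (n - mat 1) $ a $ b * v $ b) = 0"
      by (simp add: vec_eq_iff matrix_vector_mult_def)
    moreover have "(\<Sum>b\<in>UNIV. (n - mat 1) $ a $ b * v $ b) = 0"
    proof (rule sum.neutral, rule ballI)
      fix b
      show "(n - mat 1) $ a $ b * v $ b = 0"
      proof (cases "(n - mat 1) $ a $ b = 0")
        case False
        then show ?thesis using less[of b] height_less[OF unitriangular_entries[OF n False]] by simp
      qed simp
    qed
    ultimately show ?case by simp
  qed
  then show "v = 0" by (simp add: vec_eq_iff)
qed

lemma unitriangular_mult:
  assumes "m \<in> unitriangular R" "n \<in> unitriangular R"
  shows "m ** n \<in> unitriangular R"
proof -
  have "(m ** n) $ a $ b = mat 1 $ a $ b" if nR: "\<not> R a b" for a b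
  proof -
    have e: "m ** n = mat 1 + (m - mat 1) + (n - mat 1) + (m - mat 1) ** (n - mat 1)"
      by (simp add: bounded_bilinear.diff_left[OF bounded_bilinear_mm] bounded_bilinear.diff_right[OF bounded_bilinear_mm])
    have "((m - mat 1) ** (n - mat 1)) $ a $ b = 0"
    proof (rule ccontr)
      assume "((m - mat 1) ** (n - mat 1)) $ a $ b \<noteq> 0"
      then obtain k where "(m - mat 1) $ a $ k \<noteq> 0" "(n - mat 1) $ k $ b \<noteq> 0" using mm_nonzero by blast
      then show False using nR trans unitriangular_entries[OF assms(1)] unitriangular_entries[OF assms(2)] by blast
    qed
    moreover have "(m - mat 1) $ a $ b = 0" "(n - mat 1) $ a $ b = 0"
      using nR unitriangular_entries[OF assms(1)] unitriangular_entries[OF assms(2)] by blast+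
    ultimately show ?thesis by (subst e) simp
  qed
  then show ?thesis by (simp add: unitriangular_def)
qed

lemma unitriangular_inv:
  assumes n: "n \<in> unitriangular R"
  shows "matrix_inv n \<in> unitriangular R"
proof -
  define p where "p = matrix_inv n"
  have np: "n ** p = mat 1" unfolding p_def by (rule GLC_inv[OF unitriangular_GLC[OF n]])
  have "\<not> R a b \<longrightarrow> p $ a $ b = mat 1 $ a $ b" for a b
  proof (induction "card {c. R a c}" arbitrary: a rule: less_induct)
    case less
    show ?case
    proof
      assume nR: "\<not> R a b"
      have "p + (n - mat 1) ** p = mat 1" using np by (simp add: bounded_bilinear.diff_left[OF bounded_bilinear_mm])
      then have "(p + (n - mat 1) ** p) $ a $ b = mat 1 $ a $ b" by simp
      then have "p $ a $ b + ((n - mat 1) ** p) $ a $ b = mat 1 $ a $ b" by simp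
      moreover have "((n - mat 1) ** p) $ a $ b = 0"
      proof (rule ccontr)
        assume "((n - mat 1) ** p) $ a $ b \<noteq> 0"
        then obtain c where c: "(n - mat 1) $ a $ c \<noteq> 0" "p $ c $ b \<noteq> 0" using mm_nonzero by blast
        then have Rac: "R a c" using unitriangular_entries[OF n] by blast
        then have "\<not> R c b" using nR trans by blast
        then have "p $ c $ b = mat 1 $ c $ b" using less[OF height_less[OF Rac]] by blast
        then have "c = b" using c(2) by (auto simp: mat_nth split: if_splits)
        then show False using Rac nR by simp
      qed
      ultimately show "p $ a $ b = mat 1 $ a $ b" by simp
    qed
  qed
  then show ?thesis by (simp add: unitriangular_def p_def)
qed

text \<open>The group is given by affine linear conditions on the entries, so it is Zariski closed and convex.\<close>

lemma unitriangular_unipotent_group: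
  assumes V: "V \<in> unitary_group"
  defines "N \<equiv> {M. adj V ** M ** V \<in> unitriangular R}"
  shows "algebraic_subgroup N" "connected N" "\<forall>n\<in>N. unipotent n"
proof -
  have conj: "M = V ** (adj V ** M ** V) ** adj V" for M
    by (simp add: matrix_mul_assoc unitary_cancel[OF V] unitaryD[OF V])
  have VG: "V \<in> GLC" "adj V \<in> GLC" using V by (auto intro: unitary_GLC unitary_adj)
  have NG: "N \<subseteq> GLC"
  proof
    fix M assume "M \<in> N"
    then have "adj V ** M ** V \<in> GLC" by (simp add: N_def unitriangular_GLC)
    then have "V ** (adj V ** M ** V) ** adj V \<in> GLC" by (rule GLC_mult[OF GLC_mult[OF VG(1)] VG(2)])
    then show "M \<in> GLC" by (simp only: conj[symmetric])
  qed
  define F where "F = {(\<lambda>M. (adj V ** M ** V) $ a $ b + - (mat 1 $ a $ b)) |a b. \<not> R a b}"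
  have F: "F \<subseteq> poly_fun"
  proof
    fix f assume "f \<in> F"
    then obtain a b where f: "f = (\<lambda>M. (adj V ** M ** V) $ a $ b + - (mat 1 $ a $ b))" by (auto simp: F_def)
    have e: "(adj V ** M ** V) $ a $ b = (\<Sum>j\<in>UNIV. (\<Sum>i\<in>UNIV. adj V $ a $ i * M $ i $ j) * V $ j $ b)" for M
      by (simp add: matrix_matrix_mult_def)
    show "f \<in> poly_fun" unfolding f e by (intro poly_fun.intros poly_fun_sum finite)
  qed
  have "N = {M \<in> GLC. \<forall>f\<in>F. f M = 0}"
  proof (intro equalityI subsetI)
    fix M assume M: "M \<in> N"
    then have "M \<in> GLC" using NG by blast
    with M show "M \<in> {M \<in> GLC. \<forall>f\<in>F. f M = 0}" by (auto simp: F_def N_def unitriangular_def)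
  next
    fix M assume "M \<in> {M \<in> GLC. \<forall>f\<in>F. f M = 0}"
    then have M: "\<forall>f\<in>F. f M = 0" by simp
    have "(adj V ** M ** V) $ a $ b = mat 1 $ a $ b" if nR: "\<not> R a b" for a b
    proof -
      have "(\<lambda>M. (adj V ** M ** V) $ a $ b + - (mat 1 $ a $ b)) \<in> F" using nR by (auto simp: F_def)
      from bspec[OF M this] show ?thesis by simp
    qed
    then show "M \<in> N" by (simp add: N_def unitriangular_def)
  qed
  moreover have "mat 1 \<in> N" by (simp add: N_def unitriangular_def unitaryD[OF V])
  moreover have "a ** b \<in> N" if ab: "a \<in> N" "b \<in> N" for a b
  proof -
    have "adj V ** (a ** b) ** V = (adj V ** a ** V) ** (adj V ** b ** V)"
      by (simp add: matrix_mul_assoc unitary_cancel[OF V])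
    then show ?thesis using ab unitriangular_mult by (simp add: N_def)
  qed
  moreover have "matrix_inv a \<in> N" if a: "a \<in> N" for a
  proof -
    have "adj V ** a ** V ** (adj V ** matrix_inv a ** V) = mat 1"
      using GLC_inv[of a] a NG by (simp add: matrix_mul_assoc unitary_cancel[OF V] unitaryD[OF V] GLC_cancel subsetD)
    then have "adj V ** matrix_inv a ** V = matrix_inv (adj V ** a ** V)" by (rule GLC_inv_unique[symmetric])
    then show ?thesis using a unitriangular_inv by (simp add: N_def)
  qed
  ultimately show "algebraic_subgroup N" unfolding algebraic_subgroup_def using F by blast
  have "convex N"
    unfolding convex_def N_def unitriangular_def
    by (auto simp: matrix_add_ldistrib mm_add_left matrix_scalar_ac scalar_matrix_assoc[symmetric]
        scaleR_left_distrib[symmetric])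
  then show "connected N" by (rule convex_connected)
  show "\<forall>n\<in>N. unipotent n"
  proof
    fix n assume n: "n \<in> N"
    define X where "X = adj V ** n ** V - mat 1"
    have "n - mat 1 = V ** X ** adj V"
      unfolding X_def by (simp add: bounded_bilinear.diff_left[OF bounded_bilinear_mm]
          bounded_bilinear.diff_right[OF bounded_bilinear_mm] matrix_mul_assoc unitary_cancel[OF V] unitaryD[OF V])
    moreover have "mpow X (Suc CARD('n)) = 0"
      by (rule strictly_triangular_nilpotent) (use n in \<open>auto simp: X_def N_def intro: unitriangular_entries\<close>)
    ultimately have "mpow (n - mat 1) (Suc CARD('n)) = 0"
      by (simp only: mpow_conj[OF V] times0_left times0_right)
    then show "unipotent n" unfolding unipotent_def by blast
  qed
qed

end

section \<open>Compact orbits with reductive stabilisers\<close>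

context unitary_rep
begin

lemma conj_rep:
  assumes V: "V \<in> unitary_group"
  shows "unitary_rep (\<lambda>M. \<rho> (V ** M ** adj V))"
proof
  have VG: "V \<in> GLC" "adj V \<in> GLC" using V by (auto intro: unitary_GLC unitary_adj)
  have bl: "bounded_linear (\<lambda>M. V ** M ** adj V)"
    by (rule bounded_linear_compose[OF bounded_bilinear.bounded_linear_left[OF bounded_bilinear_mm]
        bounded_bilinear.bounded_linear_right[OF bounded_bilinear_mm]])
  show "\<rho> (V ** k ** adj V) \<in> unitary_group" if "k \<in> unitary_group" for k
    using that V by (intro unitary unitary_mult unitary_adj)
  show "complex_rep (\<lambda>M. \<rho> (V ** M ** adj V))"
    unfolding complex_rep_def
  proof (intro conjI ballI)
    fix M :: "complex^'n^'n" assume M: "M \<in> GLC"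
    then have MG: "V ** M ** adj V \<in> GLC" using VG by (intro GLC_mult)
    then show "\<rho> (V ** M ** adj V) \<in> GLC" by (rule rho_GLC)
    show "\<rho> (V ** (M ** N) ** adj V) = \<rho> (V ** M ** adj V) ** \<rho> (V ** N ** adj V)" if N: "N \<in> GLC" for N
    proof -
      have "V ** (M ** N) ** adj V = (V ** M ** adj V) ** (V ** N ** adj V)"
        by (simp add: matrix_mul_assoc unitary_cancel[OF V])
      then show ?thesis using M N VG by (simp add: rho_mult GLC_mult)
    qed
    obtain D' where D': "(\<rho> has_derivative D') (at (V ** M ** adj V))" "\<And>c X. D' (mat c ** X) = mat c ** D' X"
      using rep MG unfolding complex_rep_def by blast
    have "((\<lambda>M. V ** M ** adj V) has_derivative (\<lambda>M. V ** M ** adj V)) (at M)"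
      using bounded_linear_imp_has_derivative[OF bl] .
    from diff_chain_at[OF this D'(1)]
    have "((\<lambda>M. \<rho> (V ** M ** adj V)) has_derivative (\<lambda>X. D' (V ** X ** adj V))) (at M)" by (simp add: o_def)
    moreover have "D' (V ** (mat c ** X) ** adj V) = mat c ** D' (V ** X ** adj V)" for c X
    proof -
      have "V ** (mat c ** X) ** adj V = mat c ** (V ** X ** adj V)"
        by (simp add: matrix_mul_assoc mat_commute[of c V])
      then show ?thesis by (simp add: D'(2))
    qed
    ultimately show "\<exists>D. ((\<lambda>M. \<rho> (V ** M ** adj V)) has_derivative D) (at M) \<and> (\<forall>c X. D (mat c ** X) = mat c ** D X)"
      by blast
  qed
qed

text \<open>The orbit contains a highest weight line \<open>[w0]\<close>, for the representation \<open>\<sigma>\<close> conjugated so that \<open>\<Lambda>\<close>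
  becomes diagonal. Let \<open>N\<close> be the group of block unitriangular matrices for the order given by the
  weight \<open>\<eta>\<close> within the eigenspaces of \<open>\<Lambda>\<close>. It fixes \<open>w0\<close>, and the stabiliser of \<open>[w0]\<close>, which is block
  triangular for the same order, normalises it. So \<open>N\<close> is trivial, which means that \<open>\<eta>\<close> is
  constant on eigenspaces.\<close>

lemma reductive_compact_orbit_fixed:
  assumes \<Lambda>: "hermitian \<Lambda>" and w: "w \<noteq> 0"
    and orb: "\<And>h. h \<in> G_cent \<Lambda> \<Longrightarrow> \<exists>k\<in>K_cent \<Lambda>. vec.span {\<rho> h *v w} = vec.span {\<rho> k *v w}"
    and red: "\<And>k. k \<in> K_cent \<Lambda> \<Longrightarrow> reductive (proj_stab \<rho> (G_cent \<Lambda>) (vec.span {\<rho> k *v w}))"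
    and h: "h \<in> G_cent \<Lambda>"
  shows "\<exists>c. \<rho> h *v w = c *s w"
proof -
  obtain V where V: "V \<in> unitary_group" "\<And>H. H \<in> {\<Lambda>} \<Longrightarrow> \<exists>d :: 'n \<Rightarrow> real. H = V ** dg (\<lambda>i. of_real (d i)) ** adj V"
    by (rule simultaneous_diagonalization[of "{\<Lambda>}"]) (use \<Lambda> in auto)
  then obtain l :: "'n \<Rightarrow> real" where l: "\<Lambda> = V ** dg (\<lambda>i. of_real (l i)) ** adj V" by blast
  define L where "L = dg (\<lambda>i. complex_of_real (l i))"
  have VV: "V ** (adj V ** M ** V) ** adj V = M" "adj V ** (V ** M ** adj V) ** V = M" for M
    by (simp_all add: matrix_mul_assoc unitary_cancel[OF V(1)] unitaryD[OF V(1)])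
  have GL: "M \<in> G_cent \<Lambda> \<longleftrightarrow> adj V ** M ** V \<in> G_cent L" and KL: "M \<in> K_cent \<Lambda> \<longleftrightarrow> adj V ** M ** V \<in> K_cent L" for M
    unfolding l L_def by (rule G_cent_conj[OF V(1)])+
  define \<sigma> where "\<sigma> M = \<rho> (V ** M ** adj V)" for M
  interpret S: unitary_rep \<sigma> unfolding \<sigma>_def by (rule conj_rep[OF V(1)])
  have orb': "\<exists>k\<in>K_cent L. vec.span {\<sigma> h *v w} = vec.span {\<sigma> k *v w}" if hL: "h \<in> G_cent L" for h
  proof -
    have "V ** h ** adj V \<in> G_cent \<Lambda>" using hL by (simp add: GL VV)
    then obtain k where k: "k \<in> K_cent \<Lambda>" "vec.span {\<sigma> h *v w} = vec.span {\<rho> k *v w}"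
      using orb by (auto simp: \<sigma>_def)
    have "\<sigma> (adj V ** k ** V) = \<rho> k" by (simp add: \<sigma>_def VV)
    then show ?thesis using k KL by (intro bexI[of _ "adj V ** k ** V"]) auto
  qed
  obtain k \<xi> \<eta> where k: "k \<in> K_cent L" and \<xi>: "inj (\<xi> :: 'n \<Rightarrow> real)"
    and wt: "\<And>x. S.D (dg x) *v (\<sigma> k *v w) = (\<Sum>a\<in>UNIV. x a * of_int (\<eta> a)) *s (\<sigma> k *v w)"
    and up: "\<And>n. n \<in> G_cent L \<Longrightarrow> (\<And>a b. n $ a $ b \<noteq> mat 1 $ a $ b \<Longrightarrow> \<xi> a > \<xi> b) \<Longrightarrow> \<sigma> n *v (\<sigma> k *v w) = \<sigma> k *v w"
    using S.highest_weight_vector[OF w orb'[unfolded L_def], folded L_def] by blast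
  define w0 where "w0 = \<sigma> k *v w"
  have kG: "k \<in> GLC" using k by (simp add: K_cent_iff unitary_GLC)
  have w0: "w0 \<noteq> 0" unfolding w0_def by (rule S.rho_nz[OF kG w])
  have up': "\<forall>n\<in>G_cent L. (\<forall>a b. n $ a $ b \<noteq> mat 1 $ a $ b \<longrightarrow> \<xi> a > \<xi> b) \<longrightarrow> \<sigma> n *v w0 = w0"
    using up unfolding w0_def by blast
  note facts = w0 \<xi> wt[folded w0_def] up'[unfolded L_def]
  note parabolic = S.stabilizer_parabolic[OF facts, folded L_def]
  note unipotent_fixes = S.unipotent_fixes[OF facts, folded L_def]
  note central = S.central_weight_fixed[OF facts, folded L_def]
  define k\<Lambda> where "k\<Lambda> = V ** k ** adj V"
  have k\<Lambda>: "k\<Lambda> \<in> K_cent \<Lambda>" unfolding k\<Lambda>_def KL VV by (rule k)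
  have w0\<Lambda>: "w0 = \<rho> k\<Lambda> *v w" by (simp add: w0_def \<sigma>_def k\<Lambda>_def)
  define H where "H = proj_stab \<rho> (G_cent \<Lambda>) (vec.span {w0})"
  have H: "reductive H" unfolding H_def w0\<Lambda> by (rule red[OF k\<Lambda>])
  define R where "R a b \<longleftrightarrow> \<eta> a > \<eta> b \<and> l a = l b" for a b
  have R: "transp R" "irreflp R" by (auto simp: R_def transp_def irreflp_def)
  define N where "N = {M. adj V ** M ** V \<in> unitriangular R}"
  note N = unitriangular_unipotent_group[OF R V(1), folded N_def]
  have N\<sigma>: "n \<in> G_cent L" if n: "n \<in> unitriangular R" for n
    unfolding L_def G_cent_dg
  proof (intro conjI allI impI)
    show "n \<in> GLC" by (rule unitriangular_GLC[OF R n])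
    show "complex_of_real (l a) = of_real (l b)" if "n $ a $ b \<noteq> 0" for a b
      using n that by (cases "R a b") (auto simp: unitriangular_def R_def mat_nth split: if_splits)
  qed
  have "N \<subseteq> H"
  proof
    fix M assume "M \<in> N"
    then have n: "adj V ** M ** V \<in> unitriangular R" by (simp add: N_def)
    have "\<sigma> (adj V ** M ** V) *v w0 = w0"
      by (rule unipotent_fixes[OF N\<sigma>[OF n]]) (use n in \<open>auto simp: unitriangular_def R_def\<close>)
    then have "\<rho> M *v w0 = w0" by (simp add: \<sigma>_def VV)
    then show "M \<in> H" using N\<sigma>[OF n] by (simp add: H_def proj_stab_def act_span GL)
  qed
  moreover have "h ** n ** matrix_inv h \<in> N" if hH: "h \<in> H" and nN: "n \<in> N" for h n
  proof -
    have hG: "h \<in> G_cent \<Lambda>" "h \<in> GLC" and "vec.span {\<rho> h *v w0} = vec.span {w0}"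
      using hH by (auto simp: H_def proj_stab_def act_span G_cent_iff)
    then obtain c where c: "c \<noteq> 0" "\<rho> h *v w0 = c *s w0"
      using span_eqD rho_nz[OF hG(2) w0] by metis
    define h' where "h' = adj V ** h ** V"
    define i' where "i' = adj V ** matrix_inv h ** V"
    have "w0 = \<rho> (matrix_inv h) *v (c *s w0)"
      unfolding c(2)[symmetric] rho_inv[OF hG(2)] by (simp add: GLC_cancel rho_GLC hG)
    then have "\<rho> (matrix_inv h) *v w0 = (1 / c) *s w0"
      using c(1) by (metis smult_mv vector_smult_assoc vector_smult_lid nonzero_divide_eq_eq)
    then have s: "\<sigma> h' *v w0 = c *s w0" "\<sigma> i' *v w0 = (1 / c) *s w0"
      by (simp_all add: \<sigma>_def h'_def i'_def VV c(2))
    have h'L: "h' \<in> G_cent L" "i' \<in> G_cent L"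
      using hG(1) G_cent_inv[OF hG(1)] by (simp_all add: GL h'_def i'_def)
    define n' where "n' = adj V ** n ** V"
    have n': "n' \<in> unitriangular R" using nN by (simp add: N_def n'_def)
    have hi: "h' ** i' = mat 1"
      unfolding h'_def i'_def
      by (simp add: matrix_mul_assoc unitary_cancel[OF V(1)] GLC_cancel hG unitaryD[OF V(1)])
    have e: "adj V ** (h ** n ** matrix_inv h) ** V = mat 1 + h' ** (n' - mat 1) ** i'"
    proof -
      have "h' ** (n' - mat 1) ** i' = h' ** n' ** i' - mat 1"
        by (simp add: bounded_bilinear.diff_left[OF bounded_bilinear_mm]
          bounded_bilinear.diff_right[OF bounded_bilinear_mm] hi)
      moreover have "h' ** n' ** i' = adj V ** (h ** n ** matrix_inv h) ** V"
        by (simp add: h'_def n'_def i'_def matrix_mul_assoc unitary_cancel[OF V(1)])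
      ultimately show ?thesis by simp
    qed
    have "(h' ** (n' - mat 1) ** i') $ a $ b = 0" if nR: "\<not> R a b" for a b
    proof (rule ccontr)
      assume "(h' ** (n' - mat 1) ** i') $ a $ b \<noteq> 0"
      then obtain j where j: "(h' ** (n' - mat 1)) $ a $ j \<noteq> 0" "i' $ j $ b \<noteq> 0" using mm_nonzero by blast
      obtain i where i: "h' $ a $ i \<noteq> 0" "(n' - mat 1) $ i $ j \<noteq> 0" using mm_nonzero[OF j(1)] by blast
      have "\<eta> a \<ge> \<eta> i" "l a = l i" using parabolic[OF h'L(1) s(1) i(1)] h'L(1) i(1) by (auto simp: L_def G_cent_dg)
      moreover have "\<eta> i > \<eta> j" "l i = l j" using unitriangular_entries[OF R n' i(2)] by (auto simp: R_def)
      moreover have "\<eta> j \<ge> \<eta> b" "l j = l b" using parabolic[OF h'L(2) s(2) j(2)] h'L(2) j(2) by (auto simp: L_def G_cent_dg)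
      ultimately show False using nR by (simp add: R_def)
    qed
    then show ?thesis by (simp add: N_def e unitriangular_def)
  qed
  ultimately have triv: "N = {mat 1}" using H N unfolding reductive_def by blast
  have nR: "\<not> R a b" for a b
  proof
    assume Rab: "R a b"
    have "mat 1 + Emat a b \<in> unitriangular R" using Rab by (auto simp: unitriangular_def Emat_nth)
    then have "V ** (mat 1 + Emat a b) ** adj V \<in> N" by (simp add: N_def VV)
    then have "V ** (mat 1 + Emat a b) ** adj V = mat 1" using triv by blast
    then have "adj V ** (V ** (mat 1 + Emat a b) ** adj V) ** V = adj V ** mat 1 ** V" by simp
    then have "mat 1 + Emat a b = mat 1" unfolding VV by (simp add: unitaryD[OF V(1)])
    then have "Emat a b = 0" by simp
    from arg_cong[OF this, of "\<lambda>M. M $ a $ b"] show False by (simp add: Emat_nth)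
  qed
  have eq: "\<eta> a = \<eta> b" if "l a = l b" for a b
    using nR[of a b] nR[of b a] that by (auto simp: R_def)
  have fixed: "\<exists>c. \<rho> h *v w0 = c *s w0" if hG: "h \<in> G_cent \<Lambda>" for h
  proof -
    have "\<exists>c. \<sigma> (adj V ** h ** V) *v w0 = c *s w0" by (rule central[OF eq]) (use hG GL in auto)
    then show ?thesis by (simp add: \<sigma>_def VV)
  qed
  have kGL: "k\<Lambda> \<in> G_cent \<Lambda>" "k\<Lambda> \<in> GLC" using k\<Lambda> K_cent_subset_G_cent by (auto simp: K_cent_iff unitary_GLC)
  obtain c1 where c1: "\<rho> (matrix_inv k\<Lambda>) *v w0 = c1 *s w0" using fixed[OF G_cent_inv[OF kGL(1)]] by blast
  have "\<rho> (matrix_inv k\<Lambda>) *v w0 = w" unfolding w0\<Lambda> rho_inv[OF kGL(2)] by (simp add: GLC_cancel rho_GLC kGL(2))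
  then have w1: "w = c1 *s w0" using c1 by simp
  obtain c2 where "\<rho> h *v w0 = c2 *s w0" using fixed[OF h] by blast
  then have "\<rho> h *v w = c2 *s w" by (simp add: w1 smult_mv mult.commute)
  then show ?thesis by blast
qed

end

section \<open>One-parameter degenerations to a fixed line\<close>

text \<open>A large multiple of \<open>- X\<close> has large positive products with all elements of \<open>S\<close>; rounding it changes the
  product with \<open>d\<close> by at most the sum \<open>B d\<close> of the absolute values of \<open>d\<close>.\<close>

lemma integral_halfspace:
  fixes S :: "('n::finite \<Rightarrow> int) set" and X :: "'n \<Rightarrow> real"
  assumes "finite S" "\<And>d. d \<in> S \<Longrightarrow> (\<Sum>a\<in>UNIV. X a * of_int (d a)) < 0"
  shows "\<exists>n :: 'n \<Rightarrow> int. \<forall>d\<in>S. (\<Sum>a\<in>UNIV. n a * d a) > 0"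
proof -
  define B where "B d = (\<Sum>a\<in>UNIV. \<bar>of_int (d a) :: real\<bar>)" for d :: "'n \<Rightarrow> int"
  have "\<exists>N::nat. \<forall>d\<in>S. real N * - (\<Sum>a\<in>UNIV. X a * of_int (d a)) > B d"
    using assms
  proof (induction S)
    case (insert d S)
    then obtain N :: nat where N: "\<forall>d\<in>S. real N * - (\<Sum>a\<in>UNIV. X a * of_int (d a)) > B d" by auto
    have pos: "- (\<Sum>a\<in>UNIV. X a * of_int (d a)) > 0" using insert.prems[of d] by simp
    obtain M :: nat where M: "real M * - (\<Sum>a\<in>UNIV. X a * of_int (d a)) > B d"
      using reals_Archimedean3[OF pos] by blast
    have "real (max M N) * - (\<Sum>a\<in>UNIV. X a * of_int (e a)) > B e" if e: "e \<in> insert d S" for e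
    proof -
      have p: "- (\<Sum>a\<in>UNIV. X a * of_int (e a)) \<ge> 0" using insert.prems[OF e] by simp
      have "real M * - (\<Sum>a\<in>UNIV. X a * of_int (e a)) > B e \<or> real N * - (\<Sum>a\<in>UNIV. X a * of_int (e a)) > B e"
        using e M N by blast
      moreover have "real M * - (\<Sum>a\<in>UNIV. X a * of_int (e a)) \<le> real (max M N) * - (\<Sum>a\<in>UNIV. X a * of_int (e a))"
        "real N * - (\<Sum>a\<in>UNIV. X a * of_int (e a)) \<le> real (max M N) * - (\<Sum>a\<in>UNIV. X a * of_int (e a))"
        using p by (intro mult_right_mono; simp)+
      ultimately show ?thesis by linarith
    qed
    then show ?case by blast
  qed simp
  then obtain N :: nat where N: "\<And>d. d \<in> S \<Longrightarrow> real N * - (\<Sum>a\<in>UNIV. X a * of_int (d a)) > B d" by blast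
  define n where "n a = \<lfloor>- (real N * X a)\<rfloor>" for a
  have "(\<Sum>a\<in>UNIV. n a * d a) > 0" if d: "d \<in> S" for d
  proof -
    have t: "of_int (n a * d a) \<ge> - (real N * X a) * of_int (d a) - \<bar>of_int (d a)\<bar>" for a
    proof -
      have "\<bar>of_int (n a) - - (real N * X a)\<bar> \<le> 1" unfolding n_def by linarith
      then have "\<bar>(of_int (n a) - - (real N * X a)) * of_int (d a)\<bar> \<le> 1 * \<bar>of_int (d a)\<bar>"
        unfolding abs_mult by (intro mult_right_mono) auto
      then show ?thesis by (simp add: algebra_simps abs_le_iff)
    qed
    have "of_int (\<Sum>a\<in>UNIV. n a * d a) = (\<Sum>a\<in>UNIV. (of_int (n a * d a) :: real))" by (rule of_int_sum)
    also have "\<dots> \<ge> (\<Sum>a\<in>UNIV. - (real N * X a) * of_int (d a) - \<bar>of_int (d a)\<bar>)"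
      by (intro sum_mono t)
    also have "(\<Sum>a\<in>UNIV. - (real N * X a) * of_int (d a) - \<bar>of_int (d a)\<bar>) =
        real N * - (\<Sum>a\<in>UNIV. X a * of_int (d a)) - B d"
      by (simp add: B_def sum_subtractf sum_negf sum_distrib_left mult.assoc)
    finally have "of_int (\<Sum>a\<in>UNIV. n a * d a) > (0::real)" using N[OF d] by linarith
    then show ?thesis by (simp only: of_int_0_less_iff)
  qed
  then show ?thesis by blast
qed

lemma algebraic_1ps_conj_dg:
  fixes V :: "complex^'n^'n" and n :: "'n \<Rightarrow> int"
  assumes V: "V \<in> unitary_group" and \<Lambda>: "\<Lambda> = V ** dg l ** adj V"
  shows "algebraic_1ps (\<lambda>t. V ** dg (\<lambda>a. t powi n a) ** adj V) (G_cent \<Lambda>)"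
  unfolding algebraic_1ps_def
proof (intro conjI allI impI)
  fix z :: complex assume "z \<noteq> 0"
  then show "V ** dg (\<lambda>a. z powi n a) ** adj V \<in> G_cent \<Lambda>"
    by (intro conj_dg_in_G_cent[OF V \<Lambda>]) simp
next
  fix z w :: complex assume "z \<noteq> 0" "w \<noteq> 0"
  have "V ** dg (\<lambda>a. z powi n a) ** adj V ** (V ** dg (\<lambda>a. w powi n a) ** adj V) =
    V ** (dg (\<lambda>a. z powi n a) ** dg (\<lambda>a. w powi n a)) ** adj V"
    by (simp only: matrix_mul_assoc unitary_cancel[OF V])
  then show "V ** dg (\<lambda>a. (z * w) powi n a) ** adj V =
    V ** dg (\<lambda>a. z powi n a) ** adj V ** (V ** dg (\<lambda>a. w powi n a) ** adj V)"
    by (simp add: power_int_mult_distrib)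
next
  fix i j
  define N where "N = nat (Max (range (\<lambda>a. \<bar>n a\<bar>)))"
  have N: "n a + int N \<ge> 0" for a
  proof -
    have "\<bar>n a\<bar> \<le> Max (range (\<lambda>a. \<bar>n a\<bar>))" by (intro Max_ge) auto
    then show ?thesis unfolding N_def by linarith
  qed
  define p where "p = (\<Sum>a\<in>UNIV. monom (V $ i $ a * cnj (V $ j $ a)) (nat (n a + int N)))"
  have "(V ** dg (\<lambda>a. z powi n a) ** adj V) $ i $ j = poly p z / z ^ N" if z: "z \<noteq> 0" for z
  proof -
    have e: "z powi n a = z ^ nat (n a + int N) / z ^ N" for a
    proof -
      have "z powi (n a + int N) = z ^ nat (n a + int N)" using N[of a] by (simp add: power_int_def)
      moreover have "z powi (n a + int N) = z powi n a * z ^ N" using z by (simp add: power_int_add)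
      ultimately show ?thesis using z by (simp add: field_simps)
    qed
    have "(V ** dg (\<lambda>a. z powi n a) ** adj V) $ i $ j = (\<Sum>a\<in>UNIV. V $ i $ a * z powi n a * cnj (V $ j $ a))"
      unfolding matrix_matrix_mult_def[of "V ** dg (\<lambda>a. z powi n a)"] by (simp add: mult_dg_nth)
    also have "\<dots> = (\<Sum>a\<in>UNIV. V $ i $ a * cnj (V $ j $ a) * z ^ nat (n a + int N) / z ^ N)"
      by (rule sum.cong) (simp_all add: e mult_ac)
    also have "\<dots> = poly p z / z ^ N" by (simp add: p_def poly_sum poly_monom sum_divide_distrib)
    finally show ?thesis .
  qed
  then show "\<exists>p k. \<forall>z. z \<noteq> 0 \<longrightarrow> (V ** dg (\<lambda>a. z powi n a) ** adj V) $ i $ j = poly p z / z ^ k" by blast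
qed

lemma tendsto_powi_0: "e > 0 \<Longrightarrow> ((\<lambda>t::complex. t powi e) \<longlongrightarrow> 0) (at 0)"
proof -
  assume e: "e > 0"
  have "((\<lambda>t::complex. t ^ nat e) \<longlongrightarrow> 0 ^ nat e) (at 0)" by (intro tendsto_intros)
  then show ?thesis using e by (simp add: power_int_def zero_power)
qed

context unitary_rep
begin

lemma component_coord: "norm (coord j v) \<le> norm v"
proof -
  have "norm (coord j v) \<le> norm (adj W *v v)" unfolding coord_def by (rule Finite_Cartesian_Product.norm_nth_le)
  then show ?thesis using unitary_adj[OF W_unitary] by simp
qed

lemma tendsto_coordI:
  assumes "\<And>j. ((\<lambda>t. coord j (f t)) \<longlongrightarrow> coord j v) F"
  shows "(f \<longlongrightarrow> v) F"
proof -
  have "((\<lambda>t. adj W *v f t) \<longlongrightarrow> adj W *v v) F"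
    by (rule vec_tendstoI) (use assms in \<open>simp add: coord_def\<close>)
  then have "((\<lambda>t. W *v (adj W *v f t)) \<longlongrightarrow> W *v (adj W *v v)) F" by (rule tendsto_mv[OF tendsto_const])
  then show ?thesis by (simp add: unitary_cancel W_unitary)
qed

text \<open>Write \<open>L i = k\<^sub>i V\<^sub>i diag(exp X\<^sub>i) V\<^sub>i\<inverse>\<close> by the polar decomposition, and pass to a subsequence with
  \<open>V\<^sub>i \<longlonglongrightarrow> V0\<close>. In the basis given by \<open>V0\<close> the vector \<open>w\<close> has a single weight \<open>wt p\<close>. Every weight
  \<open>wt j\<close> that occurs in \<open>u\<close> also occurs, with coordinates bounded away from zero, in the basis given by
  \<open>V\<^sub>i\<close> for large \<open>i\<close>; since \<open>L i\<close> makes \<open>u\<close> small compared with \<open>w\<close>, the form \<open>X\<^sub>i\<close> is negative on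
  \<open>wt j - wt p\<close>. There are finitely many conditions, so one \<open>i\<close> satisfies all of them, and
  \<open>integral_halfspace\<close> turns \<open>X\<^sub>i\<close> into exponents \<open>n\<close> of a one-parameter subgroup.\<close>

lemma degeneration_to_fixed_line:
  assumes \<Lambda>: "hermitian \<Lambda>" and w: "w \<noteq> 0"
    and fixed: "\<And>h. h \<in> G_cent \<Lambda> \<Longrightarrow> \<exists>c. \<rho> h *v w = c *s w"
    and L: "\<And>i. L i \<in> G_cent \<Lambda>"
    and lim: "(\<lambda>i. norm (\<rho> (L i) *v u) / norm (\<rho> (L i) *v w)) \<longlonglongrightarrow> 0"
    and a: "a \<noteq> 0"
  shows "\<exists>\<phi>. algebraic_1ps \<phi> (G_cent \<Lambda>) \<and>
    limitin proj_top (\<lambda>t. act (\<rho> (\<phi> t)) (vec.span {a *s w + u})) (vec.span {w}) (at 0)"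
proof -
  have "\<exists>k V (s :: 'n \<Rightarrow> real) (l :: 'n \<Rightarrow> real). k \<in> K_cent \<Lambda> \<and> V \<in> unitary_group \<and> (\<forall>a. s a > 0) \<and>
    \<Lambda> = V ** dg (\<lambda>a. of_real (l a)) ** adj V \<and> L i = k ** (V ** dg (\<lambda>a. of_real (s a)) ** adj V)" for i
    using polar_decomposition[OF \<Lambda> L[of i]] by metis
  then obtain k V and s l :: "nat \<Rightarrow> 'n \<Rightarrow> real" where k: "\<And>i. k i \<in> K_cent \<Lambda>" and V: "\<And>i. V i \<in> unitary_group"
    and s: "\<And>i a. s i a > 0" and l: "\<And>i. \<Lambda> = V i ** dg (\<lambda>a. of_real (l i a)) ** adj (V i)"
    and Li: "\<And>i. L i = k i ** (V i ** dg (\<lambda>a. of_real (s i a)) ** adj (V i))"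
    by metis
  obtain V0 r where V0: "V0 \<in> unitary_group" and r: "strict_mono (r :: nat \<Rightarrow> nat)" and Vlim: "(V \<circ> r) \<longlonglongrightarrow> V0"
    using compact_unitary V unfolding compact_def by metis
  have Vlim: "(\<lambda>i. V (r i)) \<longlonglongrightarrow> V0" using Vlim by (simp add: o_def)
  define l0 where "l0 a = (adj V0 ** \<Lambda> ** V0) $ a $ a" for a
  have "(\<lambda>i. adj (V (r i)) ** \<Lambda> ** V (r i)) \<longlonglongrightarrow> adj V0 ** \<Lambda> ** V0" by (intro tendsto_intros Vlim)
  moreover have "adj (V i) ** \<Lambda> ** V i = dg (\<lambda>a. of_real (l i a))" for i
    by (subst l[of i]) (simp add: matrix_mul_assoc unitary_cancel[OF V] unitaryD[OF V])
  ultimately have dl: "(\<lambda>i. dg (\<lambda>a. complex_of_real (l (r i) a))) \<longlonglongrightarrow> adj V0 ** \<Lambda> ** V0" by simp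
  have "(adj V0 ** \<Lambda> ** V0) $ a $ b = 0" if "a \<noteq> b" for a b
  proof -
    have "(\<lambda>i. dg (\<lambda>a. complex_of_real (l (r i) a)) $ a $ b) \<longlonglongrightarrow> (adj V0 ** \<Lambda> ** V0) $ a $ b"
      by (intro tendsto_vec_nth dl)
    then show ?thesis using that by (simp add: dg_nth LIMSEQ_const_iff)
  qed
  then have "adj V0 ** \<Lambda> ** V0 = dg l0" by (simp add: vec_eq_iff dg_nth l0_def)
  then have "V0 ** (adj V0 ** \<Lambda> ** V0) ** adj V0 = V0 ** dg l0 ** adj V0" by simp
  then have \<Lambda>0: "\<Lambda> = V0 ** dg l0 ** adj V0"
    by (simp add: matrix_mul_assoc unitary_cancel[OF V0] unitaryD[OF V0])
  have G: "V0 \<in> GLC" "adj V0 \<in> GLC" "\<And>i. V i \<in> GLC" "\<And>i. adj (V i) \<in> GLC"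
    using V V0 by (auto intro: unitary_GLC unitary_adj)
  have rhoVV: "\<rho> (adj U) *v (\<rho> U *v x) = x" "\<rho> U *v (\<rho> (adj U) *v x) = x" if U: "U \<in> unitary_group" for U x
    using U by (simp_all add: rho_adj_unitary unitary_cancel[OF unitary])
  define T where "T z = dg (\<lambda>a. exp (z a))" for z :: "'n \<Rightarrow> complex"
  have TG: "T z \<in> GLC" for z unfolding T_def by (rule GLC_dg) simp
  \<comment> \<open>\<open>\<rho> (adj U) w\<close> is a weight vector for every unitary \<open>U\<close> that diagonalises \<open>\<Lambda>\<close>\<close>
  have wvec: "\<rho> (T z) *v (\<rho> (adj U) *v w) = exp (\<Sum>a\<in>UNIV. z a * of_int (wt p a)) *s (\<rho> (adj U) *v w)"
    if U: "U \<in> unitary_group" "\<Lambda> = U ** dg m ** adj U" and p: "coord p (\<rho> (adj U) *v w) \<noteq> 0" for U m p z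
  proof -
    have UG: "U \<in> GLC" "adj U \<in> GLC" using U by (auto intro: unitary_GLC unitary_adj)
    have "U ** T z ** adj U \<in> G_cent \<Lambda>" unfolding T_def by (rule conj_dg_in_G_cent[OF U]) simp
    then obtain c where "\<rho> (U ** T z ** adj U) *v w = c *s w" using fixed by blast
    then have "\<rho> U *v (\<rho> (T z) *v (\<rho> (adj U) *v w)) = c *s w"
      using UG TG by (simp add: rho_mult GLC_mult flip: matrix_vector_mul_assoc)
    from arg_cong[OF this, of "(*v) (\<rho> (adj U))"]
    have c: "\<rho> (T z) *v (\<rho> (adj U) *v w) = c *s (\<rho> (adj U) *v w)"
      by (simp add: rhoVV[OF U(1)] smult_mv)
    from arg_cong[OF this, of "coord p"] have "exp (\<Sum>a\<in>UNIV. z a * of_int (wt p a)) = c"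
      using p by (simp add: T_def coord_rho_dg)
    with c show ?thesis by simp
  qed
  define x where "x = \<rho> (adj V0) *v w"
  define y where "y = \<rho> (adj V0) *v u"
  have xlim: "(\<lambda>i. \<rho> (adj (V (r i))) *v w) \<longlonglongrightarrow> x" and ylim: "(\<lambda>i. \<rho> (adj (V (r i))) *v u) \<longlonglongrightarrow> y"
    unfolding x_def y_def by (intro tendsto_intros tendsto_rho Vlim G)+
  have x0: "x \<noteq> 0" unfolding x_def by (rule rho_nz[OF G(2) w])
  obtain p where p: "coord p x \<noteq> 0" using coord_nonzero[OF x0] by blast
  have evp: "\<forall>\<^sub>F i in sequentially. coord p (\<rho> (adj (V (r i))) *v w) \<noteq> 0"
    by (rule tendsto_imp_eventually_ne[OF _ p]) (intro tendsto_intros xlim)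
  define S where "S = {j. coord j y \<noteq> 0}"
  define X where "X i a = ln (s (r i) a)" for i a
  have ratio: "exp (\<Sum>a\<in>UNIV. X i a * of_int (wt j a - wt p a)) * norm (coord j (\<rho> (adj (V (r i))) *v u)) / norm w
      \<le> norm (\<rho> (L (r i)) *v u) / norm (\<rho> (L (r i)) *v w)"
    if pi: "coord p (\<rho> (adj (V (r i))) *v w) \<noteq> 0" for i j
  proof -
    define z where "z a = complex_of_real (X i a)" for a
    have Tz: "T z = dg (\<lambda>a. of_real (s (r i) a))" unfolding T_def z_def X_def by (simp add: s exp_of_real)
    have kU: "k (r i) \<in> unitary_group" "k (r i) \<in> GLC" using k by (auto simp: K_cent_iff unitary_GLC)
    have nL: "norm (\<rho> (L (r i)) *v v) = norm (\<rho> (T z) *v (\<rho> (adj (V (r i))) *v v))" for v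
      unfolding Li Tz[symmetric] using kU V G TG
      by (simp add: rho_mult GLC_mult unitary flip: matrix_vector_mul_assoc)
    have nw: "norm (\<rho> (L (r i)) *v w) = exp (\<Sum>a\<in>UNIV. X i a * of_int (wt p a)) * norm w"
      unfolding nL wvec[OF V l pi] using unitary[OF unitary_adj[OF V]]
      by (simp add: z_def)
    have "exp (\<Sum>a\<in>UNIV. X i a * of_int (wt j a)) * norm (coord j (\<rho> (adj (V (r i))) *v u))
      = norm (coord j (\<rho> (T z) *v (\<rho> (adj (V (r i))) *v u)))"
      unfolding T_def coord_rho_dg by (simp add: norm_mult z_def)
    also have "\<dots> \<le> norm (\<rho> (L (r i)) *v u)" unfolding nL by (rule component_coord)
    finally have "exp (\<Sum>a\<in>UNIV. X i a * of_int (wt j a)) * norm (coord j (\<rho> (adj (V (r i))) *v u)) / norm (\<rho> (L (r i)) *v w)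
      \<le> norm (\<rho> (L (r i)) *v u) / norm (\<rho> (L (r i)) *v w)" by (rule divide_right_mono) simp
    note h1 = this
    have h2: "exp (\<Sum>a\<in>UNIV. X i a * of_int (wt j a - wt p a)) =
       exp (\<Sum>a\<in>UNIV. X i a * of_int (wt j a)) / exp (\<Sum>a\<in>UNIV. X i a * of_int (wt p a))"
      by (simp add: exp_diff[symmetric] algebra_simps sum_subtractf)
    show ?thesis using h1 unfolding h2 nw by (simp only: times_divide_eq_left divide_divide_eq_left)
  qed
  have "\<forall>\<^sub>F i in sequentially. (\<Sum>a\<in>UNIV. X i a * of_int (wt j a - wt p a)) < 0" if j: "j \<in> S" for j
  proof -
    have j0: "norm (coord j y) > 0" using j by (simp add: S_def)
    have "(\<lambda>i. norm (\<rho> (L (r i)) *v u) / norm (\<rho> (L (r i)) *v w)) \<longlonglongrightarrow> 0"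
      using LIMSEQ_subseq_LIMSEQ[OF lim r] by (simp add: o_def)
    then have e1: "\<forall>\<^sub>F i in sequentially. norm (\<rho> (L (r i)) *v u) / norm (\<rho> (L (r i)) *v w) < norm (coord j y) / 2 / norm w"
      by (rule order_tendstoD) (use j0 w in simp)
    have "(\<lambda>i. norm (coord j (\<rho> (adj (V (r i))) *v u))) \<longlonglongrightarrow> norm (coord j y)" by (intro tendsto_intros ylim)
    then have e2: "\<forall>\<^sub>F i in sequentially. norm (coord j (\<rho> (adj (V (r i))) *v u)) > norm (coord j y) / 2"
      by (rule order_tendstoD) (use j0 in simp)
    show ?thesis using e1 e2 evp
    proof eventually_elim
      case (elim i)
      define q where "q = exp (\<Sum>a\<in>UNIV. X i a * of_int (wt j a - wt p a))"
      define C where "C = norm (coord j (\<rho> (adj (V (r i))) *v u))"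
      have "q * C / norm w < norm (coord j y) / 2 / norm w"
        using ratio[OF elim(3), of j] elim(1) by (simp add: q_def C_def)
      moreover have "norm w > 0" using w by simp
      ultimately have "q * C < norm (coord j y) / 2" by (metis divide_less_cancel less_asym)
      then have "q * C < 1 * C" using elim(2) by (simp add: C_def)
      moreover have "C > 0" using elim(2) j0 unfolding C_def by linarith
      ultimately have "q < 1" by (simp only: mult_less_cancel_right_pos)
      then show ?case by (simp add: q_def)
    qed
  qed
  then have "\<forall>\<^sub>F i in sequentially. \<forall>j\<in>S. (\<Sum>a\<in>UNIV. X i a * of_int (wt j a - wt p a)) < 0"
    by (intro eventually_ball_finite) auto
  then obtain i where i: "\<And>j. j \<in> S \<Longrightarrow> (\<Sum>a\<in>UNIV. X i a * of_int (wt j a - wt p a)) < 0"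
    using eventually_happens'[OF sequentially_bot] by blast
  have "\<exists>n :: 'n \<Rightarrow> int. \<forall>d\<in>(\<lambda>j a. wt j a - wt p a) ` S. (\<Sum>a\<in>UNIV. n a * d a) > 0"
    by (rule integral_halfspace[of _ "X i"]) (use i in auto)
  then obtain n :: "'n \<Rightarrow> int" where n: "\<And>j. j \<in> S \<Longrightarrow> (\<Sum>a\<in>UNIV. n a * (wt j a - wt p a)) > 0" by auto
  define \<phi> where "\<phi> t = V0 ** dg (\<lambda>a. t powi n a) ** adj V0" for t
  have alg: "algebraic_1ps \<phi> (G_cent \<Lambda>)" unfolding \<phi>_def by (rule algebraic_1ps_conj_dg[OF V0 \<Lambda>0])
  define e where "e j = (\<Sum>a\<in>UNIV. n a * wt j a)" for j
  have Tt: "dg (\<lambda>a. t powi n a) = T (\<lambda>a. of_int (n a) * Ln t)" if "t \<noteq> 0" for t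
    unfolding T_def using that by (simp add: exp_power_int[symmetric])
  have ex: "exp (\<Sum>a\<in>UNIV. of_int (n a) * Ln t * of_int (wt j a)) = t powi e j" if "t \<noteq> 0" for t j
  proof -
    have "(\<Sum>a\<in>UNIV. of_int (n a) * Ln t * of_int (wt j a)) = of_int (e j) * Ln t"
      by (simp add: e_def sum_distrib_left mult_ac)
    then show ?thesis using that by (simp add: exp_power_int[symmetric])
  qed
  define f where "f t = (1 / t powi e p) *s (\<rho> (dg (\<lambda>a. t powi n a)) *v y)" for t
  have flim: "(f \<longlongrightarrow> 0) (at 0)"
  proof (rule tendsto_coordI)
    fix j
    have fj: "coord j (f t) = t powi (e j - e p) * coord j y" if "t \<noteq> 0" for t
      using that by (simp add: f_def Tt T_def coord_rho_dg ex power_int_diff)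
    have "((\<lambda>t. t powi (e j - e p) * coord j y) \<longlongrightarrow> 0) (at 0)"
    proof (cases "j \<in> S")
      case True
      have "e j - e p > 0" using n[OF True] by (simp add: e_def algebra_simps sum_subtractf)
      from tendsto_mult[OF tendsto_powi_0[OF this] tendsto_const] show ?thesis by simp
    qed (simp add: S_def)
    moreover have "\<forall>\<^sub>F t in at 0. coord j (f t) = t powi (e j - e p) * coord j y"
      using eventually_neq_at_within[of 0] by eventually_elim (rule fj)
    ultimately show "((\<lambda>t. coord j (f t)) \<longlongrightarrow> coord j 0) (at 0)" by (simp add: tendsto_cong)
  qed
  have \<phi>v: "(1 / t powi e p) *s (\<rho> (\<phi> t) *v (a *s w + u)) = a *s w + \<rho> V0 *v f t" if t: "t \<noteq> 0" for t
  proof -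
    have rv: "\<rho> (\<phi> t) *v v = \<rho> V0 *v (\<rho> (dg (\<lambda>a. t powi n a)) *v (\<rho> (adj V0) *v v))" for v
      unfolding \<phi>_def Tt[OF t] using G TG by (simp add: rho_mult GLC_mult flip: matrix_vector_mul_assoc)
    have "\<rho> (\<phi> t) *v w = t powi e p *s w"
      unfolding rv Tt[OF t] wvec[OF V0 \<Lambda>0 p[unfolded x_def]] ex[OF t] by (simp add: smult_mv rhoVV[OF V0])
    moreover have "(1 / t powi e p) *s (\<rho> (\<phi> t) *v u) = \<rho> V0 *v f t"
      unfolding rv by (simp add: f_def y_def smult_mv)
    ultimately show ?thesis using t
      by (simp add: matrix_vector_right_distrib smult_mv vector_add_ldistrib mult.commute)
  qed
  have "((\<lambda>t. a *s w + \<rho> V0 *v f t) \<longlongrightarrow> a *s w + \<rho> V0 *v 0) (at 0)" by (intro tendsto_intros flim)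
  then have "limitin proj_top (\<lambda>t. vec.span {a *s w + \<rho> V0 *v f t}) (vec.span {a *s w}) (at 0)"
    by (intro limitin_span_tendsto) (use a w in \<open>simp_all add: vector_mul_eq_0\<close>)
  moreover have "\<forall>\<^sub>F t in at 0. vec.span {a *s w + \<rho> V0 *v f t} = act (\<rho> (\<phi> t)) (vec.span {a *s w + u})"
    using eventually_neq_at_within[of 0]
  proof eventually_elim
    case (elim t)
    then show ?case unfolding \<phi>v[OF elim, symmetric] act_span by (intro span_eqI) simp
  qed
  ultimately have "limitin proj_top (\<lambda>t. act (\<rho> (\<phi> t)) (vec.span {a *s w + u})) (vec.span {a *s w}) (at 0)"
    by (rule limitin_transform_eventually[rotated])
  then show ?thesis using alg span_eqI[OF a, of w] by auto
qed

end

section \<open>Products of matrices converging to a positive diagonal matrix\<close>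

definition restr :: "'n set \<Rightarrow> complex^'n \<Rightarrow> complex^'n" where
  "restr A z = (\<chi> a. if a \<in> A then z $ a else 0)"

lemma restr_nth [simp]: "restr A z $ a = (if a \<in> A then z $ a else 0)"
  by (simp add: restr_def)

lemma restr_add: "restr A (u + v) = restr A u + restr A v"
  by (simp add: vec_eq_iff)

lemma restr_0 [simp]: "restr A 0 = 0"
  by (simp add: vec_eq_iff)

lemma norm_mono_componentwise:
  assumes "\<And>a. norm (u $ a) \<le> norm (v $ a)"
  shows "norm (u :: complex^'n) \<le> norm (v :: complex^'n)"
  unfolding norm_vec_def by (intro L2_set_mono assms) auto

lemma norm_axis_one: "norm (axis b 1 :: complex^'n) = 1"
proof -
  have "(norm (axis b 1 :: complex^'n))\<^sup>2 = (\<Sum>i\<in>UNIV. if i = b then 1 else 0)"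
    unfolding norm_vec_sq by (rule sum.cong) (auto simp: axis_def)
  then have "(norm (axis b 1 :: complex^'n))\<^sup>2 = 1\<^sup>2" by simp
  then show ?thesis by (simp only: power2_eq_iff_nonneg norm_ge_zero zero_le_one)
qed

lemma norm_restr_mono: "A \<subseteq> B \<Longrightarrow> norm (restr A z) \<le> norm (restr B z)"
  by (rule norm_mono_componentwise) auto

lemma norm_restr_le: "norm (restr A z) \<le> norm z"
  by (rule norm_mono_componentwise) simp

lemma norm_restr_Un: "norm (restr (A \<union> B) z) \<le> norm (restr A z) + norm (restr B z)"
proof -
  have "restr (A \<union> B) z = restr A z + restr (B - A) z" by (auto simp: vec_eq_iff)
  then have "norm (restr (A \<union> B) z) \<le> norm (restr A z) + norm (restr (B - A) z)"
    by (simp add: norm_triangle_ineq)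
  also have "norm (restr (B - A) z) \<le> norm (restr B z)" by (rule norm_restr_mono) auto
  finally show ?thesis by simp
qed

lemma norm_le_restr: "norm z \<le> norm (restr A z) + norm (restr (- A) z)"
proof -
  have "restr (A \<union> - A) z = z" by (simp add: vec_eq_iff)
  then show ?thesis using norm_restr_Un[of A "- A" z] by simp
qed

lemma norm_restr_dg_le:
  assumes "\<And>a. a \<in> A \<Longrightarrow> norm (d a) \<le> \<beta>" "\<beta> \<ge> 0"
  shows "norm (restr A (dg d *v z)) \<le> \<beta> * norm (restr A z)"
proof -
  have "norm (restr A (dg d *v z)) \<le> norm (of_real \<beta> *s restr A z)"
    by (rule norm_mono_componentwise) (use assms in \<open>auto simp: norm_mult mult_right_mono\<close>)
  then show ?thesis using assms(2) by simp
qed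

lemma norm_restr_dg_ge:
  assumes "\<And>a. a \<in> A \<Longrightarrow> norm (d a) \<ge> \<alpha>" "\<alpha> \<ge> 0"
  shows "\<alpha> * norm (restr A z) \<le> norm (restr A (dg d *v z))"
proof -
  have "norm (of_real \<alpha> *s restr A z) \<le> norm (restr A (dg d *v z))"
    by (rule norm_mono_componentwise) (use assms in \<open>auto simp: norm_mult mult_right_mono\<close>)
  then show ?thesis using assms(2) by simp
qed

text \<open>Here \<open>x\<close> and \<open>y\<close> are the sizes of the components of a vector in a subspace expanded by at least \<open>\<alpha>\<close> and in a
  complement expanded by at most \<open>\<beta>\<close>; the primed numbers are the sizes after a step with error \<open>\<delta>\<close>.
  Without error the slope \<open>\<kappa>\<close> would be multiplied by \<open>\<beta>/\<alpha>\<close>; the mean of \<open>1\<close> and \<open>\<beta>/\<alpha>\<close> leaves room for the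
  error.\<close>

lemma cone_contraction:
  fixes \<alpha> \<beta> \<kappa> \<delta> x y x' y' :: real
  assumes ab: "0 < \<beta>" "\<beta> < \<alpha>" and \<kappa>: "0 < \<kappa>"
    and \<delta>: "0 \<le> \<delta>" "4 * \<delta> * (1 + \<kappa>)\<^sup>2 \<le> \<kappa> * (\<alpha> - \<beta>)"
    and x': "x' \<ge> \<alpha> * x - \<delta> * (x + y)" and y': "y' \<le> \<beta> * y + \<delta> * (x + y)"
    and cone: "0 \<le> y" "y < \<kappa> * x"
  shows "y' < (\<alpha> + \<beta>) / (2 * \<alpha>) * \<kappa> * x'"
proof -
  define q where "q = (\<alpha> + \<beta>) / (2 * \<alpha>)"
  have q: "0 < q" "q < 1" "q * \<alpha> = (\<alpha> + \<beta>) / 2" using ab by (simp_all add: q_def)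
  have x: "x > 0" using cone \<kappa> by (metis le_less_trans zero_less_mult_pos)
  have d: "\<delta> * (x + y) \<le> \<delta> * ((1 + \<kappa>) * x)"
    using cone \<delta>(1) by (intro mult_left_mono) (simp_all add: algebra_simps)
  have "q * \<kappa> * (\<alpha> * x - \<delta> * ((1 + \<kappa>) * x)) \<le> q * \<kappa> * x'"
    using x' d q \<kappa> by (intro mult_left_mono) auto
  moreover have "y' < \<beta> * \<kappa> * x + \<delta> * ((1 + \<kappa>) * x)"
  proof -
    have "\<beta> * y < \<beta> * (\<kappa> * x)" using cone ab by simp
    then show ?thesis using y' d by (simp add: mult.assoc)
  qed
  moreover have "\<beta> * \<kappa> * x + \<delta> * ((1 + \<kappa>) * x) \<le> q * \<kappa> * (\<alpha> * x - \<delta> * ((1 + \<kappa>) * x))"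
  proof -
    have "q * \<kappa> \<le> \<kappa>" using q \<kappa> by simp
    then have "\<delta> * (1 + \<kappa>) * (1 + q * \<kappa>) \<le> \<delta> * (1 + \<kappa>) * (1 + \<kappa>)"
      using \<delta> \<kappa> by (intro mult_left_mono) auto
    also have "\<dots> \<le> \<kappa> * (\<alpha> - \<beta>) / 4" using \<delta>(2) by (simp add: power2_eq_square)
    also have "\<dots> \<le> \<kappa> * (\<alpha> - \<beta>) / 2" using ab \<kappa> by simp
    also have "\<dots> = \<kappa> * (q * \<alpha>) - \<beta> * \<kappa>" unfolding q(3) by (simp add: field_simps)
    finally have "\<beta> * \<kappa> + \<delta> * (1 + \<kappa>) \<le> q * \<kappa> * (\<alpha> - \<delta> * (1 + \<kappa>))" by (simp add: algebra_simps)
    then have "(\<beta> * \<kappa> + \<delta> * (1 + \<kappa>)) * x \<le> q * \<kappa> * (\<alpha> - \<delta> * (1 + \<kappa>)) * x"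
      using x by (intro mult_right_mono) auto
    then show ?thesis by (simp add: algebra_simps)
  qed
  ultimately show ?thesis unfolding q_def by linarith
qed

lemma finite_gap_below:
  fixes l :: "'n::finite \<Rightarrow> real"
  obtains \<beta> where "\<beta> < c" "\<And>a. l a < c \<Longrightarrow> l a \<le> \<beta>"
proof
  define S where "S = insert (c - 1) (l ` {a. l a < c})"
  have S: "finite S" "S \<noteq> {}" by (auto simp: S_def)
  show "Max S < c" unfolding Max_less_iff[OF S] by (auto simp: S_def)
  show "l a \<le> Max S" if "l a < c" for a by (rule Max_ge[OF S(1)]) (use that in \<open>auto simp: S_def\<close>)
qed

lemma finite_gap_above:
  fixes l :: "'n::finite \<Rightarrow> real"
  obtains \<alpha> where "c < \<alpha>" "\<And>a. c < l a \<Longrightarrow> \<alpha> \<le> l a"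
proof -
  obtain \<beta> where b: "\<beta> < - c" "\<And>a. - l a < - c \<Longrightarrow> - l a \<le> \<beta>"
    using finite_gap_below[of "- c" "\<lambda>a. - l a"] by blast
  show thesis
  proof
    show "c < - \<beta>" using b(1) by linarith
    show "- \<beta> \<le> l a" if "c < l a" for a using b(2)[of a] that by linarith
  qed
qed

lemma tendsto_average:
  fixes a :: "nat \<Rightarrow> real"
  assumes "(\<lambda>i. a (Suc i) - a i) \<longlonglongrightarrow> c"
  shows "(\<lambda>i. a i / real i) \<longlonglongrightarrow> c"
proof (rule LIMSEQ_I)
  fix e :: real assume e: "e > 0"
  obtain N where N: "\<And>i. i \<ge> N \<Longrightarrow> norm (a (Suc i) - a i - c) < e / 2"
    using LIMSEQ_D[OF assms, of "e / 2"] e by auto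
  have B: "\<bar>a (N + k) - a N - real k * c\<bar> \<le> real k * (e / 2)" for k
  proof (induction k)
    case (Suc k)
    have "\<bar>a (Suc (N + k)) - a (N + k) - c\<bar> \<le> e / 2" using N[of "N + k"] by simp
    moreover have "a (N + Suc k) - a N - real (Suc k) * c = (a (Suc (N + k)) - a (N + k) - c) + (a (N + k) - a N - real k * c)"
      by (simp add: algebra_simps)
    moreover have "real (Suc k) * (e / 2) = e / 2 + real k * (e / 2)" by (simp add: algebra_simps)
    ultimately show ?case using Suc by linarith
  qed simp
  define C where "C = \<bar>a N\<bar> + real N * \<bar>c\<bar>"
  obtain M :: nat where M: "real M > 2 * C / e" using reals_Archimedean2 by blast
  show "\<exists>no. \<forall>i\<ge>no. norm (a i / real i - c) < e"
  proof (intro exI allI impI)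
    fix i assume i: "i \<ge> max (Suc N) (Suc M)"
    then have "N \<le> i" by simp
    then obtain k where k: "i = N + k" using le_iff_add by blast
    have ip: "real i > 0" using i by simp
    have "real N * c \<le> real N * \<bar>c\<bar>" "real N * (- c) \<le> real N * \<bar>c\<bar>"
      by (intro mult_left_mono; simp)+
    moreover have "real N * (- c) = - (real N * c)" by simp
    moreover have "real i * c = real N * c + real k * c" by (simp add: k algebra_simps)
    ultimately have "\<bar>a i - real i * c\<bar> \<le> real k * (e / 2) + C"
      using B[of k] unfolding C_def k by linarith
    also have "\<dots> \<le> real i * (e / 2) + C" using e k by simp
    also have "\<dots> < real i * e"
    proof -
      have "C < real M * (e / 2)" using M e by (simp add: field_simps)
      also have "\<dots> \<le> real i * (e / 2)" using e i by (intro mult_right_mono) auto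
      finally have "C < real i * (e / 2)" .
      moreover have "real i * e = real i * (e / 2) + real i * (e / 2)" by (simp add: field_simps)
      ultimately show ?thesis by linarith
    qed
    finally have "\<bar>a i - real i * c\<bar> < real i * e" .
    then have "\<bar>a i - real i * c\<bar> / real i < e" using ip by (simp add: divide_less_eq mult.commute)
    moreover have "\<bar>a i - real i * c\<bar> / real i = \<bar>a i / real i - c\<bar>"
    proof -
      have "a i / real i - c = (a i - real i * c) / real i" using ip by (simp add: field_simps)
      then show ?thesis using ip by simp
    qed
    ultimately show "norm (a i / real i - c) < e" by simp
  qed
qed

context
  fixes F :: "nat \<Rightarrow> complex^'n^'n" and l :: "'n \<Rightarrow> real"
  assumes F: "F \<longlonglongrightarrow> dg (\<lambda>a. of_real (exp (l a)))"
begin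

text \<open>The limit of \<open>F\<close> expands the coordinates in \<open>A\<close> more than the others, so \<open>F i\<close> contracts cones around
  them by a fixed factor, for all \<open>i\<close> beyond a bound that depends on the slope.\<close>

lemma cone_invariant:
  assumes gap: "\<forall>a\<in>A. \<alpha> \<le> l a" "\<forall>a\<in>- A. l a \<le> \<beta>" "\<beta> < \<alpha>"
  shows "\<exists>q. 0 < q \<and> q < 1 \<and> (\<forall>\<kappa>>0. \<exists>I. \<forall>i\<ge>I. \<forall>z. norm (restr (- A) z) < \<kappa> * norm (restr A z) \<longrightarrow>
    norm (restr (- A) (F i *v z)) < q * \<kappa> * norm (restr A (F i *v z)))"
proof -
  define d where "d = (\<lambda>a. complex_of_real (exp (l a)))"
  obtain K where K: "K > 0" "\<And>(M :: complex^'n^'n) (v :: complex^'n). norm (M *v v) \<le> norm M * norm v * K"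
    using bounded_bilinear.pos_bounded[OF bounded_bilinear_mv[where 'n='n and 'm='n]] by auto
  define q where "q = (exp \<alpha> + exp \<beta>) / (2 * exp \<alpha>)"
  have q: "0 < q" "q < 1" using gap(3) by (auto simp: q_def add_pos_pos)
  have "\<exists>I. \<forall>i\<ge>I. \<forall>z. norm (restr (- A) z) < \<kappa> * norm (restr A z) \<longrightarrow>
    norm (restr (- A) (F i *v z)) < q * \<kappa> * norm (restr A (F i *v z))" if \<kappa>: "\<kappa> > 0" for \<kappa>
  proof -
    have "(\<lambda>i. 4 * (norm (F i - dg d) * K) * (1 + \<kappa>)\<^sup>2) \<longlonglongrightarrow> 4 * (norm (dg d - dg d) * K) * (1 + \<kappa>)\<^sup>2"
      using F unfolding d_def by (intro tendsto_intros)
    then have lim: "(\<lambda>i. 4 * (norm (F i - dg d) * K) * (1 + \<kappa>)\<^sup>2) \<longlonglongrightarrow> 0" by simp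
    have "\<kappa> * (exp \<alpha> - exp \<beta>) > 0" using \<kappa> gap(3) by simp
    from order_tendstoD(2)[OF lim this] obtain I where
      I: "\<And>i. i \<ge> I \<Longrightarrow> 4 * (norm (F i - dg d) * K) * (1 + \<kappa>)\<^sup>2 < \<kappa> * (exp \<alpha> - exp \<beta>)"
      by (auto simp: eventually_sequentially)
    have "norm (restr (- A) (F i *v z)) < q * \<kappa> * norm (restr A (F i *v z))"
      if i: "i \<ge> I" and z: "norm (restr (- A) z) < \<kappa> * norm (restr A z)" for i z
      unfolding q_def
    proof (rule cone_contraction)
      define \<delta> where "\<delta> = norm (F i - dg d) * K"
      have Fz: "F i *v z = dg d *v z + (F i - dg d) *v z" by (simp add: matrix_vector_mult_diff_rdistrib)
      have "norm ((F i - dg d) *v z) \<le> norm (F i - dg d) * norm z * K" by (rule K)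
      also have "\<dots> = \<delta> * norm z" by (simp add: \<delta>_def)
      also have "\<dots> \<le> \<delta> * (norm (restr A z) + norm (restr (- A) z))"
        using K(1) by (intro mult_left_mono norm_le_restr) (simp add: \<delta>_def)
      finally have err: "norm (restr B ((F i - dg d) *v z)) \<le> \<delta> * (norm (restr A z) + norm (restr (- A) z))" for B
        by (rule order_trans[OF norm_restr_le])
      have "norm (restr A (dg d *v z)) \<le> norm (restr A (F i *v z)) + norm (restr A ((F i - dg d) *v z))"
        using norm_triangle_ineq4[of "restr A (F i *v z)" "restr A ((F i - dg d) *v z)"]
        by (simp add: Fz restr_add)
      moreover have "exp \<alpha> * norm (restr A z) \<le> norm (restr A (dg d *v z))"
        by (rule norm_restr_dg_ge) (use gap(1) in \<open>auto simp: d_def\<close>)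
      ultimately show "norm (restr A (F i *v z)) \<ge> exp \<alpha> * norm (restr A z) -
          (norm (F i - dg d) * K) * (norm (restr A z) + norm (restr (- A) z))"
        using err[of A] unfolding \<delta>_def by linarith
      have "norm (restr (- A) (F i *v z)) \<le> norm (restr (- A) (dg d *v z)) + norm (restr (- A) ((F i - dg d) *v z))"
        unfolding Fz restr_add by (rule norm_triangle_ineq)
      moreover have "norm (restr (- A) (dg d *v z)) \<le> exp \<beta> * norm (restr (- A) z)"
        by (rule norm_restr_dg_le) (use gap(2) in \<open>auto simp: d_def\<close>)
      ultimately show "norm (restr (- A) (F i *v z)) \<le> exp \<beta> * norm (restr (- A) z) +
          (norm (F i - dg d) * K) * (norm (restr A z) + norm (restr (- A) z))"
        using err[of "- A"] unfolding \<delta>_def by linarith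
    qed (use gap(3) \<kappa> K(1) I[OF i] z in \<open>auto simp: less_imp_le\<close>)
    then show ?thesis by blast
  qed
  with q show ?thesis by blast
qed

text \<open>An orbit that enters a cone is drawn into all narrower ones. That \<open>I\<close> does not depend on the orbit is
  what makes \<open>uniform_alignment\<close> possible.\<close>

lemma cone_dichotomy:
  assumes gap: "\<forall>a\<in>A. \<alpha> \<le> l a" "\<forall>a\<in>- A. l a \<le> \<beta>" "\<beta> < \<alpha>"
  obtains I :: "real \<Rightarrow> nat" where
    "\<forall>\<kappa>>0. \<forall>i\<ge>I \<kappa>. \<forall>z. norm (restr (- A) z) < \<kappa> * norm (restr A z) \<longrightarrow>
      norm (restr (- A) (F i *v z)) < \<kappa> * norm (restr A (F i *v z))"
    "\<forall>z. (\<forall>i. z (Suc i) = F i *v z i) \<longrightarrow>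
      (\<forall>\<kappa>>0. \<forall>\<^sub>F i in sequentially. norm (restr (- A) (z i)) < \<kappa> * norm (restr A (z i))) \<or>
      (\<forall>\<kappa>>0. \<forall>i\<ge>I \<kappa>. \<not> norm (restr (- A) (z i)) < \<kappa> * norm (restr A (z i)))"
proof -
  obtain q where q: "0 < q" "q < 1" and "\<forall>\<kappa>>0. \<exists>I. \<forall>i\<ge>I. \<forall>z. norm (restr (- A) z) < \<kappa> * norm (restr A z) \<longrightarrow>
    norm (restr (- A) (F i *v z)) < q * \<kappa> * norm (restr A (F i *v z))"
    using cone_invariant[OF gap] by blast
  then obtain I where I: "\<And>\<kappa> i z. \<kappa> > 0 \<Longrightarrow> i \<ge> I \<kappa> \<Longrightarrow> norm (restr (- A) z) < \<kappa> * norm (restr A z) \<Longrightarrow>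
    norm (restr (- A) (F i *v z)) < q * \<kappa> * norm (restr A (F i *v z))" by metis
  have I1: "norm (restr (- A) (F i *v z)) < \<kappa> * norm (restr A (F i *v z))"
    if "\<kappa> > 0" "i \<ge> I \<kappa>" "norm (restr (- A) z) < \<kappa> * norm (restr A z)" for \<kappa> i z
  proof -
    have "q * \<kappa> * norm (restr A (F i *v z)) \<le> \<kappa> * norm (restr A (F i *v z))"
      using q that(1) by (intro mult_right_mono) auto
    then show ?thesis using I[OF that] by linarith
  qed
  have "(\<forall>\<kappa>'>0. \<forall>\<^sub>F i in sequentially. norm (restr (- A) (z i)) < \<kappa>' * norm (restr A (z i)))"
    if z: "\<And>i. z (Suc i) = F i *v z i" and \<kappa>: "\<kappa> > 0" and i1: "i1 \<ge> I \<kappa>"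
      and c: "norm (restr (- A) (z i1)) < \<kappa> * norm (restr A (z i1))" for z \<kappa> i1
  proof -
    have "norm (restr (- A) (z i)) < \<kappa> * norm (restr A (z i))" if "i \<ge> i1" for i
      using that
    proof (induction i rule: dec_induct)
      case (step i)
      then show ?case unfolding z using i1 by (intro I1[OF \<kappa>]) auto
    qed (rule c)
    then have base: "\<forall>\<^sub>F i in sequentially. norm (restr (- A) (z i)) < q ^ 0 * \<kappa> * norm (restr A (z i))"
      unfolding eventually_sequentially by auto
    have ev: "\<forall>\<^sub>F i in sequentially. norm (restr (- A) (z i)) < q ^ m * \<kappa> * norm (restr A (z i))" for m
    proof (induction m)
      case (Suc m)
      have pos: "q ^ m * \<kappa> > 0" using q \<kappa> by simp
      have "\<forall>\<^sub>F i in sequentially. norm (restr (- A) (z (Suc i))) < q ^ Suc m * \<kappa> * norm (restr A (z (Suc i)))"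
        using Suc eventually_ge_at_top[of "I (q ^ m * \<kappa>)"]
      proof eventually_elim
        case (elim i)
        show ?case unfolding z using I[OF pos elim(2,1)] by (simp add: mult.assoc)
      qed
      then show ?case
        by (rule iffD1[OF eventually_sequentially_Suc[of "\<lambda>i. norm (restr (- A) (z i)) < q ^ Suc m * \<kappa> * norm (restr A (z i))"]])
    qed (rule base)
    show ?thesis
    proof (intro allI impI)
      fix \<kappa>' :: real assume \<kappa>': "\<kappa>' > 0"
      obtain m where "q ^ m < \<kappa>' / \<kappa>" using real_arch_pow_inv[of "\<kappa>' / \<kappa>" q] q \<kappa> \<kappa>' by auto
      then have m: "q ^ m * \<kappa> \<le> \<kappa>'" using \<kappa> by (simp add: field_simps)
      show "\<forall>\<^sub>F i in sequentially. norm (restr (- A) (z i)) < \<kappa>' * norm (restr A (z i))"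
        using ev[of m]
      proof eventually_elim
        case (elim i)
        then show ?case using mult_right_mono[OF m norm_ge_zero[of "restr A (z i)"]] by linarith
      qed
    qed
  qed
  note fast = this
  show thesis
  proof (rule that[of I]; intro allI impI)
    fix z assume z: "\<forall>i. z (Suc i) = F i *v z i"
    show "(\<forall>\<kappa>>0. \<forall>\<^sub>F i in sequentially. norm (restr (- A) (z i)) < \<kappa> * norm (restr A (z i))) \<or>
      (\<forall>\<kappa>>0. \<forall>i\<ge>I \<kappa>. \<not> norm (restr (- A) (z i)) < \<kappa> * norm (restr A (z i)))"
    proof (rule disjCI)
      assume "\<not> (\<forall>\<kappa>>0. \<forall>i\<ge>I \<kappa>. \<not> norm (restr (- A) (z i)) < \<kappa> * norm (restr A (z i)))"
      then obtain \<kappa> i1 where "\<kappa> > 0" "i1 \<ge> I \<kappa>" "norm (restr (- A) (z i1)) < \<kappa> * norm (restr A (z i1))" by blast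
      then show "\<forall>\<kappa>>0. \<forall>\<^sub>F i in sequentially. norm (restr (- A) (z i)) < \<kappa> * norm (restr A (z i))"
        using fast z by blast
    qed
  qed (use I1 in blast)
qed

lemma alignment_arith:
  fixes e lo hi \<kappa> :: real
  assumes "lo \<le> \<kappa> * (e + hi)" "hi \<le> \<kappa> * (e + lo)" "0 < \<kappa>" "\<kappa> \<le> 1 / 2" "0 \<le> lo" "0 \<le> hi"
  shows "lo + hi \<le> 4 * \<kappa> * e"
proof -
  have "lo + hi \<le> \<kappa> * (2 * e) + \<kappa> * (lo + hi)" using assms(1,2) by (simp add: algebra_simps)
  moreover have "\<kappa> * (lo + hi) \<le> 1 / 2 * (lo + hi)" using assms by (intro mult_right_mono) auto
  ultimately show ?thesis by (simp add: algebra_simps)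
qed

text \<open>The two hypotheses bound the components with \<open>l < c\<close> and with \<open>l > c\<close>, each in terms of the other and
  of the component with \<open>l = c\<close>.\<close>

lemma alignment_combine:
  assumes lo: "norm (restr (- {a. c \<le> l a}) v) < \<kappa> * norm (restr {a. c \<le> l a} v)"
    and hi: "\<not> norm (restr (- {a. c < l a}) v) < (1 / \<kappa>) * norm (restr {a. c < l a} v)"
    and \<kappa>: "0 < \<kappa>" "\<kappa> \<le> 1 / 2"
  shows "norm (restr {a. l a \<noteq> c} v) \<le> 4 * \<kappa> * norm (restr {a. l a = c} v)"
proof -
  define e where "e = norm (restr {a. l a = c} v)"
  define h where "h = norm (restr {a. c < l a} v)"
  define o' where "o' = norm (restr {a. l a < c} v)"
  have "{a. c \<le> l a} = {a. l a = c} \<union> {a. c < l a}" "- {a. c \<le> l a} = {a. l a < c}" by auto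
  then have "o' \<le> \<kappa> * norm (restr ({a. l a = c} \<union> {a. c < l a}) v)" using lo by (simp add: o'_def)
  also have "\<dots> \<le> \<kappa> * (e + h)" unfolding e_def h_def using \<kappa> by (intro mult_left_mono norm_restr_Un) auto
  finally have 1: "o' \<le> \<kappa> * (e + h)" .
  have "- {a. c < l a} = {a. l a = c} \<union> {a. l a < c}" by auto
  then have "h \<le> \<kappa> * norm (restr ({a. l a = c} \<union> {a. l a < c}) v)"
    using hi \<kappa> by (simp add: h_def field_simps not_less)
  also have "\<dots> \<le> \<kappa> * (e + o')" unfolding e_def o'_def using \<kappa> by (intro mult_left_mono norm_restr_Un) auto
  finally have 2: "h \<le> \<kappa> * (e + o')" .
  have "{a. l a \<noteq> c} = {a. l a < c} \<union> {a. c < l a}" by auto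
  then have "norm (restr {a. l a \<noteq> c} v) \<le> o' + h" unfolding o'_def h_def by (simp add: norm_restr_Un)
  also have "\<dots> \<le> 4 * \<kappa> * e" by (rule alignment_arith[OF 1 2 \<kappa>]) (simp_all add: o'_def h_def)
  finally show ?thesis unfolding e_def .
qed

text \<open>Let \<open>c\<close> be the largest value such that the orbit enters all cones around the coordinates with \<open>l \<ge> c\<close>.
  By the dichotomy it eventually avoids the cones around those with \<open>l > c\<close>.\<close>

lemma alignment:
  assumes z: "\<forall>i. z (Suc i) = F i *v z i" and nz: "\<And>i. z i \<noteq> 0"
  shows "\<exists>c\<in>range l. \<forall>\<epsilon>>0. \<forall>\<^sub>F i in sequentially. norm (restr {a. l a \<noteq> c} (z i)) \<le> \<epsilon> * norm (restr {a. l a = c} (z i))"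
proof -
  define fast where "fast c \<longleftrightarrow> (\<forall>\<kappa>>0. \<forall>\<^sub>F i in sequentially.
    norm (restr (- {a. c \<le> l a}) (z i)) < \<kappa> * norm (restr {a. c \<le> l a} (z i)))" for c
  define C where "C = {c \<in> range l. fast c}"
  have "fast (Min (range l))"
  proof -
    have U: "{a. Min (range l) \<le> l a} = UNIV" by auto
    have "restr (- UNIV) v = 0" "restr UNIV v = v" for v :: "complex^'n" by (simp_all add: vec_eq_iff)
    then show ?thesis unfolding fast_def U using nz by simp
  qed
  moreover have "Min (range l) \<in> range l" by (rule Min_in) auto
  ultimately have "Min (range l) \<in> C" unfolding C_def by blast
  then have "C \<noteq> {}" by blast
  moreover have "finite C" by (simp add: C_def)
  ultimately have "Max C \<in> C" by (intro Max_in)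
  define c0 where "c0 = Max C"
  have c0: "c0 \<in> range l" "fast c0" using \<open>Max C \<in> C\<close> by (auto simp: c0_def C_def)
  define A where "A = {a. c0 < l a}"
  obtain \<alpha> where \<alpha>: "c0 < \<alpha>" "\<And>a. c0 < l a \<Longrightarrow> \<alpha> \<le> l a" using finite_gap_above[of c0 l] by blast
  have gapA: "\<forall>a\<in>A. \<alpha> \<le> l a" "\<forall>a\<in>- A. l a \<le> c0" using \<alpha>(2) by (auto simp: A_def)
  obtain I where I: "\<forall>z. (\<forall>i. z (Suc i) = F i *v z i) \<longrightarrow>
      (\<forall>\<kappa>>0. \<forall>\<^sub>F i in sequentially. norm (restr (- A) (z i)) < \<kappa> * norm (restr A (z i))) \<or>
      (\<forall>\<kappa>>0. \<forall>i\<ge>I \<kappa>. \<not> norm (restr (- A) (z i)) < \<kappa> * norm (restr A (z i)))"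
    by (rule cone_dichotomy[OF gapA \<alpha>(1)]) (rule that)
  have "\<not> (\<forall>\<kappa>>0. \<forall>\<^sub>F i in sequentially. norm (restr (- A) (z i)) < \<kappa> * norm (restr A (z i)))"
  proof
    assume f: "\<forall>\<kappa>>0. \<forall>\<^sub>F i in sequentially. norm (restr (- A) (z i)) < \<kappa> * norm (restr A (z i))"
    have "A \<noteq> {}"
    proof
      assume "A = {}"
      then have r: "restr A v = 0" for v :: "complex^'n" by (simp add: vec_eq_iff)
      have "\<forall>\<^sub>F i in sequentially. norm (restr (- A) (z i)) < 1 * norm (restr A (z i))" by (rule mp[OF spec[OF f, of 1] zero_less_one])
      then have "\<forall>\<^sub>F i in sequentially. False" by eventually_elim (simp add: r)
      then show False by simp
    qed
    define c' where "c' = Min (l ` A)"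
    have "c' \<in> l ` A" unfolding c'_def using \<open>A \<noteq> {}\<close> by (intro Min_in) auto
    then have gt: "c0 < c'" "c' \<in> range l" by (auto simp: A_def)
    have "A = {a. c' \<le> l a}"
    proof (intro equalityI subsetI)
      fix a assume "a \<in> A"
      then show "a \<in> {a. c' \<le> l a}" unfolding c'_def by auto
    next
      fix a assume "a \<in> {a. c' \<le> l a}"
      then show "a \<in> A" using gt(1) by (simp add: A_def)
    qed
    then have "c' \<in> C" using f gt(2) by (simp add: C_def fast_def)
    then have "c' \<le> c0" unfolding c0_def by (intro Max_ge) (auto simp: C_def)
    then show False using gt(1) by simp
  qed
  then have slow: "\<And>\<kappa> i. \<kappa> > 0 \<Longrightarrow> i \<ge> I \<kappa> \<Longrightarrow> \<not> norm (restr (- A) (z i)) < \<kappa> * norm (restr A (z i))"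
    using I z by blast
  have "\<forall>\<^sub>F i in sequentially. norm (restr {a. l a \<noteq> c0} (z i)) \<le> \<epsilon> * norm (restr {a. l a = c0} (z i))" if \<epsilon>: "\<epsilon> > 0" for \<epsilon>
  proof -
    define \<kappa> where "\<kappa> = min (1 / 2) (\<epsilon> / 4)"
    have \<kappa>: "0 < \<kappa>" "\<kappa> \<le> 1 / 2" "4 * \<kappa> \<le> \<epsilon>" using \<epsilon> by (auto simp: \<kappa>_def)
    have "\<forall>\<^sub>F i in sequentially. norm (restr (- {a. c0 \<le> l a}) (z i)) < \<kappa> * norm (restr {a. c0 \<le> l a} (z i))"
      using c0(2) \<kappa>(1) by (simp add: fast_def)
    then show ?thesis using eventually_ge_at_top[of "I (1 / \<kappa>)"]
    proof eventually_elim
      case (elim i)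
      have "norm (restr {a. l a \<noteq> c0} (z i)) \<le> 4 * \<kappa> * norm (restr {a. l a = c0} (z i))"
        by (rule alignment_combine[OF elim(1) _ \<kappa>(1,2)]) (use slow[of "1 / \<kappa>" i] \<kappa> elim(2) in \<open>simp add: A_def\<close>)
      also have "\<dots> \<le> \<epsilon> * norm (restr {a. l a = c0} (z i))" using \<kappa> by (intro mult_right_mono) auto
      finally show ?case .
    qed
  qed
  then show ?thesis using c0(1) by blast
qed

text \<open>On an aligned orbit \<open>F\<close> acts asymptotically as multiplication by \<open>exp c\<close>, so the quotients of
  consecutive norms tend to \<open>exp c\<close>.\<close>

lemma growth_of_aligned:
  assumes z: "\<forall>i. z (Suc i) = F i *v z i" and nz: "\<And>i. z i \<noteq> 0"
    and al: "\<forall>\<epsilon>>0. \<forall>\<^sub>F i in sequentially. norm (restr {a. l a \<noteq> c} (z i)) \<le> \<epsilon> * norm (restr {a. l a = c} (z i))"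
  shows "(\<lambda>i. ln (norm (z i)) / real i) \<longlonglongrightarrow> c"
proof -
  define d where "d = (\<lambda>a. complex_of_real (exp (l a)))"
  define d' where "d' = (\<lambda>a. d a - of_real (exp c))"
  obtain K where K: "K > 0" "\<And>(M :: complex^'n^'n) (v :: complex^'n). norm (M *v v) \<le> norm M * norm v * K"
    using bounded_bilinear.pos_bounded[OF bounded_bilinear_mv[where 'n='n and 'm='n]] by auto
  define \<eta> where "\<eta> i = norm (restr {a. l a \<noteq> c} (z i)) / norm (z i)" for i
  have \<eta>: "\<eta> \<longlonglongrightarrow> 0"
  proof (rule LIMSEQ_I)
    fix r :: real assume r: "r > 0"
    then have "\<forall>\<^sub>F i in sequentially. norm (restr {a. l a \<noteq> c} (z i)) \<le> r / 2 * norm (restr {a. l a = c} (z i))"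
      using al half_gt_zero by blast
    then have "\<forall>\<^sub>F i in sequentially. norm (\<eta> i - 0) < r"
    proof eventually_elim
      case (elim i)
      also have "r / 2 * norm (restr {a. l a = c} (z i)) \<le> r / 2 * norm (z i)"
        using r by (intro mult_left_mono norm_restr_le) auto
      also have "\<dots> < r * norm (z i)" using r nz[of i] by simp
      finally show ?case using nz[of i] by (simp add: \<eta>_def divide_less_eq)
    qed
    then show "\<exists>no. \<forall>i\<ge>no. norm (\<eta> i - 0) < r" by (simp add: eventually_sequentially)
  qed
  have "(\<lambda>i. norm (F i - dg d) * K + norm (dg d') * \<eta> i * K) \<longlonglongrightarrow> norm (dg d - dg d) * K + norm (dg d') * 0 * K"
    using F unfolding d_def by (intro tendsto_intros \<eta>)
  then have lim: "(\<lambda>i. norm (F i - dg d) * K + norm (dg d') * \<eta> i * K) \<longlonglongrightarrow> 0" by simp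
  have bound: "norm (norm (z (Suc i)) / norm (z i) - exp c) \<le> norm (F i - dg d) * K + norm (dg d') * \<eta> i * K" for i
  proof -
    have zp: "norm (z i) > 0" using nz by simp
    have eq: "z (Suc i) - of_real (exp c) *s z i = (F i - dg d) *v z i + dg d' *v restr {a. l a \<noteq> c} (z i)"
    proof -
      have "dg d *v z i - of_real (exp c) *s z i = dg d' *v restr {a. l a \<noteq> c} (z i)"
        by (auto simp: vec_eq_iff d'_def d_def algebra_simps)
      then show ?thesis using z by (simp add: matrix_vector_mult_diff_rdistrib algebra_simps)
    qed
    have "norm (z (Suc i) - of_real (exp c) *s z i) \<le> norm (F i - dg d) * norm (z i) * K + norm (dg d') * norm (restr {a. l a \<noteq> c} (z i)) * K"
      unfolding eq using norm_triangle_ineq[of "(F i - dg d) *v z i" "dg d' *v restr {a. l a \<noteq> c} (z i)"] K(2)[of "F i - dg d" "z i"]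
        K(2)[of "dg d'" "restr {a. l a \<noteq> c} (z i)"] by linarith
    moreover have "\<bar>norm (z (Suc i)) - exp c * norm (z i)\<bar> \<le> norm (z (Suc i) - of_real (exp c) *s z i)"
      using norm_triangle_ineq3[of "z (Suc i)" "of_real (exp c) *s z i"] by simp
    moreover have "norm (restr {a. l a \<noteq> c} (z i)) = \<eta> i * norm (z i)" using zp by (simp add: \<eta>_def)
    ultimately have "\<bar>norm (z (Suc i)) - exp c * norm (z i)\<bar> \<le> (norm (F i - dg d) * K + norm (dg d') * \<eta> i * K) * norm (z i)"
      by (simp add: algebra_simps)
    moreover have "norm (z (Suc i)) / norm (z i) - exp c = (norm (z (Suc i)) - exp c * norm (z i)) / norm (z i)"
      using zp by (simp add: field_simps)
    ultimately show ?thesis using zp by (simp add: abs_divide divide_le_eq)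
  qed
  have "(\<lambda>i. norm (z (Suc i)) / norm (z i) - exp c) \<longlonglongrightarrow> 0"
    by (rule Lim_null_comparison[OF _ lim]) (use bound in auto)
  then have "(\<lambda>i. norm (z (Suc i)) / norm (z i)) \<longlonglongrightarrow> exp c" by (simp add: LIM_zero_iff)
  then have "(\<lambda>i. ln (norm (z (Suc i)) / norm (z i))) \<longlonglongrightarrow> ln (exp c)" by (intro tendsto_ln) simp_all
  then have "(\<lambda>i. ln (norm (z (Suc i))) - ln (norm (z i))) \<longlonglongrightarrow> c" using nz by (simp add: ln_div)
  then show ?thesis by (rule tendsto_average)
qed

text \<open>The components with \<open>l > c\<close> are controlled uniformly by \<open>cone_dichotomy\<close>. For those with \<open>l < c\<close> this is
  an argument as in Dini's theorem: the unit vectors \<open>x\<close> for which \<open>Q i x\<close> is not yet in the cone form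
  a decreasing sequence of compact sets with empty intersection.\<close>

lemma uniform_alignment:
  assumes Q: "\<And>i. Q (Suc i) = F i ** Q i" "\<And>i. Q i \<in> GLC" and \<epsilon>: "\<epsilon> > 0"
    and al: "\<And>x \<epsilon>. x \<noteq> 0 \<Longrightarrow> restr {a. l a = c} x = x \<Longrightarrow> \<epsilon> > 0 \<Longrightarrow> \<forall>\<^sub>F i in sequentially.
      norm (restr {a. l a \<noteq> c} (Q i *v x)) \<le> \<epsilon> * norm (restr {a. l a = c} (Q i *v x))"
  shows "\<forall>\<^sub>F i in sequentially. \<forall>x. restr {a. l a = c} x = x \<longrightarrow>
      norm (restr {a. l a \<noteq> c} (Q i *v x)) \<le> \<epsilon> * norm (restr {a. l a = c} (Q i *v x))"
proof -
  define \<kappa> where "\<kappa> = min (1 / 2) (\<epsilon> / 4)"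
  have \<kappa>: "0 < \<kappa>" "\<kappa> \<le> 1 / 2" "4 * \<kappa> \<le> \<epsilon>" using \<epsilon> by (auto simp: \<kappa>_def)
  have orbit: "\<forall>i. Q (Suc i) *v x = F i *v (Q i *v x)" for x by (simp add: Q(1) matrix_vector_mul_assoc)
  define A where "A = {a. c < l a}"
  define B where "B = {a. c \<le> l a}"
  obtain \<alpha> where \<alpha>: "c < \<alpha>" "\<And>a. c < l a \<Longrightarrow> \<alpha> \<le> l a" using finite_gap_above[of c l] by blast
  have gapA: "\<forall>a\<in>A. \<alpha> \<le> l a" "\<forall>a\<in>- A. l a \<le> c" using \<alpha>(2) by (auto simp: A_def)
  obtain I where I: "\<forall>z. (\<forall>i. z (Suc i) = F i *v z i) \<longrightarrow>
      (\<forall>\<kappa>>0. \<forall>\<^sub>F i in sequentially. norm (restr (- A) (z i)) < \<kappa> * norm (restr A (z i))) \<or>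
      (\<forall>\<kappa>>0. \<forall>i\<ge>I \<kappa>. \<not> norm (restr (- A) (z i)) < \<kappa> * norm (restr A (z i)))"
    by (rule cone_dichotomy[OF gapA \<alpha>(1)]) (rule that)
  have hi: "\<not> norm (restr (- A) (Q i *v x)) < (1 / \<kappa>) * norm (restr A (Q i *v x))"
    if x: "x \<noteq> 0" "restr {a. l a = c} x = x" and i: "i \<ge> I (1 / \<kappa>)" for x i
  proof -
    have "\<not> (\<forall>\<kappa>>0. \<forall>\<^sub>F i in sequentially. norm (restr (- A) (Q i *v x)) < \<kappa> * norm (restr A (Q i *v x)))"
    proof
      assume f: "\<forall>\<kappa>>0. \<forall>\<^sub>F i in sequentially. norm (restr (- A) (Q i *v x)) < \<kappa> * norm (restr A (Q i *v x))"
      have "\<forall>\<^sub>F i in sequentially. norm (restr (- A) (Q i *v x)) < 1 * norm (restr A (Q i *v x))"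
        by (rule mp[OF spec[OF f, of 1] zero_less_one])
      moreover have "\<forall>\<^sub>F i in sequentially. norm (restr {a. l a \<noteq> c} (Q i *v x)) \<le> 1 / 2 * norm (restr {a. l a = c} (Q i *v x))"
        by (rule al[OF x]) simp
      ultimately have "\<forall>\<^sub>F i in sequentially. False"
      proof eventually_elim
        case (elim i)
        have "norm (restr A (Q i *v x)) \<le> norm (restr {a. l a \<noteq> c} (Q i *v x))"
          by (rule norm_restr_mono) (auto simp: A_def)
        moreover have "norm (restr {a. l a = c} (Q i *v x)) \<le> norm (restr (- A) (Q i *v x))"
          by (rule norm_restr_mono) (auto simp: A_def)
        moreover have "0 \<le> norm (restr (- A) (Q i *v x))" by simp
        ultimately show False using elim by linarith
      qed
      then show False by simp
    qed
    moreover note mp[OF spec[OF I, of "\<lambda>i. Q i *v x"] orbit]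
    ultimately have slow: "\<forall>\<kappa>>0. \<forall>i\<ge>I \<kappa>. \<not> norm (restr (- A) (Q i *v x)) < \<kappa> * norm (restr A (Q i *v x))"
      by (simp only: simp_thms)
    have "\<forall>i\<ge>I (1 / \<kappa>). \<not> norm (restr (- A) (Q i *v x)) < 1 / \<kappa> * norm (restr A (Q i *v x))"
      by (rule mp[OF spec[OF slow, of "1 / \<kappa>"]]) (use \<kappa>(1) in simp)
    then show ?thesis using i by blast
  qed
  obtain \<beta> where \<beta>: "\<beta> < c" "\<And>a. l a < c \<Longrightarrow> l a \<le> \<beta>" using finite_gap_below[of c l] by blast
  have gapB: "\<forall>a\<in>B. c \<le> l a" "\<forall>a\<in>- B. l a \<le> \<beta>" using \<beta>(2) by (auto simp: B_def)
  obtain J where J: "\<forall>\<kappa>>0. \<forall>i\<ge>J \<kappa>. \<forall>z. norm (restr (- B) z) < \<kappa> * norm (restr B z) \<longrightarrow>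
      norm (restr (- B) (F i *v z)) < \<kappa> * norm (restr B (F i *v z))"
    by (rule cone_dichotomy[OF gapB \<beta>(1)]) (rule that)
  define cone where "cone i x \<longleftrightarrow> norm (restr (- B) (Q i *v x)) < \<kappa> * norm (restr B (Q i *v x))" for i x
  have cone_step: "cone (Suc i) x" if "i \<ge> J \<kappa>" "cone i x" for i x
  proof -
    have "norm (restr (- B) (F i *v (Q i *v x))) < \<kappa> * norm (restr B (F i *v (Q i *v x)))"
      using J[rule_format, OF \<kappa>(1) that(1), of "Q i *v x"] that(2) unfolding cone_def .
    then show ?thesis using orbit[of x] by (simp add: cone_def)
  qed
  have mono: "cone k x" if "i \<ge> J \<kappa>" "cone i x" "k \<ge> i" for i k x
    using that(3)
  proof (induction k rule: dec_induct)
    case (step k)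
    show ?case by (rule cone_step) (use step that(1) in auto)
  qed (rule that(2))
  have pt: "\<forall>\<^sub>F i in sequentially. cone i x" if x: "x \<noteq> 0" "restr {a. l a = c} x = x" for x
  proof -
    have "\<forall>\<^sub>F i in sequentially. norm (restr {a. l a \<noteq> c} (Q i *v x)) \<le> \<kappa> / 2 * norm (restr {a. l a = c} (Q i *v x))"
      by (rule al[OF x]) (use \<kappa> in simp)
    then show ?thesis
    proof eventually_elim
      case (elim i)
      have "Q i *v x \<noteq> 0" using GLC_mv_eq_0[OF Q(2)] x(1) by simp
      then have "0 < norm (restr {a. l a = c} (Q i *v x)) + norm (restr (- {a. l a = c}) (Q i *v x))"
        by (meson norm_le_restr less_le_trans zero_less_norm_iff)
      moreover have "- {a. l a = c} = {a. l a \<noteq> c}" by auto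
      ultimately have e: "norm (restr {a. l a = c} (Q i *v x)) > 0"
        using elim \<kappa>(1) by (smt (verit) mult_nonneg_nonneg mult_eq_0_iff norm_ge_zero)
      have "norm (restr (- B) (Q i *v x)) \<le> norm (restr {a. l a \<noteq> c} (Q i *v x))"
        by (rule norm_restr_mono) (auto simp: B_def)
      also have "\<dots> \<le> \<kappa> / 2 * norm (restr {a. l a = c} (Q i *v x))" by (rule elim)
      also have "\<dots> < \<kappa> * norm (restr {a. l a = c} (Q i *v x))" using e \<kappa>(1) by simp
      also have "\<dots> \<le> \<kappa> * norm (restr B (Q i *v x))"
        using \<kappa>(1) by (intro mult_left_mono norm_restr_mono) (auto simp: B_def)
      finally show ?case unfolding cone_def .
    qed
  qed
  define T where "T = {x. norm x = 1 \<and> restr {a. l a = c} x = x}"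
  define G where "G n = T \<inter> {x. \<not> cone (J \<kappa> + n) x}" for n
  have cont: "continuous_on UNIV (\<lambda>x. norm (restr S (M *v x)))" for S and M :: "complex^'n^'n"
  proof -
    have "restr S = (\<lambda>v. dg (\<lambda>a. if a \<in> S then 1 else 0) *v v)" by (auto simp: fun_eq_iff vec_eq_iff)
    then show ?thesis unfolding continuous_on_def by (auto intro!: tendsto_intros)
  qed
  have "compact T"
  proof -
    have "closed {x. restr {a. l a = c} (x :: complex^'n) = x}"
    proof -
      have "restr {a. l a = c} = (\<lambda>v. dg (\<lambda>a. if l a = c then 1 else 0) *v v)" by (auto simp: fun_eq_iff vec_eq_iff)
      then show ?thesis by (auto simp: continuous_on_def intro!: closed_Collect_eq tendsto_intros)
    qed
    moreover have "T = sphere 0 1 \<inter> {x. restr {a. l a = c} x = x}" by (auto simp: T_def)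
    ultimately show ?thesis by (simp add: compact_Int_closed)
  qed
  moreover have "closed {x. \<not> cone i x}" for i
    unfolding cone_def not_less by (rule closed_Collect_le[OF continuous_on_mult_left[OF cont] cont])
  ultimately have Gc: "compact (G n)" for n unfolding G_def by (rule compact_Int_closed)
  have "\<exists>n. G n = {}"
  proof (rule ccontr)
    assume "\<not> (\<exists>n. G n = {})"
    moreover have "G n \<subseteq> G m" if "m \<le> n" for m n
      unfolding G_def using mono[of "J \<kappa> + m" _ "J \<kappa> + n"] that by auto
    ultimately have "\<Inter> (range G) \<noteq> {}" by (intro compact_nest Gc) auto
    then obtain x where x: "\<And>n. x \<in> G n" by auto
    then have "x \<noteq> 0" "restr {a. l a = c} x = x" using x[of 0] by (auto simp: G_def T_def)
    from pt[OF this] obtain N where N: "\<And>i. i \<ge> N \<Longrightarrow> cone i x" by (auto simp: eventually_sequentially)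
    show False using x[of N] N[of "J \<kappa> + N"] by (auto simp: G_def)
  qed
  then obtain n where n: "G n = {}" by blast
  have lo: "cone i x" if x: "x \<noteq> 0" "restr {a. l a = c} x = x" and i: "i \<ge> J \<kappa> + n" for x i
  proof -
    define y where "y = (1 / of_real (norm x)) *s x"
    have sc: "restr S (r *s v) = r *s restr S v" for S r and v :: "complex^'n" by (simp add: vec_eq_iff)
    have "y \<in> T" using x by (simp add: T_def y_def norm_divide sc)
    then have "cone (J \<kappa> + n) y" using n by (auto simp: G_def)
    then have "cone i y" using mono[of "J \<kappa> + n" y i] i by simp
    then show ?thesis using x(1) by (simp add: cone_def y_def smult_mv sc norm_divide divide_less_cancel)
  qed
  show ?thesis
    using eventually_ge_at_top[of "I (1 / \<kappa>)"] eventually_ge_at_top[of "J \<kappa> + n"]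
  proof eventually_elim
    case (elim i)
    show ?case
    proof (intro allI impI)
      fix x assume x: "restr {a. l a = c} x = x"
      show "norm (restr {a. l a \<noteq> c} (Q i *v x)) \<le> \<epsilon> * norm (restr {a. l a = c} (Q i *v x))"
      proof (cases "x = 0")
        case False
        have "norm (restr {a. l a \<noteq> c} (Q i *v x)) \<le> 4 * \<kappa> * norm (restr {a. l a = c} (Q i *v x))"
          by (rule alignment_combine[OF _ _ \<kappa>(1,2)])
            (use lo[OF False x elim(2)] hi[OF False x elim(1)] in \<open>simp_all add: cone_def A_def B_def\<close>)
        also have "\<dots> \<le> \<epsilon> * norm (restr {a. l a = c} (Q i *v x))" using \<kappa> by (intro mult_right_mono) auto
        finally show ?thesis .
      qed simp
    qed
  qed
qed

text \<open>Let \<open>M i\<close> be the block diagonal part of \<open>Q i\<close>. By \<open>uniform_alignment\<close> the remaining blocks are small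
  relative to it: \<open>Q i - M i\<close> is at most \<open>\<epsilon>\<close> times \<open>M i\<close> on every vector, for large \<open>i\<close>. In particular
  \<open>M i\<close> is invertible for large \<open>i\<close>, and \<open>Q i M i\<inverse>\<close> tends to \<open>1\<close>.\<close>

lemma block_diagonal_asymptotics:
  assumes Q: "\<And>i. Q (Suc i) = F i ** Q i" "\<And>i. Q i \<in> GLC"
    and al: "\<And>c x \<epsilon>. x \<noteq> 0 \<Longrightarrow> restr {a. l a = c} x = x \<Longrightarrow> \<epsilon> > 0 \<Longrightarrow> \<forall>\<^sub>F i in sequentially.
      norm (restr {a. l a \<noteq> c} (Q i *v x)) \<le> \<epsilon> * norm (restr {a. l a = c} (Q i *v x))"
  obtains L where "\<And>i. L i \<in> G_cent (dg (\<lambda>a. of_real (l a)))" "(\<lambda>i. Q i ** matrix_inv (L i)) \<longlonglongrightarrow> mat 1"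
proof -
  define M where "M i = (\<chi> a b. if l a = l b then Q i $ a $ b else 0)" for i
  define P where "P c = restr {a. l a = c}" for c
  have Pdg: "P c v = dg (\<lambda>a. if l a = c then 1 else 0) *v v" for c v by (simp add: P_def vec_eq_iff)
  have PP: "P c (P c v) = P c v" for c v by (simp add: P_def vec_eq_iff)
  have PM: "P c (M i *v v) = P c (Q i *v P c v)" for c i v
  proof -
    have "(P c (M i *v v)) $ a = (P c (Q i *v P c v)) $ a" for a
    proof (cases "l a = c")
      case True
      have "(M i *v v) $ a = (\<Sum>b\<in>UNIV. M i $ a $ b * v $ b)" by (simp add: matrix_vector_mult_def)
      also have "\<dots> = (\<Sum>b\<in>UNIV. Q i $ a $ b * P c v $ b)"
        by (rule sum.cong) (use True in \<open>auto simp: M_def P_def\<close>)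
      also have "\<dots> = (Q i *v P c v) $ a" by (simp add: matrix_vector_mult_def)
      finally show ?thesis using True by (simp add: P_def)
    qed (simp add: P_def)
    then show ?thesis by (simp only: vec_eq_iff) blast
  qed
  have decomp: "v = (\<Sum>c\<in>range l. P c v)" for v
  proof -
    have "(\<Sum>c\<in>range l. P c v) $ a = v $ a" for a
    proof -
      have "(\<Sum>c\<in>range l. P c v) $ a = (\<Sum>c\<in>range l. if c = l a then v $ a else 0)"
        unfolding sum_component by (rule sum.cong) (auto simp: P_def)
      then show ?thesis by simp
    qed
    then show ?thesis by (simp only: vec_eq_iff) simp
  qed
  have diff: "Q i *v v - M i *v v = (\<Sum>c\<in>range l. restr {a. l a \<noteq> c} (Q i *v P c v))" for i v
  proof -
    have "Q i *v v = (\<Sum>c\<in>range l. Q i *v P c v)"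
      by (subst decomp) (rule bounded_bilinear.sum_right[OF bounded_bilinear_mv])
    moreover have "M i *v v = (\<Sum>c\<in>range l. P c (Q i *v P c v))"
      by (subst decomp) (simp only: PM)
    ultimately have "Q i *v v - M i *v v = (\<Sum>c\<in>range l. Q i *v P c v - P c (Q i *v P c v))"
      by (simp add: sum_subtractf)
    also have "\<dots> = (\<Sum>c\<in>range l. restr {a. l a \<noteq> c} (Q i *v P c v))"
      by (rule sum.cong) (auto simp: vec_eq_iff P_def)
    finally show ?thesis .
  qed
  have close: "\<forall>\<^sub>F i in sequentially. \<forall>v. norm (Q i *v v - M i *v v) \<le> \<epsilon> * norm (M i *v v)" if \<epsilon>: "\<epsilon> > 0" for \<epsilon>
  proof -
    define \<epsilon>' where "\<epsilon>' = \<epsilon> / real (card (range l))"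
    have card: "real (card (range l)) > 0" by (simp add: card_gt_0_iff)
    have \<epsilon>': "\<epsilon>' > 0" using \<epsilon> card by (simp add: \<epsilon>'_def)
    have "\<forall>\<^sub>F i in sequentially. \<forall>c\<in>range l. \<forall>x. restr {a. l a = c} x = x \<longrightarrow>
      norm (restr {a. l a \<noteq> c} (Q i *v x)) \<le> \<epsilon>' * norm (restr {a. l a = c} (Q i *v x))"
      by (rule eventually_ball_finite) (auto intro!: uniform_alignment[OF Q \<epsilon>'] al)
    then show ?thesis
    proof eventually_elim
      case (elim i)
      show ?case
      proof
        fix v
        have "norm (Q i *v v - M i *v v) \<le> (\<Sum>c\<in>range l. norm (restr {a. l a \<noteq> c} (Q i *v P c v)))"
          unfolding diff by (rule norm_sum)
        also have "\<dots> \<le> (\<Sum>c\<in>range l. \<epsilon>' * norm (M i *v v))"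
        proof (rule sum_mono)
          fix c assume c: "c \<in> range l"
          have "norm (restr {a. l a \<noteq> c} (Q i *v P c v)) \<le> \<epsilon>' * norm (restr {a. l a = c} (Q i *v P c v))"
            using elim c PP[of c v] by (auto simp: P_def)
          also have "restr {a. l a = c} (Q i *v P c v) = P c (M i *v v)" by (simp add: PM) (simp add: P_def)
          also have "norm (P c (M i *v v)) \<le> norm (M i *v v)" unfolding P_def by (rule norm_restr_le)
          finally show "norm (restr {a. l a \<noteq> c} (Q i *v P c v)) \<le> \<epsilon>' * norm (M i *v v)"
            using \<epsilon>' by (simp add: mult_left_mono)
        qed
        also have "\<dots> = \<epsilon> * norm (M i *v v)" using card by (simp add: \<epsilon>'_def)
        finally show "norm (Q i *v v - M i *v v) \<le> \<epsilon> * norm (M i *v v)" .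
      qed
    qed
  qed
  have MG: "M i \<in> G_cent (dg (\<lambda>a. of_real (l a)))" if "M i \<in> GLC" for i
    using that by (auto simp: G_cent_dg M_def)
  have evG: "\<forall>\<^sub>F i in sequentially. M i \<in> GLC"
    using close[OF zero_less_one]
  proof eventually_elim
    case (elim i)
    show ?case unfolding GLC_iff_inj
    proof (intro allI impI)
      fix v assume "M i *v v = 0"
      then have "norm (Q i *v v) \<le> 0" using elim[rule_format, of v] by simp
      then show "v = 0" using GLC_mv_eq_0[OF Q(2)] by simp
    qed
  qed
  \<comment> \<open>the value for small \<open>i\<close> only has to belong to the centraliser\<close>
  define L where "L i = (if M i \<in> GLC then M i else mat 1)" for i
  have L: "L i \<in> G_cent (dg (\<lambda>a. of_real (l a)))" for i using MG by (simp add: L_def)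
  have "(\<lambda>i. (Q i ** matrix_inv (L i)) $ a $ b) \<longlonglongrightarrow> mat 1 $ a $ b" for a b
  proof (rule LIMSEQ_I)
    fix r :: real assume r: "r > 0"
    have "\<forall>\<^sub>F i in sequentially. norm ((Q i ** matrix_inv (L i)) $ a $ b - mat 1 $ a $ b) < r"
      using close[OF half_gt_zero[OF r]] evG
    proof eventually_elim
      case (elim i)
      define v where "v = matrix_inv (M i) *v axis b 1"
      have Mv: "M i *v v = axis b 1" unfolding v_def by (rule GLC_cancel(6)[OF elim(2)])
      have "Q i ** matrix_inv (M i) *v axis b 1 = Q i *v v" by (simp add: v_def matrix_vector_mul_assoc)
      then have "(Q i ** matrix_inv (L i)) $ a $ b - mat 1 $ a $ b = (Q i *v v - M i *v v) $ a"
        using elim(2) mv_axis[of "Q i ** matrix_inv (M i)" b a]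
        by (simp add: L_def Mv mat_nth axis_def)
      also have "norm \<dots> \<le> norm (Q i *v v - M i *v v)" by (rule Finite_Cartesian_Product.norm_nth_le)
      also have "\<dots> \<le> r / 2 * norm (M i *v v)" using elim(1) by blast
      also have "\<dots> < r" using r by (simp add: Mv norm_axis_one)
      finally show ?case .
    qed
    then show "\<exists>no. \<forall>i\<ge>no. norm ((Q i ** matrix_inv (L i)) $ a $ b - mat 1 $ a $ b) < r"
      by (simp add: eventually_sequentially)
  qed
  then have "(\<lambda>i. Q i ** matrix_inv (L i)) \<longlonglongrightarrow> mat 1" by (intro vec_tendstoI)
  with L that show thesis by blast
qed

end

section \<open>The limit line\<close>

text \<open>A step from above \<open>1/2\<close> to below \<open>1/2\<close> can occur only finitely often: along a subsequence of such steps
  \<open>f i\<close> and \<open>f (i + 1)\<close> would have a common limit, which is neither \<open>0\<close> nor \<open>1\<close>. As \<open>f\<close> is close to \<open>1\<close>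
  infinitely often, it stays above \<open>1/2\<close>, and then \<open>0\<close> is not a limit point.\<close>

lemma two_limit_points_no_jump:
  fixes f :: "nat \<Rightarrow> real"
  assumes sub: "\<And>\<beta>. strict_mono (\<beta> :: nat \<Rightarrow> nat) \<Longrightarrow> \<exists>\<gamma> c. strict_mono (\<gamma> :: nat \<Rightarrow> nat) \<and> c \<in> {0, 1} \<and>
      (\<lambda>j. f (\<beta> (\<gamma> j))) \<longlonglongrightarrow> c \<and> (\<lambda>j. f (Suc (\<beta> (\<gamma> j)))) \<longlonglongrightarrow> c"
    and one: "strict_mono (\<alpha> :: nat \<Rightarrow> nat)" "(\<lambda>j. f (\<alpha> j)) \<longlonglongrightarrow> 1"
  shows "f \<longlonglongrightarrow> 1"
proof -
  have inf_sub: "\<exists>\<beta> c. strict_mono (\<beta> :: nat \<Rightarrow> nat) \<and> (\<forall>j. \<beta> j \<in> X) \<and> c \<in> {0, 1} \<and>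
      (\<lambda>j. f (\<beta> j)) \<longlonglongrightarrow> c \<and> (\<lambda>j. f (Suc (\<beta> j))) \<longlonglongrightarrow> c" if X: "infinite X" for X
  proof -
    define \<beta> where "\<beta> = enumerate X"
    have \<beta>: "strict_mono \<beta>" "\<And>j. \<beta> j \<in> X" unfolding \<beta>_def using X by (simp_all add: strict_mono_enumerate enumerate_in_set)
    obtain \<gamma> c where "strict_mono (\<gamma> :: nat \<Rightarrow> nat)" "c \<in> {0, 1}" "(\<lambda>j. f (\<beta> (\<gamma> j))) \<longlonglongrightarrow> c" "(\<lambda>j. f (Suc (\<beta> (\<gamma> j)))) \<longlonglongrightarrow> c"
      using sub[OF \<beta>(1)] by blast
    then show ?thesis using \<beta> by (intro exI[of _ "\<beta> \<circ> \<gamma>"] exI[of _ c]) (auto simp: strict_mono_o)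
  qed
  have no_jump: "finite {i. f i \<ge> 1 / 2 \<and> f (Suc i) < 1 / 2}"
  proof (rule ccontr)
    assume "infinite {i. f i \<ge> 1 / 2 \<and> f (Suc i) < 1 / 2}"
    from inf_sub[OF this] obtain \<beta> c where b: "\<And>j. f (\<beta> j) \<ge> 1 / 2 \<and> f (Suc (\<beta> j)) < 1 / 2" "c \<in> {0, 1}"
      "(\<lambda>j. f (\<beta> j)) \<longlonglongrightarrow> c" "(\<lambda>j. f (Suc (\<beta> j))) \<longlonglongrightarrow> c" by auto
    have "c \<ge> 1 / 2" by (rule LIMSEQ_le_const[OF b(3)]) (use b(1) in auto)
    moreover have "c \<le> 1 / 2" by (rule LIMSEQ_le_const2[OF b(4)]) (use b(1) less_imp_le in blast)
    ultimately show False using b(2) by auto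
  qed
  then obtain N where N: "\<And>i. i \<ge> N \<Longrightarrow> f i \<ge> 1 / 2 \<Longrightarrow> f (Suc i) \<ge> 1 / 2"
    unfolding finite_nat_set_iff_bounded by (metis (mono_tags, lifting) mem_Collect_eq not_le)
  have "\<forall>\<^sub>F j in sequentially. f (\<alpha> j) > 1 / 2" by (rule order_tendstoD[OF one(2)]) simp
  then obtain j0 where j0: "\<And>j. j \<ge> j0 \<Longrightarrow> f (\<alpha> j) > 1 / 2" by (auto simp: eventually_sequentially)
  define i0 where "i0 = \<alpha> (max j0 N)"
  have i0: "i0 \<ge> N" "f i0 \<ge> 1 / 2"
    using seq_suble[OF one(1), of "max j0 N"] j0[of "max j0 N"] by (auto simp: i0_def)
  have large: "f i \<ge> 1 / 2" if "i \<ge> i0" for i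
    using that by (induction i rule: dec_induct) (use i0 N in auto)
  show ?thesis
  proof (rule ccontr)
    assume "\<not> f \<longlonglongrightarrow> 1"
    then obtain r where r: "r > 0" "\<And>n. \<exists>i\<ge>n. \<not> dist (f i) 1 < r" unfolding lim_sequentially by blast
    then have "infinite {i. \<not> dist (f i) 1 < r}" unfolding infinite_nat_iff_unbounded_le by auto
    from inf_sub[OF this] obtain \<beta> c where b: "strict_mono (\<beta> :: nat \<Rightarrow> nat)" "\<And>j. \<not> dist (f (\<beta> j)) 1 < r" "c \<in> {0, 1}"
      "(\<lambda>j. f (\<beta> j)) \<longlonglongrightarrow> c" by auto
    have "c \<ge> 1 / 2"
    proof (rule LIMSEQ_le_const[OF b(4)], intro exI allI impI)
      fix j assume "j \<ge> i0"
      then show "1 / 2 \<le> f (\<beta> j)" using seq_suble[OF b(1), of j] by (intro large) simp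
    qed
    then have "c = 1" using b(3) by auto
    then have "\<forall>\<^sub>F j in sequentially. dist (f (\<beta> j)) 1 < r" using tendstoD[OF b(4) r(1)] by simp
    then show False using b(2) by simp
  qed
qed

context unitary_rep
begin

text \<open>Let \<open>w\<close> span a limit line and \<open>\<theta>\<close> be the character of \<open>G\<^sub>\<Lambda>\<close> on it. The components of \<open>D\<Lambda> i vt\<close> along \<open>w\<close>
  and orthogonal to \<open>w\<close> come from those of \<open>vt\<close>, because \<open>G\<^sub>\<Lambda>\<close> is closed under adjoints. If another
  limit line is spanned by \<open>w' = c w + x\<close> with \<open>c \<noteq> 0\<close>, it has the same character \<open>\<theta>\<close>. Then the quotient
  of the products of \<open>D\<Lambda> i vt\<close> with \<open>x\<close> and with \<open>w\<close> does not depend on \<open>i\<close>; along the subsequence for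
  \<open>w\<close> it tends to \<open>0\<close>, so it is \<open>0\<close> and \<open>x = 0\<close>. Thus the cosine accumulates at \<open>0\<close> and \<open>1\<close> only, and
  \<open>two_limit_points_no_jump\<close> applies because the limit \<open>H\<close> of the steps fixes all limit lines.\<close>

lemma unique_limit_line:
  fixes D\<Lambda> :: "nat \<Rightarrow> complex^'n^'n" and vt :: "complex^'m"
  assumes \<Lambda>: "hermitian \<Lambda>" and D: "\<And>i. D\<Lambda> i \<in> G_cent \<Lambda>"
    and step: "(\<lambda>i. D\<Lambda> (Suc i) ** matrix_inv (D\<Lambda> i)) \<longlonglongrightarrow> H" and H: "H \<in> G_cent \<Lambda>"
    and vt: "vt \<noteq> 0"
    and q_eq: "\<And>i. q i = (1 / of_real (norm (\<rho> (D\<Lambda> i) *v vt))) *s (\<rho> (D\<Lambda> i) *v vt)"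
    and fixed: "\<And>\<alpha> w h. strict_mono (\<alpha> :: nat \<Rightarrow> nat) \<Longrightarrow> norm w = 1 \<Longrightarrow> (\<lambda>j. q (\<alpha> j)) \<longlonglongrightarrow> w \<Longrightarrow>
      h \<in> G_cent \<Lambda> \<Longrightarrow> \<exists>c. \<rho> h *v w = c *s w"
  shows "\<exists>w. norm w = 1 \<and> (\<forall>h\<in>G_cent \<Lambda>. \<exists>c. \<rho> h *v w = c *s w) \<and> (\<lambda>i. norm (herm (q i) w)) \<longlonglongrightarrow> 1 \<and>
    (\<exists>\<phi>. algebraic_1ps \<phi> (G_cent \<Lambda>) \<and>
      limitin proj_top (\<lambda>t. act (\<rho> (\<phi> t)) (vec.span {vt})) (vec.span {w}) (at 0))"
proof -
  have DG: "D\<Lambda> i \<in> GLC" for i using D by (simp add: G_cent_iff)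
  define b where "b i = \<rho> (D\<Lambda> i) *v vt" for i
  have b0: "b i \<noteq> 0" for i unfolding b_def by (rule rho_nz[OF DG vt])
  have q: "q i = (1 / of_real (norm (b i))) *s b i" for i by (simp add: q_eq b_def)
  have q1: "norm (q i) = 1" for i using b0[of i] by (simp add: q norm_divide)
  have sphere_sub: "\<exists>\<gamma> w. strict_mono (\<gamma> :: nat \<Rightarrow> nat) \<and> norm w = 1 \<and> (\<lambda>j. q (\<beta> (\<gamma> j))) \<longlonglongrightarrow> w" for \<beta> :: "nat \<Rightarrow> nat"
  proof -
    have "\<forall>j. (q \<circ> \<beta>) j \<in> sphere 0 1" using q1 by simp
    then obtain w \<gamma> where "w \<in> sphere 0 1" "strict_mono (\<gamma> :: nat \<Rightarrow> nat)" "(q \<circ> \<beta> \<circ> \<gamma>) \<longlonglongrightarrow> w"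
      using compact_sphere[of "0::complex^'m" 1] unfolding compact_def by metis
    then show ?thesis by (intro exI[of _ \<gamma>] exI[of _ w]) (simp add: o_def)
  qed
  obtain \<alpha> w where \<alpha>: "strict_mono (\<alpha> :: nat \<Rightarrow> nat)" and w1: "norm w = 1" and \<alpha>w: "(\<lambda>j. q (\<alpha> j)) \<longlonglongrightarrow> w"
    using sphere_sub[of "\<lambda>j. j"] by auto
  have w0: "w \<noteq> 0" using w1 by auto
  have ww: "herm w w = 1" by (simp add: herm_self w1)
  obtain \<theta> where \<theta>: "\<And>h. h \<in> G_cent \<Lambda> \<Longrightarrow> \<rho> h *v w = \<theta> h *s w" using fixed[OF \<alpha> w1 \<alpha>w] by metis
  have \<theta>0: "\<theta> h \<noteq> 0" if "h \<in> G_cent \<Lambda>" for h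
  proof
    assume "\<theta> h = 0"
    then have "\<rho> h *v w = 0" using \<theta>[OF that] by simp
    then show False using rho_nz[OF _ w0, of h] that by (simp add: G_cent_iff)
  qed
  have adjG: "adj h \<in> G_cent \<Lambda>" "h \<in> GLC" if "h \<in> G_cent \<Lambda>" for h
    using that G_cent_adj[OF \<Lambda> that] by (simp_all add: G_cent_iff)
  have move: "herm (\<rho> h *v x) y = herm x (\<rho> (adj h) *v y)" if "h \<in> G_cent \<Lambda>" for h x y
    unfolding rho_adj[OF adjG(2)[OF that]] by (rule herm_adj)
  \<comment> \<open>a line fixed by the group, not orthogonal to \<open>w\<close>, carries the same character\<close>
  have same_char: "\<rho> h *v w' = \<theta> h *s w'"
    if w': "\<And>h. h \<in> G_cent \<Lambda> \<Longrightarrow> \<exists>c. \<rho> h *v w' = c *s w'" "norm w' = 1" and nz: "herm w w' \<noteq> 0" and h: "h \<in> G_cent \<Lambda>" for w' h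
  proof -
    obtain c where c: "\<rho> (adj h) *v w' = c *s w'" using w'(1)[OF adjG(1)[OF h]] by blast
    obtain d where d: "\<rho> h *v w' = d *s w'" using w'(1)[OF h] by blast
    have "herm w' w' \<noteq> 0" using w'(2) by auto
    moreover have "d * herm w' w' = cnj c * herm w' w'" using move[OF h, of w' w'] by (simp add: c d)
    moreover have "\<theta> h * herm w w' = cnj c * herm w w'" using move[OF h, of w w'] by (simp add: c \<theta>[OF h])
    ultimately have "d = \<theta> h" using nz by simp
    then show ?thesis using d by simp
  qed
  have \<theta>adj: "\<theta> h = cnj (\<theta> (adj h))" if h: "h \<in> G_cent \<Lambda>" for h
    using move[OF h, of w w] by (simp add: \<theta>[OF h] \<theta>[OF adjG(1)[OF h]] ww)
  define a where "a = herm vt w"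
  define u where "u = vt - a *s w"
  have vtu: "vt = a *s w + u" by (simp add: u_def)
  have uw: "herm u w = 0" by (simp add: u_def herm_diff ww a_def)
  have bu: "b i = (a * \<theta> (D\<Lambda> i)) *s w + \<rho> (D\<Lambda> i) *v u" for i
    unfolding b_def by (subst vtu) (simp add: matrix_vector_right_distrib smult_mv \<theta>[OF D] mult.commute)
  have Duw: "herm (\<rho> (D\<Lambda> i) *v u) w = 0" for i
    using move[OF D, of i u w] by (simp add: \<theta>[OF adjG(1)[OF D]] uw)
  have qw: "herm (q i) w = a * \<theta> (D\<Lambda> i) / of_real (norm (b i))" for i
    unfolding q bu[of i] by (simp add: herm_add ww Duw del: norm_smult)
  have lim1: "(\<lambda>j. herm (q (\<alpha> j)) w) \<longlonglongrightarrow> 1"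
    using tendsto_herm[OF \<alpha>w tendsto_const[of w]] by (simp add: ww)
  have a0: "a \<noteq> 0"
  proof
    assume "a = 0"
    then show False using lim1 by (simp add: qw LIMSEQ_const_iff)
  qed
  have "(\<lambda>j. q (\<alpha> j) - herm (q (\<alpha> j)) w *s w) \<longlonglongrightarrow> w - 1 *s w"
    by (intro tendsto_intros \<alpha>w lim1)
  then have r0: "(\<lambda>j. q (\<alpha> j) - herm (q (\<alpha> j)) w *s w) \<longlonglongrightarrow> 0" by simp
  have req: "q i - herm (q i) w *s w = (1 / of_real (norm (b i))) *s (\<rho> (D\<Lambda> i) *v u)" for i
  proof -
    have "q i = (1 / of_real (norm (b i))) *s ((a * \<theta> (D\<Lambda> i)) *s w + \<rho> (D\<Lambda> i) *v u)"
      unfolding q using bu[of i] by simp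
    then show ?thesis unfolding qw by (simp add: vector_add_ldistrib)
  qed
  have "(\<lambda>j. norm (q (\<alpha> j) - herm (q (\<alpha> j)) w *s w) / norm (herm (q (\<alpha> j)) w) * norm a) \<longlonglongrightarrow> norm (0 :: complex^'m) / norm (1::complex) * norm a"
    by (intro tendsto_intros r0 lim1) simp
  moreover have "norm (q i - herm (q i) w *s w) / norm (herm (q i) w) * norm a
      = norm (\<rho> (D\<Lambda> i) *v u) / norm (\<rho> (D\<Lambda> i) *v w)" for i
  proof -
    have n: "norm (q i - herm (q i) w *s w) = norm (\<rho> (D\<Lambda> i) *v u) / norm (b i)"
      unfolding req by (simp add: norm_divide)
    show ?thesis unfolding n unfolding qw \<theta>[OF D]
      using b0[of i] a0 by (simp add: norm_mult norm_divide w1)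
  qed
  ultimately have ratio: "(\<lambda>j. norm (\<rho> (D\<Lambda> (\<alpha> j)) *v u) / norm (\<rho> (D\<Lambda> (\<alpha> j)) *v w)) \<longlonglongrightarrow> 0" by simp
  have "\<exists>\<phi>. algebraic_1ps \<phi> (G_cent \<Lambda>) \<and>
      limitin proj_top (\<lambda>t. act (\<rho> (\<phi> t)) (vec.span {a *s w + u})) (vec.span {w}) (at 0)"
    by (rule degeneration_to_fixed_line[OF \<Lambda> w0 _ _ ratio a0]) (use \<theta> D in auto)
  then have deg: "\<exists>\<phi>. algebraic_1ps \<phi> (G_cent \<Lambda>) \<and>
      limitin proj_top (\<lambda>t. act (\<rho> (\<phi> t)) (vec.span {vt})) (vec.span {w}) (at 0)"
    unfolding vtu[symmetric] .
  \<comment> \<open>limit lines other than that of \<open>w\<close> are orthogonal to it\<close>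
  have dichotomy: "norm (herm w' w) \<in> {0, 1}"
    if \<beta>: "strict_mono (\<beta> :: nat \<Rightarrow> nat)" "norm w' = 1" "(\<lambda>j. q (\<beta> j)) \<longlonglongrightarrow> w'" for \<beta> w'
  proof (cases "herm w w' = 0")
    case True
    then show ?thesis using cnj_herm[of w w'] by simp
  next
    case False
    define c where "c = herm w' w"
    define x where "x = w' - c *s w"
    have xw: "herm w x = 0" "herm x w = 0"
      using cnj_herm[of x w] by (simp_all add: x_def herm_diff c_def ww cnj_herm)
    have \<theta>x: "\<rho> h *v x = \<theta> h *s x" if h: "h \<in> G_cent \<Lambda>" for h
      using same_char[OF fixed[OF \<beta>] \<beta>(2) False h] \<theta>[OF h]
      by (simp add: x_def matrix_vector_mult_diff_distrib smult_mv vec_eq_iff algebra_simps)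
    have qx: "herm (q i) x * a = herm (q i) w * herm vt x" for i
    proof -
      have "herm (b i) x = \<theta> (D\<Lambda> i) * herm vt x"
        unfolding b_def move[OF D] \<theta>x[OF adjG(1)[OF D]] by (simp add: \<theta>adj[OF D])
      then show ?thesis unfolding qw by (simp add: q mult_ac)
    qed
    have "(\<lambda>j. herm (q (\<alpha> j)) x * a) \<longlonglongrightarrow> herm w x * a" by (intro tendsto_intros \<alpha>w)
    moreover have "(\<lambda>j. herm (q (\<alpha> j)) x * a) \<longlonglongrightarrow> 1 * herm vt x" unfolding qx by (intro tendsto_intros lim1)
    ultimately have "herm vt x = 0" using LIMSEQ_unique xw(1) by fastforce
    then have "herm (q i) x = 0" for i using qx[of i] a0 by simp
    moreover have "(\<lambda>j. herm (q (\<beta> j)) x) \<longlonglongrightarrow> herm w' x" by (intro tendsto_intros \<beta>(3))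
    ultimately have "herm w' x = 0" by (simp add: LIMSEQ_const_iff)
    then have "herm (x + c *s w) x = 0" by (simp add: x_def)
    then have "x = 0" by (simp add: herm_add xw)
    then have "w' = c *s w" by (simp add: x_def)
    then have "norm c = 1" using \<beta>(2) w1 by simp
    then show ?thesis by (simp add: c_def)
  qed
  have HG: "H \<in> GLC" using H by (simp add: G_cent_iff)
  have "(\<lambda>i. norm (herm (q i) w)) \<longlonglongrightarrow> 1"
  proof (rule two_limit_points_no_jump[OF _ \<alpha>])
    show "(\<lambda>j. norm (herm (q (\<alpha> j)) w)) \<longlonglongrightarrow> 1" using tendsto_norm[OF lim1] by simp
    fix \<beta> :: "nat \<Rightarrow> nat" assume \<beta>: "strict_mono \<beta>"
    obtain \<gamma> w' where \<gamma>: "strict_mono (\<gamma> :: nat \<Rightarrow> nat)" and w': "norm w' = 1" and lim: "(\<lambda>j. q (\<beta> (\<gamma> j))) \<longlonglongrightarrow> w'"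
      using sphere_sub[of \<beta>] by blast
    have \<beta>\<gamma>: "strict_mono (\<lambda>j. \<beta> (\<gamma> j))" using \<beta> \<gamma> by (simp add: strict_mono_def)
    obtain c where c: "\<rho> H *v w' = c *s w'" using fixed[OF \<beta>\<gamma> w' lim H] by blast
    have w'0: "w' \<noteq> 0" using w' by auto
    have c0: "c \<noteq> 0" using c rho_nz[OF HG w'0] by auto
    define G where "G i = D\<Lambda> (Suc i) ** matrix_inv (D\<Lambda> i)" for i
    have GG: "G i \<in> GLC" for i unfolding G_def using DG by (intro GLC_mult GLC_matrix_inv)
    have bS: "b (Suc i) = \<rho> (G i) *v b i" for i
    proof -
      have "D\<Lambda> (Suc i) = G i ** D\<Lambda> i" unfolding G_def by (simp add: GLC_cancel DG)
      then show ?thesis unfolding b_def by (simp add: rho_mult GG DG matrix_vector_mul_assoc)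
    qed
    have Glim: "(\<lambda>j. G (\<beta> (\<gamma> j))) \<longlonglongrightarrow> H"
      using LIMSEQ_subseq_LIMSEQ[OF step \<beta>\<gamma>] by (simp add: o_def G_def)
    have "(\<lambda>j. norm (herm (\<rho> (G (\<beta> (\<gamma> j))) *v q (\<beta> (\<gamma> j))) w) / norm (\<rho> (G (\<beta> (\<gamma> j))) *v q (\<beta> (\<gamma> j)))) \<longlonglongrightarrow>
        norm (herm (\<rho> H *v w') w) / norm (\<rho> H *v w')"
      by (intro tendsto_intros tendsto_rho Glim HG lim) (use rho_nz[OF HG w'0] in simp)
    moreover have "norm (herm (\<rho> (G i) *v q i) w) / norm (\<rho> (G i) *v q i) = norm (herm (q (Suc i)) w)" for i
      using b0[of i] b0[of "Suc i"] by (simp add: q smult_mv bS[symmetric] norm_mult norm_divide)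
    moreover have "norm (herm (\<rho> H *v w') w) / norm (\<rho> H *v w') = norm (herm w' w)"
      using c0 w' by (simp add: c norm_mult)
    ultimately have "(\<lambda>j. norm (herm (q (Suc (\<beta> (\<gamma> j)))) w)) \<longlonglongrightarrow> norm (herm w' w)" by simp
    moreover have "(\<lambda>j. norm (herm (q (\<beta> (\<gamma> j))) w)) \<longlonglongrightarrow> norm (herm w' w)" by (intro tendsto_intros lim)
    ultimately show "\<exists>\<gamma> c. strict_mono (\<gamma> :: nat \<Rightarrow> nat) \<and> c \<in> {0, 1} \<and>
      (\<lambda>j. norm (herm (q (\<beta> (\<gamma> j))) w)) \<longlonglongrightarrow> c \<and> (\<lambda>j. norm (herm (q (Suc (\<beta> (\<gamma> j)))) w)) \<longlonglongrightarrow> c"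
      using \<gamma> dichotomy[OF \<beta>\<gamma> w' lim] by blast
  qed
  then show ?thesis using w1 \<theta> deg by blast
qed

text \<open>In a basis of weight vectors (the columns of \<open>adj B\<close>), the operator \<open>\<rho> (exp \<Lambda>)\<close> is diagonal with entries
  \<open>exp (\<omega> j)\<close>, and the operators \<open>\<rho> (D\<Lambda> i)\<close> preserve the blocks of equal \<open>\<omega>\<close>. The vector \<open>vt\<close> is the part of
  \<open>v'\<close> in the block of the largest value \<open>\<omega>0\<close> of \<open>\<omega>\<close> that occurs in \<open>v'\<close>. The orbit of \<open>v'\<close> under the \<open>D\<Lambda> i\<close>
  aligns with some block, and it grows at least as fast as that of \<open>vt\<close>, which grows with rate \<open>\<omega>0\<close>. So
  it aligns with the block of \<open>\<omega>0\<close>.\<close>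

lemma dominant_component:
  fixes V :: "complex^'n^'n" and l :: "'n \<Rightarrow> real"
  assumes V: "V \<in> unitary_group" and D: "\<And>i. D\<Lambda> i \<in> G_cent (V ** dg (\<lambda>a. of_real (l a)) ** adj V)"
    and step: "(\<lambda>i. D\<Lambda> (Suc i) ** matrix_inv (D\<Lambda> i)) \<longlonglongrightarrow> V ** dg (\<lambda>a. of_real (exp (l a))) ** adj V"
    and v': "v' \<noteq> 0"
  shows "\<exists>vt. vt \<noteq> 0 \<and>
    limitin proj_top (\<lambda>t::real. vec.span {\<rho> (V ** dg (\<lambda>a. of_real (exp (t * l a))) ** adj V) *v v'}) (vec.span {vt}) at_top \<and>
    (\<lambda>i. norm (\<rho> (D\<Lambda> i) *v (v' - vt)) / norm (\<rho> (D\<Lambda> i) *v vt)) \<longlonglongrightarrow> 0"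
proof -
  have DG: "D\<Lambda> i \<in> GLC" for i using D by (simp add: G_cent_iff)
  have VG: "V \<in> GLC" "adj V \<in> GLC" using V by (auto intro: unitary_GLC unitary_adj)
  define B where "B = adj W ** \<rho> (adj V)"
  have BU: "B \<in> unitary_group" unfolding B_def
    by (intro unitary_mult unitary_adj W_unitary unitary V)
  have adjB: "adj B = \<rho> V ** W" unfolding B_def by (simp add: adj_mult rho_adj_unitary[OF V])
  define \<omega> where "\<omega> j = (\<Sum>a\<in>UNIV. l a * of_int (wt j a))" for j
  have T: "\<rho> (dg (\<lambda>a. of_real (exp (t * l a)))) = W ** dg (\<lambda>j. of_real (exp (t * \<omega> j))) ** adj W" for t :: real
  proof -
    have "(\<Sum>a\<in>UNIV. complex_of_real (t * l a) * of_int (wt j a)) = of_real (t * \<omega> j)" for j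
      by (simp add: \<omega>_def sum_distrib_left mult.assoc)
    then show ?thesis using rho_dg_exp[of "\<lambda>a. of_real (t * l a)"] by (simp only: exp_of_real)
  qed
  have TG: "dg (\<lambda>a. complex_of_real (exp (t * l a))) \<in> GLC" for t by (rule GLC_dg) simp
  have TV: "\<rho> (V ** dg (\<lambda>a. of_real (exp (t * l a))) ** adj V) = adj B ** dg (\<lambda>j. of_real (exp (t * \<omega> j))) ** B" for t :: real
    unfolding adjB using VG TG by (simp add: rho_mult GLC_mult T B_def matrix_mul_assoc)
  define z' where "z' = B *v v'"
  have z'0: "z' \<noteq> 0" unfolding z'_def using GLC_mv_eq_0[OF unitary_GLC[OF BU]] v' by blast
  define J where "J = {j. z' $ j \<noteq> 0}"
  have J: "finite (\<omega> ` J)" "\<omega> ` J \<noteq> {}" using z'0 by (auto simp: J_def vec_eq_iff)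
  define \<omega>0 where "\<omega>0 = Max (\<omega> ` J)"
  obtain j0 where j0: "z' $ j0 \<noteq> 0" "\<omega> j0 = \<omega>0" using Max_in[OF J] by (auto simp: \<omega>0_def J_def)
  have le: "\<omega> j \<le> \<omega>0" if "z' $ j \<noteq> 0" for j unfolding \<omega>0_def by (rule Max_ge[OF J(1)]) (use that in \<open>auto simp: J_def\<close>)
  define A where "A = {j. \<omega> j = \<omega>0}"
  define vt where "vt = adj B *v restr A z'"
  have Bvt: "B *v vt = restr A z'" by (simp add: vt_def unitary_cancel[OF BU])
  have rA0: "restr A z' \<noteq> 0"
  proof
    assume "restr A z' = 0"
    then have "restr A z' $ j0 = 0" by simp
    then show False using j0 by (simp add: A_def)
  qed
  have vt0: "vt \<noteq> 0" using Bvt rA0 by auto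
  have "((\<lambda>t::real. of_real (exp (t * (\<omega> j - \<omega>0))) * z' $ j) \<longlongrightarrow> restr A z' $ j) at_top" for j
  proof (cases "z' $ j = 0 \<or> \<omega> j = \<omega>0")
    case True
    then show ?thesis by (auto simp: A_def)
  next
    case False
    then have neg: "\<omega> j - \<omega>0 < 0" using le[of j] by force
    have "filterlim (\<lambda>t::real. (\<omega> j - \<omega>0) * t) at_bot at_top"
      by (rule filterlim_tendsto_neg_mult_at_bot[OF tendsto_const neg filterlim_ident])
    from filterlim_compose[OF exp_at_bot this]
    have "((\<lambda>t. of_real (exp (t * (\<omega> j - \<omega>0))) * z' $ j) \<longlongrightarrow> of_real 0 * z' $ j) at_top"
      by (intro tendsto_intros) (simp add: mult.commute)
    then show ?thesis using False by (simp add: A_def)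
  qed
  then have "((\<lambda>t::real. dg (\<lambda>j. of_real (exp (t * (\<omega> j - \<omega>0)))) *v z') \<longlongrightarrow> restr A z') at_top"
    by (intro vec_tendstoI) simp
  then have "((\<lambda>t::real. adj B *v (dg (\<lambda>j. of_real (exp (t * (\<omega> j - \<omega>0)))) *v z')) \<longlongrightarrow> vt) at_top"
    unfolding vt_def by (rule tendsto_mv[OF tendsto_const])
  moreover have "adj B *v (dg (\<lambda>j. of_real (exp (t * (\<omega> j - \<omega>0)))) *v z') =
      of_real (exp (- (t * \<omega>0))) *s (\<rho> (V ** dg (\<lambda>a. of_real (exp (t * l a))) ** adj V) *v v')" for t :: real
  proof -
    have "dg (\<lambda>j. of_real (exp (t * (\<omega> j - \<omega>0)))) *v z' = of_real (exp (- (t * \<omega>0))) *s (dg (\<lambda>j. of_real (exp (t * \<omega> j))) *v z')"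
    proof -
      have "exp (t * (\<omega> j - \<omega>0)) = exp (- (t * \<omega>0)) * exp (t * \<omega> j)" for j
        by (simp add: exp_add[symmetric] algebra_simps)
      then show ?thesis by (simp add: vec_eq_iff)
    qed
    then show ?thesis by (simp add: smult_mv TV z'_def flip: matrix_vector_mul_assoc)
  qed
  ultimately have "((\<lambda>t::real. of_real (exp (- (t * \<omega>0))) *s (\<rho> (V ** dg (\<lambda>a. of_real (exp (t * l a))) ** adj V) *v v')) \<longlongrightarrow> vt) at_top"
    by simp
  from limitin_span_tendsto[OF this vt0]
  have lim_vt: "limitin proj_top (\<lambda>t::real. vec.span {\<rho> (V ** dg (\<lambda>a. of_real (exp (t * l a))) ** adj V) *v v'}) (vec.span {vt}) at_top"
    by (simp add: span_eqI)
  define N where "N i = B ** \<rho> (D\<Lambda> i) ** adj B" for i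
  have NG: "N i \<in> GLC" for i unfolding N_def
    by (intro GLC_mult rho_GLC DG unitary_GLC unitary_adj BU)
  have Nblock: "\<omega> a = \<omega> b" if nz: "N i $ a $ b \<noteq> 0" for i a b
  proof -
    define M where "M = adj V ** D\<Lambda> i ** V"
    have MG: "M \<in> GLC" unfolding M_def by (intro GLC_mult DG VG)
    have "M \<in> G_cent (dg (\<lambda>a. of_real (l a)))" unfolding M_def G_cent_conj(1)[OF V, symmetric] by (rule D)
    then have "M \<in> G_cent (dg (\<lambda>a. of_real (exp (1 * l a))))" unfolding G_cent_dg by auto
    then have "M ** dg (\<lambda>a. of_real (exp (1 * l a))) = dg (\<lambda>a. of_real (exp (1 * l a))) ** M" by (simp only: G_cent_iff)
    then have "\<rho> M ** \<rho> (dg (\<lambda>a. of_real (exp (1 * l a)))) = \<rho> (dg (\<lambda>a. of_real (exp (1 * l a)))) ** \<rho> M"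
      using MG TG by (simp only: rho_mult[symmetric])
    then have "\<rho> M ** (W ** dg (\<lambda>j. of_real (exp (1 * \<omega> j))) ** adj W) = (W ** dg (\<lambda>j. of_real (exp (1 * \<omega> j))) ** adj W) ** \<rho> M"
      by (simp only: T)
    then have "adj W ** (\<rho> M ** (W ** dg (\<lambda>j. of_real (exp (1 * \<omega> j))) ** adj W)) ** W = adj W ** ((W ** dg (\<lambda>j. of_real (exp (1 * \<omega> j))) ** adj W) ** \<rho> M) ** W"
      by (simp only:)
    then have c: "(adj W ** \<rho> M ** W) ** dg (\<lambda>j. of_real (exp (\<omega> j))) = dg (\<lambda>j. of_real (exp (\<omega> j))) ** (adj W ** \<rho> M ** W)"
      by (simp add: matrix_mul_assoc unitary_cancel[OF W_unitary] unitaryD[OF W_unitary])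
    have "adj W ** \<rho> M ** W = N i"
      unfolding M_def N_def adjB unfolding B_def using VG DG by (simp add: rho_mult GLC_mult matrix_mul_assoc)
    then have "(N i ** dg (\<lambda>j. of_real (exp (\<omega> j)))) $ a $ b = (dg (\<lambda>j. of_real (exp (\<omega> j))) ** N i) $ a $ b"
      using c by simp
    then have "N i $ a $ b * of_real (exp (\<omega> b)) = of_real (exp (\<omega> a)) * N i $ a $ b"
      by (simp only: mult_dg_nth dg_mult_nth)
    then have "complex_of_real (exp (\<omega> b)) = of_real (exp (\<omega> a))" using nz by simp
    then show ?thesis by (simp only: of_real_eq_iff exp_inj_iff)
  qed
  have restrN: "restr {j. \<omega> j = c} (N i *v x) = N i *v restr {j. \<omega> j = c} x"
    "restr {j. \<omega> j \<noteq> c} (N i *v x) = N i *v restr {j. \<omega> j \<noteq> c} x" for i c x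
  proof -
    have "(if P (\<omega> a) then (\<Sum>b\<in>UNIV. N i $ a $ b * x $ b) else 0) = (\<Sum>b\<in>UNIV. N i $ a $ b * (if P (\<omega> b) then x $ b else 0))" for P a
    proof (cases "P (\<omega> a)")
      case True
      have "N i $ a $ b * x $ b = N i $ a $ b * (if P (\<omega> b) then x $ b else 0)" for b
        using Nblock[of i a b] True by (cases "N i $ a $ b = 0") auto
      then have "(\<Sum>b\<in>UNIV. N i $ a $ b * x $ b) = (\<Sum>b\<in>UNIV. N i $ a $ b * (if P (\<omega> b) then x $ b else 0))"
        by (intro sum.cong refl)
      then show ?thesis by (simp only: True if_True)
    next
      case False
      have "N i $ a $ b * (if P (\<omega> b) then x $ b else 0) = 0" for b
        using Nblock[of i a b] False by (cases "N i $ a $ b = 0") auto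
      then have "(\<Sum>b\<in>UNIV. N i $ a $ b * (if P (\<omega> b) then x $ b else 0)) = 0" by (intro sum.neutral ballI)
      then show ?thesis by (simp only: False if_False)
    qed
    note key = this
    have mv: "(N i *v y) $ a = (\<Sum>b\<in>UNIV. N i $ a $ b * y $ b)" for y a by (simp add: matrix_vector_mult_def)
    show "restr {j. \<omega> j = c} (N i *v x) = N i *v restr {j. \<omega> j = c} x"
      unfolding vec_eq_iff restr_nth mv mem_Collect_eq using key[of "\<lambda>y. y = c"] by blast
    show "restr {j. \<omega> j \<noteq> c} (N i *v x) = N i *v restr {j. \<omega> j \<noteq> c} x"
      unfolding vec_eq_iff restr_nth mv mem_Collect_eq using key[of "\<lambda>y. y \<noteq> c"] by blast
  qed
  define F where "F i = N (Suc i) ** matrix_inv (N i)" for i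
  have F: "F \<longlonglongrightarrow> dg (\<lambda>j. of_real (exp (\<omega> j)))"
  proof -
    have Feq: "F i = B ** \<rho> (D\<Lambda> (Suc i) ** matrix_inv (D\<Lambda> i)) ** adj B" for i
    proof -
      have "matrix_inv (N i) = B ** \<rho> (matrix_inv (D\<Lambda> i)) ** adj B"
      proof (rule GLC_inv_unique)
        have "N i ** (B ** \<rho> (matrix_inv (D\<Lambda> i)) ** adj B) = B ** (\<rho> (D\<Lambda> i) ** \<rho> (matrix_inv (D\<Lambda> i))) ** adj B"
          by (simp add: N_def matrix_mul_assoc unitary_cancel[OF BU])
        also have "\<rho> (D\<Lambda> i) ** \<rho> (matrix_inv (D\<Lambda> i)) = mat 1"
          unfolding rho_inv[OF DG] by (rule GLC_inv(1)[OF rho_GLC[OF DG]])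
        finally show "N i ** (B ** \<rho> (matrix_inv (D\<Lambda> i)) ** adj B) = mat 1" by (simp add: unitaryD[OF BU])
      qed
      then show ?thesis by (simp add: F_def N_def rho_mult DG GLC_matrix_inv matrix_mul_assoc unitary_cancel[OF BU])
    qed
    have "F = (\<lambda>i. B ** \<rho> (D\<Lambda> (Suc i) ** matrix_inv (D\<Lambda> i)) ** adj B)" using Feq by (rule ext)
    moreover have "(\<lambda>i. B ** \<rho> (D\<Lambda> (Suc i) ** matrix_inv (D\<Lambda> i)) ** adj B) \<longlonglongrightarrow> B ** \<rho> (V ** dg (\<lambda>a. of_real (exp (1 * l a))) ** adj V) ** adj B"
      by (rule tendsto_mm[OF tendsto_mm[OF tendsto_const tendsto_rho] tendsto_const])
         (use step in simp, intro GLC_mult VG TG)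
    moreover have "B ** \<rho> (V ** dg (\<lambda>a. of_real (exp (1 * l a))) ** adj V) ** adj B = dg (\<lambda>j. of_real (exp (\<omega> j)))"
      unfolding TV by (simp add: matrix_mul_assoc unitary_cancel[OF BU] unitaryD[OF BU])
    ultimately show ?thesis by (simp only:)
  qed
  have rec: "\<forall>i. N (Suc i) *v x = F i *v (N i *v x)" for x
    unfolding F_def by (simp add: matrix_vector_mul_assoc GLC_cancel NG)
  have nzN: "N i *v x \<noteq> 0" if "x \<noteq> 0" for i x using GLC_mv_eq_0[OF NG] that by blast
  obtain c where c: "\<forall>\<epsilon>>0. \<forall>\<^sub>F i in sequentially. norm (restr {j. \<omega> j \<noteq> c} (N i *v z')) \<le> \<epsilon> * norm (restr {j. \<omega> j = c} (N i *v z'))"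
    using alignment[OF F rec[of z'] nzN[OF z'0]] by blast
  have gz: "(\<lambda>i. ln (norm (N i *v z')) / real i) \<longlonglongrightarrow> c"
    by (rule growth_of_aligned[OF F rec nzN[OF z'0] c])
  have al_u: "\<forall>\<epsilon>>0. \<forall>\<^sub>F i in sequentially. norm (restr {j. \<omega> j \<noteq> \<omega>0} (N i *v restr A z')) \<le> \<epsilon> * norm (restr {j. \<omega> j = \<omega>0} (N i *v restr A z'))"
  proof -
    have "restr {j. \<omega> j \<noteq> \<omega>0} (restr A z') = 0" by (simp add: vec_eq_iff A_def)
    then have "restr {j. \<omega> j \<noteq> \<omega>0} (N i *v restr A z') = 0" for i by (simp only: restrN matrix_vector_mult_0_right)
    then show ?thesis by simp
  qed
  have gu: "(\<lambda>i. ln (norm (N i *v restr A z')) / real i) \<longlonglongrightarrow> \<omega>0"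
    by (rule growth_of_aligned[OF F rec nzN[OF rA0] al_u])
  have uz: "restr A (N i *v z') = N i *v restr A z'" for i unfolding A_def by (rule restrN)
  have "\<omega>0 \<le> c"
  proof (rule LIMSEQ_le[OF gu gz], intro exI allI impI)
    fix i :: nat
    have "norm (N i *v restr A z') \<le> norm (N i *v z')" unfolding uz[symmetric] by (rule norm_restr_le)
    then show "ln (norm (N i *v restr A z')) / real i \<le> ln (norm (N i *v z')) / real i"
      using nzN[OF rA0, of i] nzN[OF z'0, of i] by (intro divide_right_mono) simp_all
  qed
  moreover have "\<not> c > \<omega>0"
  proof
    assume gt: "c > \<omega>0"
    have "restr {j. \<omega> j = c} z' = 0" using le gt by (force simp: vec_eq_iff)
    then have z: "restr {j. \<omega> j = c} (N i *v z') = 0" for i by (simp only: restrN matrix_vector_mult_0_right)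
    have "\<forall>\<^sub>F i in sequentially. norm (restr {j. \<omega> j \<noteq> c} (N i *v z')) \<le> 1 * norm (restr {j. \<omega> j = c} (N i *v z'))"
      by (rule mp[OF spec[OF c, of 1] zero_less_one])
    then have "\<forall>\<^sub>F i in sequentially. False"
    proof eventually_elim
      case (elim i)
      have "- {j. \<omega> j = c} = {j. \<omega> j \<noteq> c}" by auto
      then have "norm (N i *v z') \<le> 0" using elim norm_le_restr[of "N i *v z'" "{j. \<omega> j = c}"] by (simp add: z)
      then show False using nzN[OF z'0, of i] by simp
    qed
    then show False by simp
  qed
  ultimately have c0: "c = \<omega>0" by simp
  have n1: "norm (restr {j. \<omega> j \<noteq> \<omega>0} (N i *v z')) = norm (\<rho> (D\<Lambda> i) *v (v' - vt))" for i
  proof -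
    have "restr {j. \<omega> j \<noteq> \<omega>0} z' = z' - restr A z'" by (simp add: vec_eq_iff A_def)
    also have "\<dots> = B *v (v' - vt)" by (simp add: matrix_vector_mult_diff_distrib Bvt z'_def)
    finally have "restr {j. \<omega> j \<noteq> \<omega>0} (N i *v z') = B *v (\<rho> (D\<Lambda> i) *v (v' - vt))"
      unfolding restrN by (simp add: N_def unitary_cancel[OF BU] flip: matrix_vector_mul_assoc)
    then show ?thesis by (simp add: BU)
  qed
  have n2: "norm (restr {j. \<omega> j = \<omega>0} (N i *v z')) = norm (\<rho> (D\<Lambda> i) *v vt)" for i
  proof -
    have "restr {j. \<omega> j = \<omega>0} (N i *v z') = B *v (\<rho> (D\<Lambda> i) *v vt)"
      using uz[of i] unfolding A_def[symmetric] Bvt[symmetric]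
      by (simp add: N_def unitary_cancel[OF BU] flip: matrix_vector_mul_assoc)
    then show ?thesis by (simp add: BU)
  qed
  have "(\<lambda>i. norm (\<rho> (D\<Lambda> i) *v (v' - vt)) / norm (\<rho> (D\<Lambda> i) *v vt)) \<longlonglongrightarrow> 0"
  proof (rule LIMSEQ_I)
    fix r :: real assume r: "r > 0"
    have "\<forall>\<^sub>F i in sequentially. norm (restr {j. \<omega> j \<noteq> c} (N i *v z')) \<le> r / 2 * norm (restr {j. \<omega> j = c} (N i *v z'))"
      by (rule mp[OF spec[OF c, of "r / 2"] half_gt_zero[OF r]])
    then have "\<forall>\<^sub>F i in sequentially. norm (norm (\<rho> (D\<Lambda> i) *v (v' - vt)) / norm (\<rho> (D\<Lambda> i) *v vt) - 0) < r"
      unfolding c0 n1 n2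
    proof eventually_elim
      case (elim i)
      have p: "norm (\<rho> (D\<Lambda> i) *v vt) > 0" using rho_nz[OF DG vt0] by simp
      then have "r / 2 * norm (\<rho> (D\<Lambda> i) *v vt) < r * norm (\<rho> (D\<Lambda> i) *v vt)" using r by simp
      then show ?case using elim p by (simp add: divide_less_eq)
    qed
    then show "\<exists>no. \<forall>i\<ge>no. norm (norm (\<rho> (D\<Lambda> i) *v (v' - vt)) / norm (\<rho> (D\<Lambda> i) *v vt) - 0) < r"
      by (simp add: eventually_sequentially)
  qed
  with vt0 lim_vt show ?thesis by blast
qed

end

section \<open>The asymptotic form of the sequence\<close>

text \<open>The \<open>U i\<close> need not converge, but unitary matrices are bounded.\<close>

lemma tendsto_unitary_conj_1:
  fixes X U :: "nat \<Rightarrow> complex^'n^'n"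
  assumes X: "X \<longlonglongrightarrow> mat 1" and U: "\<And>i. U i \<in> unitary_group"
  shows "(\<lambda>i. adj (U i) ** X i ** U i) \<longlonglongrightarrow> mat 1"
proof -
  obtain K where K: "K > 0" "\<And>(a :: complex^'n^'n) (b :: complex^'n^'n). norm (a ** b) \<le> norm a * norm b * K"
    using bounded_bilinear.pos_bounded[OF bounded_bilinear_mm] by auto
  obtain B where B: "B > 0" "\<And>M :: complex^'n^'n. M \<in> unitary_group \<Longrightarrow> norm M \<le> B"
    using compact_imp_bounded[OF compact_unitary] unfolding bounded_pos by blast
  have "norm (adj (U i) ** X i ** U i - mat 1) \<le> B * B * K * K * norm (X i - mat 1)" for i
  proof -
    have "adj (U i) ** (X i - mat 1) ** U i = adj (U i) ** X i ** U i - mat 1"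
      by (simp add: bounded_bilinear.diff_left[OF bounded_bilinear_mm]
          bounded_bilinear.diff_right[OF bounded_bilinear_mm] unitaryD[OF U])
    moreover have "norm (adj (U i) ** (X i - mat 1) ** U i) \<le> norm (adj (U i) ** (X i - mat 1)) * norm (U i) * K" by (rule K(2))
    moreover have "norm (adj (U i) ** (X i - mat 1)) * norm (U i) * K \<le> (B * norm (X i - mat 1) * K) * B * K"
    proof (intro mult_right_mono mult_mono)
      have "norm (adj (U i) ** (X i - mat 1)) \<le> norm (adj (U i)) * norm (X i - mat 1) * K" by (rule K(2))
      also have "\<dots> \<le> B * norm (X i - mat 1) * K"
        using K(1) B(2)[OF unitary_adj[OF U[of i]]] by (intro mult_right_mono) auto
      finally show "norm (adj (U i) ** (X i - mat 1)) \<le> B * norm (X i - mat 1) * K" .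
    qed (use K(1) B(1) B(2)[OF U] in auto)
    ultimately show ?thesis by (simp add: mult_ac)
  qed
  note bound = this
  have "(\<lambda>i. B * B * K * K * norm (X i - mat 1)) \<longlonglongrightarrow> B * B * K * K * norm (mat 1 - mat 1 :: complex^'n^'n)"
    by (intro tendsto_intros X)
  then have "(\<lambda>i. B * B * K * K * norm (X i - mat 1)) \<longlonglongrightarrow> 0" by simp
  from Lim_null_comparison[OF always_eventually[OF allI[OF bound]] this]
  have "(\<lambda>i. adj (U i) ** X i ** U i - mat 1) \<longlonglongrightarrow> 0" .
  then show ?thesis by (rule LIM_zero_cancel)
qed

lemma eigenspace_restr:
  assumes V: "V \<in> unitary_group" and \<Lambda>: "\<Lambda> = V ** dg (\<lambda>a. of_real (l a)) ** adj V"
    and x: "restr {a. l a = c} x = x"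
  shows "\<Lambda> *v (V *v x) = of_real c *s (V *v x)"
proof -
  have "x $ a = (if l a = c then x $ a else 0)" for a
    using arg_cong[OF x, of "\<lambda>y. y $ a"] by simp
  then have "of_real (l a) * x $ a = of_real c * x $ a" for a
    by (cases "l a = c") (metis mult_zero_right)+
  then have "dg (\<lambda>a. of_real (l a)) *v x = of_real c *s x" by (simp add: vec_eq_iff)
  then show ?thesis unfolding \<Lambda>
    by (simp add: unitary_cancel[OF V] smult_mv flip: matrix_vector_mul_assoc)
qed

lemma eigenvector_axis:
  assumes V: "V \<in> unitary_group" and \<Lambda>: "\<Lambda> = V ** dg (\<lambda>a. of_real (l a)) ** adj V"
  shows "\<Lambda> *v (V *v axis a 1) = of_real (l a) *s (V *v axis a 1)"
  by (rule eigenspace_restr[OF V \<Lambda>]) (auto simp: vec_eq_iff axis_def)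

text \<open>In an eigenbasis of \<open>\<Lambda>\<close> the matrices \<open>Q i = g\<^sub>i\<inverse> A\<^sub>i C0\<inverse>\<close> satisfy a recursion whose steps converge to
  \<open>exp \<Lambda>\<close>. An eigenvector of \<open>\<Lambda>\<close> for \<open>\<lambda>\<^sub>s\<close> is \<open>C0 w\<close> for some \<open>w\<close> in \<open>W\<^sub>s\<close>; the growth rate of the orbit of \<open>w\<close>
  is an eigenvalue, at most \<open>\<lambda>\<^sub>s\<close> and (for \<open>s < r\<close>) larger than \<open>\<lambda>\<^bsub>s+1\<^esub>\<close>, because \<open>w\<close> belongs to the \<open>s\<close>-th step of the
  filtration and not to the next. So it is \<open>\<lambda>\<^sub>s\<close>, which is the alignment required by
  \<open>block_diagonal_asymptotics\<close>.\<close>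

lemma asymptotic_factorization:
  fixes A g :: "nat \<Rightarrow> complex^'n^'n" and V :: "complex^'n^'n" and l :: "'n \<Rightarrow> real"
  assumes V: "V \<in> unitary_group" and \<Lambda>: "\<Lambda> = V ** dg (\<lambda>a. of_real (l a)) ** adj V"
    and A: "\<And>i. A i \<in> GLC" and g: "\<And>i. g i \<in> unitary_group"
    and g_lim: "(\<lambda>i. incr A i ** g i ** mexp (- \<Lambda>) ** matrix_inv (g i)) \<longlonglongrightarrow> mat 1"
    and g_step: "(\<lambda>i. matrix_inv (g (i - 1)) ** g i) \<longlonglongrightarrow> mat 1"
    and decreasing: "\<And>s t. 1 \<le> s \<Longrightarrow> s < t \<Longrightarrow> t \<le> r \<Longrightarrow> lam t < lam s"
    and eigenvalues: "{c. \<exists>u. u \<noteq> 0 \<and> \<Lambda> *v u = c *s u} = (\<lambda>s. complex_of_real (lam s)) ` {1..r}"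
    and W_sum: "\<And>s. s \<in> {1..r} \<Longrightarrow>
      filtration A r lam s = {w + u | w u. w \<in> W s \<and> u \<in> filtration A r lam (s + 1)}"
    and W_direct: "\<And>s. s \<in> {1..r} \<Longrightarrow> W s \<inter> filtration A r lam (s + 1) = {0}"
    and C0: "C0 \<in> GLC"
    and C0_W: "\<And>s. s \<in> {1..r} \<Longrightarrow> (\<lambda>w. C0 *v w) ` W s = eigenspace \<Lambda> (lam s)"
  obtains S D where "S \<longlonglongrightarrow> mat 1" "\<And>i. S i \<in> GLC" "\<And>i. D i \<in> G_cent \<Lambda>"
    "\<And>i. matrix_inv (g i) ** A i = S i ** D i ** C0"
    "(\<lambda>i. D (Suc i) ** matrix_inv (D i)) \<longlonglongrightarrow> V ** dg (\<lambda>a. of_real (exp (l a))) ** adj V"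
proof -
  have VG: "V \<in> GLC" "adj V \<in> GLC" using V by (auto intro: unitary_GLC unitary_adj)
  have gG: "g i \<in> GLC" for i using g by (rule unitary_GLC)
  define H where "H = V ** dg (\<lambda>a. of_real (exp (l a))) ** adj V"
  define H' where "H' = mexp (- \<Lambda>)"
  have H'H: "H' ** H = mat 1"
  proof -
    have "dg (\<lambda>a. complex_of_real (- l a)) = - dg (\<lambda>a. complex_of_real (l a))" by (simp add: vec_eq_iff dg_nth)
    then have "- \<Lambda> = V ** dg (\<lambda>a. of_real (- l a)) ** adj V"
      unfolding \<Lambda> by (simp only: bounded_bilinear.minus_left[OF bounded_bilinear_mm] bounded_bilinear.minus_right[OF bounded_bilinear_mm])
    then have "H' = V ** dg (\<lambda>a. of_real (exp (- l a))) ** adj V"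
      unfolding H'_def using mexp_conj_dg[OF unitaryD(2)[OF V], of "\<lambda>a. of_real (- l a)"] by (simp only: exp_of_real)
    then have "H' ** H = V ** (dg (\<lambda>a. of_real (exp (- l a))) ** dg (\<lambda>a. of_real (exp (l a)))) ** adj V"
      by (simp only: H_def matrix_mul_assoc unitary_cancel[OF V])
    also have "dg (\<lambda>a. complex_of_real (exp (- l a))) ** dg (\<lambda>a. of_real (exp (l a))) = mat 1"
      by (simp flip: of_real_mult exp_add)
    finally show ?thesis by (simp add: unitaryD[OF V])
  qed
  define M where "M i = matrix_inv (g i) ** A i" for i
  have M: "M i = adj (g i) ** A i" for i by (simp add: M_def unitary_inv[OF g])
  have MG: "M i \<in> GLC" for i unfolding M by (intro GLC_mult A unitary_GLC unitary_adj g)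
  define E where "E i = M (Suc i) ** matrix_inv (M i)" for i
  have EM: "E i ** M i = M (Suc i)" for i by (simp add: E_def GLC_cancel MG)
  define R where "R i = incr A i ** g i ** H' ** adj (g i)" for i
  have E: "E i = (adj (g (Suc i)) ** R (Suc i) ** g (Suc i)) ** H ** adj (adj (g i) ** g (Suc i))" for i
  proof -
    have "E i = adj (g (Suc i)) ** A (Suc i) ** matrix_inv (A i) ** g i"
      unfolding E_def M by (simp add: matrix_inv_mult A unitary_GLC[OF unitary_adj[OF g]] unitary_inv[OF unitary_adj[OF g]] matrix_mul_assoc)
    moreover have "(adj (g (Suc i)) ** R (Suc i) ** g (Suc i)) ** H ** adj (adj (g i) ** g (Suc i)) =
        adj (g (Suc i)) ** incr A (Suc i) ** g (Suc i) ** (H' ** H) ** adj (g (Suc i)) ** g i"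
      by (simp add: R_def adj_mult matrix_mul_assoc unitary_cancel[OF g])
    ultimately show ?thesis unfolding H'H by (simp add: incr_def matrix_mul_assoc unitary_cancel[OF g])
  qed
  have Elim: "E \<longlonglongrightarrow> H"
  proof -
    have "R \<longlonglongrightarrow> mat 1" using g_lim by (simp add: R_def[abs_def] H'_def unitary_inv[OF g])
    from LIMSEQ_Suc[OF tendsto_unitary_conj_1[OF this g]]
    have "(\<lambda>i. adj (g (Suc i)) ** R (Suc i) ** g (Suc i)) \<longlonglongrightarrow> mat 1" .
    moreover have "(\<lambda>i. adj (g i) ** g (Suc i)) \<longlonglongrightarrow> mat 1" using LIMSEQ_Suc[OF g_step] by (simp add: unitary_inv[OF g])
    ultimately have "(\<lambda>i. (adj (g (Suc i)) ** R (Suc i) ** g (Suc i)) ** H ** adj (adj (g i) ** g (Suc i))) \<longlonglongrightarrow> mat 1 ** H ** adj (mat 1)"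
      by (intro tendsto_intros)
    then show ?thesis by (simp add: E[abs_def])
  qed
  define Q where "Q i = adj V ** M i ** matrix_inv C0 ** V" for i
  define F where "F i = adj V ** E i ** V" for i
  have F: "F \<longlonglongrightarrow> dg (\<lambda>a. of_real (exp (l a)))"
  proof -
    have "F \<longlonglongrightarrow> adj V ** H ** V" unfolding F_def[abs_def] by (intro tendsto_intros Elim)
    then show ?thesis by (simp add: H_def matrix_mul_assoc unitary_cancel[OF V] unitaryD[OF V])
  qed
  have Q: "Q (Suc i) = F i ** Q i" for i
    by (simp add: Q_def F_def matrix_mul_assoc unitary_cancel[OF V] flip: EM)
  have QG: "Q i \<in> GLC" for i unfolding Q_def by (intro GLC_mult VG MG GLC_matrix_inv C0)
  have eigenvalue: "\<exists>s\<in>{1..r}. c = lam s" if u: "u \<noteq> 0" "\<Lambda> *v u = complex_of_real c *s u" for c u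
  proof -
    have "complex_of_real c \<in> (\<lambda>s. complex_of_real (lam s)) ` {1..r}" unfolding eigenvalues[symmetric] using u by blast
    then show ?thesis by auto
  qed
  have al: "\<forall>\<^sub>F i in sequentially. norm (restr {a. l a \<noteq> c} (Q i *v x)) \<le> \<epsilon> * norm (restr {a. l a = c} (Q i *v x))"
    if x: "x \<noteq> 0" "restr {a. l a = c} x = x" and \<epsilon>: "\<epsilon> > 0" for c x and \<epsilon> :: real
  proof -
    have rec: "\<forall>i. Q (Suc i) *v x = F i *v (Q i *v x)" by (simp add: Q matrix_vector_mul_assoc)
    have nz: "Q i *v x \<noteq> 0" for i using GLC_mv_eq_0[OF QG] x(1) by blast
    obtain a where c': "\<forall>\<epsilon>>0. \<forall>\<^sub>F i in sequentially.
        norm (restr {b. l b \<noteq> l a} (Q i *v x)) \<le> \<epsilon> * norm (restr {b. l b = l a} (Q i *v x))"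
      using alignment[OF F rec nz] by blast
    define y where "y = V *v x"
    have y: "y \<noteq> 0" "\<Lambda> *v y = of_real c *s y"
      unfolding y_def using GLC_mv_eq_0[OF VG(1)] x(1) eigenspace_restr[OF V \<Lambda> x(2)] by blast+
    obtain s where s: "s \<in> {1..r}" "c = lam s" using eigenvalue[OF y] by blast
    have "y \<in> (\<lambda>w. C0 *v w) ` W s" unfolding C0_W[OF s(1)] eigenspace_def using y(2) s(2) by simp
    then obtain w where w: "w \<in> W s" "y = C0 *v w" by blast
    have w0: "w \<noteq> 0" using y(1) w(2) by auto
    have "norm (Q i *v x) = norm (A i *v w)" for i
    proof -
      have "Q i *v x = adj V *v (adj (g i) *v (A i *v w))"
        unfolding Q_def M matrix_vector_mul_assoc[symmetric] y_def[symmetric] w(2) GLC_cancel[OF C0] ..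
      then show ?thesis using V g by (simp add: unitary_adj)
    qed
    then have "(\<lambda>i. ln (norm (A i *v w)) / real i) \<longlonglongrightarrow> l a"
      using growth_of_aligned[OF F rec nz c'] by simp
    then have "(\<lambda>i. ereal (ln (norm (A i *v w)) / real i)) \<longlonglongrightarrow> ereal (l a)" by (rule tendsto_ereal)
    then have growth: "growth (\<lambda>M. M) A w = ereal (l a)" using w0 by (simp add: growth_def limI)
    have "V *v axis a 1 \<noteq> 0" using GLC_mv_eq_0[OF VG(1), of "axis a 1"] by (simp add: axis_eq_0_iff)
    from eigenvalue[OF this eigenvector_axis[OF V \<Lambda>]] obtain s' where s': "s' \<in> {1..r}" "l a = lam s'" by blast
    have "0 \<in> filtration A r lam (s + 1)" using W_direct[OF s(1)] by blast
    then have "w + 0 \<in> filtration A r lam s" unfolding W_sum[OF s(1)] using w(1) by blast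
    then have le: "lam s' \<le> lam s" using s(1) s'(2) by (simp add: filtration_def growth)
    have "w \<notin> filtration A r lam (s + 1)" using W_direct[OF s(1)] w(1) w0 by blast
    then have gt: "s + 1 \<le> r \<Longrightarrow> lam (s + 1) < lam s'" using s'(2) by (simp add: filtration_def growth)
    have "\<not> s' < s" using decreasing[of s' s] le s(1) s'(1) by auto
    moreover have "\<not> s < s'"
    proof
      assume "s < s'"
      then have "s + 1 \<le> r" "s + 1 = s' \<or> s + 1 < s'" using s'(1) by auto
      then show False using gt decreasing[of "s + 1" s'] s'(1) by auto
    qed
    ultimately have "s' = s" by simp
    then have "l a = c" using s(2) s'(2) by simp
    then show ?thesis using mp[OF spec[OF c', of \<epsilon>] \<epsilon>] by simp
  qed
  obtain L where L: "\<And>i. L i \<in> G_cent (dg (\<lambda>a. of_real (l a)))" "(\<lambda>i. Q i ** matrix_inv (L i)) \<longlonglongrightarrow> mat 1"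
    using block_diagonal_asymptotics[OF F Q QG al] by blast
  have LG: "L i \<in> GLC" for i using L(1) by (simp add: G_cent_iff)
  define D where "D i = V ** L i ** adj V" for i
  have D: "D i \<in> G_cent \<Lambda>" for i
    unfolding \<Lambda> G_cent_conj(1)[OF V] using L(1) by (simp add: D_def matrix_mul_assoc unitary_cancel[OF V] unitaryD[OF V])
  have DG: "D i \<in> GLC" for i using D by (simp add: G_cent_iff)
  have Dinv: "matrix_inv (D i) = V ** matrix_inv (L i) ** adj V" for i
  proof (rule GLC_inv_unique)
    have "D i ** (V ** matrix_inv (L i) ** adj V) = V ** (L i ** matrix_inv (L i)) ** adj V"
      by (simp add: D_def matrix_mul_assoc unitary_cancel[OF V])
    then show "D i ** (V ** matrix_inv (L i) ** adj V) = mat 1" by (simp add: GLC_inv LG unitaryD[OF V])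
  qed
  define S where "S i = M i ** matrix_inv C0 ** matrix_inv (D i)" for i
  have SG: "S i \<in> GLC" for i unfolding S_def by (intro GLC_mult MG GLC_matrix_inv C0 DG)
  have "S = (\<lambda>i. V ** (Q i ** matrix_inv (L i)) ** adj V)"
    by (rule ext) (simp add: S_def Dinv Q_def matrix_mul_assoc unitaryD[OF V])
  moreover have "(\<lambda>i. V ** (Q i ** matrix_inv (L i)) ** adj V) \<longlonglongrightarrow> V ** mat 1 ** adj V" by (intro tendsto_intros L(2))
  ultimately have Slim: "S \<longlonglongrightarrow> mat 1" by (simp add: unitaryD[OF V])
  have SD: "S i ** D i = M i ** matrix_inv C0" for i by (simp add: S_def GLC_cancel DG)
  have fac: "matrix_inv (g i) ** A i = S i ** D i ** C0" for i
    by (simp add: SD GLC_cancel[OF C0] flip: M_def)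
  have step: "D (Suc i) ** matrix_inv (D i) = matrix_inv (S (Suc i)) ** E i ** S i" for i
  proof -
    have "S (Suc i) ** D (Suc i) = E i ** (S i ** D i)" unfolding SD by (simp add: matrix_mul_assoc EM)
    then have "matrix_inv (S (Suc i)) ** (S (Suc i) ** D (Suc i)) = matrix_inv (S (Suc i)) ** (E i ** (S i ** D i))" by (simp only:)
    then have "D (Suc i) = matrix_inv (S (Suc i)) ** (E i ** (S i ** D i))" by (simp only: GLC_cancel[OF SG])
    then have "D (Suc i) ** matrix_inv (D i) = matrix_inv (S (Suc i)) ** (E i ** (S i ** D i)) ** matrix_inv (D i)" by (simp only:)
    then show ?thesis by (simp only: matrix_mul_assoc GLC_cancel[OF DG])
  qed
  have "(\<lambda>i. matrix_inv (S (Suc i)) ** E i ** S i) \<longlonglongrightarrow> mat 1 ** H ** mat 1"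
    by (intro tendsto_intros LIMSEQ_Suc[OF tendsto_matrix_inv_1[OF Slim]] Elim Slim)
  then have "(\<lambda>i. D (Suc i) ** matrix_inv (D i)) \<longlonglongrightarrow> H" by (simp add: step)
  with that[OF Slim SG D fac] show thesis unfolding H_def by blast
qed

text \<open>Both \<open>\<Lambda>\<close> and \<open>C0 \<xi> C0\<inverse>\<close> act on the eigenspace \<open>C0 W\<^sub>s\<close> as \<open>\<lambda>\<^sub>s\<close>.\<close>

lemma one_parameter_group_conj:
  fixes V \<xi> C0 :: "complex^'n^'n" and l :: "'n \<Rightarrow> real"
  assumes V: "V \<in> unitary_group" and \<Lambda>: "\<Lambda> = V ** dg (\<lambda>a. of_real (l a)) ** adj V"
    and eigenvalues: "{c. \<exists>u. u \<noteq> 0 \<and> \<Lambda> *v u = c *s u} = (\<lambda>s. complex_of_real (lam s)) ` {1..r}"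
    and xi: "\<And>s w. s \<in> {1..r} \<Longrightarrow> w \<in> W s \<Longrightarrow> \<xi> *v w = complex_of_real (lam s) *s w"
    and C0: "C0 \<in> GLC"
    and C0_W: "\<And>s. s \<in> {1..r} \<Longrightarrow> (\<lambda>w. C0 *v w) ` W s = eigenspace \<Lambda> (lam s)"
  shows "C0 ** mexp (t *\<^sub>R \<xi>) = V ** dg (\<lambda>a. of_real (exp (t * l a))) ** adj V ** C0"
proof -
  define S where "S = matrix_inv C0 ** V"
  define S' where "S' = adj V ** C0"
  have SS': "S ** S' = mat 1"
    by (simp add: S_def S'_def matrix_mul_assoc unitary_cancel[OF V] GLC_inv C0)
  have "\<xi> *v (S *v axis a 1) = of_real (l a) *s (S *v axis a 1)" for a
  proof -
    define y where "y = V *v axis a 1"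
    have y: "y \<noteq> 0" "\<Lambda> *v y = of_real (l a) *s y"
      unfolding y_def using GLC_mv_eq_0[OF unitary_GLC[OF V], of "axis a 1"] eigenvector_axis[OF V \<Lambda>] by (simp_all add: axis_eq_0_iff)
    have "complex_of_real (l a) \<in> (\<lambda>s. complex_of_real (lam s)) ` {1..r}" unfolding eigenvalues[symmetric] using y by blast
    then obtain s where s: "s \<in> {1..r}" "l a = lam s" by auto
    have "y \<in> (\<lambda>w. C0 *v w) ` W s" unfolding C0_W[OF s(1)] eigenspace_def using y(2) s(2) by simp
    then obtain w where w: "w \<in> W s" "y = C0 *v w" by blast
    have "S *v axis a 1 = w" unfolding S_def matrix_vector_mul_assoc[symmetric] y_def[symmetric] w(2) by (rule GLC_cancel[OF C0])
    then show ?thesis using xi[OF s(1) w(1)] s(2) by simp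
  qed
  note ax = this
  have "(\<xi> ** S) $ i $ j = (S ** dg (\<lambda>a. of_real (l a))) $ i $ j" for i j
  proof -
    have "(\<xi> ** S) $ i $ j = (\<xi> *v (S *v axis j 1)) $ i" by (simp add: mv_axis matrix_vector_mul_assoc)
    also have "\<dots> = of_real (l j) * S $ i $ j" by (simp add: ax mv_axis)
    finally show ?thesis by (simp add: mult_dg_nth mult.commute)
  qed
  then have "\<xi> ** S = S ** dg (\<lambda>a. of_real (l a))" by (subst vec_eq_iff)+ blast
  then have "\<xi> ** (S ** S') = S ** dg (\<lambda>a. of_real (l a)) ** S'" by (simp add: matrix_mul_assoc)
  then have \<xi>: "\<xi> = S ** dg (\<lambda>a. of_real (l a)) ** S'" by (simp add: SS')
  have "(t *\<^sub>R dg (\<lambda>a. complex_of_real (l a))) $ i $ j = dg (\<lambda>a. of_real (t * l a)) $ i $ j" for i j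
    by (simp only: vector_scaleR_component dg_nth) (simp add: scaleR_conv_of_real)
  then have "t *\<^sub>R dg (\<lambda>a. complex_of_real (l a)) = dg (\<lambda>a. of_real (t * l a))" by (subst vec_eq_iff)+ blast
  moreover have "t *\<^sub>R \<xi> = S ** (t *\<^sub>R dg (\<lambda>a. of_real (l a))) ** S'"
    by (simp only: \<xi> bounded_bilinear.scaleR_left[OF bounded_bilinear_mm] bounded_bilinear.scaleR_right[OF bounded_bilinear_mm])
  ultimately have "t *\<^sub>R \<xi> = S ** dg (\<lambda>a. of_real (t * l a)) ** S'" by (simp only:)
  then have "mexp (t *\<^sub>R \<xi>) = S ** dg (\<lambda>a. of_real (exp (t * l a))) ** S'"
    using mexp_conj_dg[OF SS', of "\<lambda>a. of_real (t * l a)"] by (simp only: exp_of_real)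
  then show ?thesis by (simp add: S_def S'_def matrix_mul_assoc GLC_inv C0)
qed

section \<open>The limit set of a point with Property (R)\<close>

theorem theorem2p12:
  fixes A g :: "nat \<Rightarrow> complex^'n::{finite,linorder}^'n::{finite,linorder}"
    and \<Lambda> \<xi> C0 :: "complex^'n::{finite,linorder}^'n::{finite,linorder}"
    and \<rho> :: "complex^'n::{finite,linorder}^'n::{finite,linorder} \<Rightarrow> complex^'m^'m"
    and v :: "complex^'m"
    and vbar :: "(complex^'m) set"
    and r :: nat
    and lam :: "nat \<Rightarrow> real"
    and W :: "nat \<Rightarrow> (complex^'n::{finite,linorder}) set"
  assumes A_0: "A 0 = mat 1"
    and A_GL: "\<And>i. A i \<in> GLC"
    and Lambda: "hermitian \<Lambda>"
    and star: "cond_star A \<Lambda>"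
    and g_K: "\<And>i. g i \<in> unitary_group"
    and g_0: "g 0 = mat 1"
    and g_lim: "(\<lambda>i. incr A i ** g i ** mexp (- \<Lambda>) ** matrix_inv (g i)) \<longlonglongrightarrow> mat 1"
    and g_step: "(\<lambda>i. matrix_inv (g (i - 1)) ** g i) \<longlonglongrightarrow> mat 1"
    and rep: "complex_rep \<rho>"
    and rep_unitary: "\<And>k. k \<in> unitary_group \<Longrightarrow> \<rho> k \<in> unitary_group"
    and lam_decreasing: "\<And>s t. 1 \<le> s \<Longrightarrow> s < t \<Longrightarrow> t \<le> r \<Longrightarrow> lam t < lam s"
    and lam_eigenvalues:
      "{c. \<exists>u. u \<noteq> 0 \<and> \<Lambda> *v u = c *s u} = (\<lambda>s. complex_of_real (lam s)) ` {1..r}"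
    and W_subspace: "\<And>s. s \<in> {1..r} \<Longrightarrow> vec.subspace (W s)"
    and W_sum: "\<And>s. s \<in> {1..r} \<Longrightarrow>
      filtration A r lam s = {w + u | w u. w \<in> W s \<and> u \<in> filtration A r lam (s + 1)}"
    and W_direct: "\<And>s. s \<in> {1..r} \<Longrightarrow> W s \<inter> filtration A r lam (s + 1) = {0}"
    and W_Lim: "\<And>s. s \<in> {1..r} \<Longrightarrow>
      Lim_set exterior_rep \<Lambda> A g (plucker (W s)) = {plucker (eigenspace \<Lambda> (lam s))}"
    and xi: "\<And>s w. s \<in> {1..r} \<Longrightarrow> w \<in> W s \<Longrightarrow> \<xi> *v w = complex_of_real (lam s) *s w"
    and C0_GL: "C0 \<in> GLC"
    and C0_W: "\<And>s. s \<in> {1..r} \<Longrightarrow> (\<lambda>w. C0 *v w) ` W s = eigenspace \<Lambda> (lam s)"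
    and v_nz: "v \<noteq> 0"
    and R: "property_R \<rho> \<Lambda> A g v"
    and vbar_def: "vbar =
      proj_lim (\<lambda>t::real. act (\<rho> (C0 ** mexp (t *\<^sub>R \<xi>))) (vec.span {v})) at_top"
  shows "\<exists>vinf \<in> proj_space.
      Lim_set \<rho> \<Lambda> A g (vec.span {v}) = proj_orbit \<rho> (K_cent \<Lambda>) vinf \<and>
      (\<forall>P \<in> proj_space.
         Lim_set \<rho> \<Lambda> A g (vec.span {v}) = proj_orbit \<rho> (K_cent \<Lambda>) P \<longrightarrow> P = vinf) \<and>
      (\<exists>\<phi>. algebraic_1ps \<phi> (G_cent \<Lambda>) \<and>
         limitin proj_top (\<lambda>t. act (\<rho> (\<phi> t)) vbar) vinf (at 0))"
proof -
  interpret rep: unitary_rep \<rho> by unfold_locales (use rep rep_unitary in blast)+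
  obtain V where V: "V \<in> unitary_group" and
    diag: "\<And>H. H \<in> {\<Lambda>} \<Longrightarrow> \<exists>d :: 'n \<Rightarrow> real. H = V ** dg (\<lambda>a. of_real (d a)) ** adj V"
    by (rule simultaneous_diagonalization[of "{\<Lambda>}"]) (use Lambda in auto)
  obtain l :: "'n \<Rightarrow> real" where \<Lambda>: "\<Lambda> = V ** dg (\<lambda>a. of_real (l a)) ** adj V"
    using diag by blast
  obtain S D where S: "S \<longlonglongrightarrow> mat 1" "\<And>i. S i \<in> GLC" and D: "\<And>i. D i \<in> G_cent \<Lambda>"
    and fac: "\<And>i. matrix_inv (g i) ** A i = S i ** D i ** C0"
    and step: "(\<lambda>i. D (Suc i) ** matrix_inv (D i)) \<longlonglongrightarrow> V ** dg (\<lambda>a. of_real (exp (l a))) ** adj V"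
    by (rule asymptotic_factorization[OF V \<Lambda> A_GL g_K g_lim g_step lam_decreasing lam_eigenvalues W_sum W_direct C0_GL C0_W]) blast+
  have DG: "D i \<in> GLC" for i using D by (simp add: G_cent_iff)
  \<comment> \<open>\<open>vt\<close> is the component of \<open>v'\<close> that spans the line of \<open>vbar\<close>\<close>
  define v' where "v' = \<rho> C0 *v v"
  have v'0: "v' \<noteq> 0" unfolding v'_def by (rule rep.rho_nz[OF C0_GL v_nz])
  obtain vt where vt: "vt \<noteq> 0"
    and lim_vt: "limitin proj_top (\<lambda>t::real. vec.span {\<rho> (V ** dg (\<lambda>a. of_real (exp (t * l a))) ** adj V) *v v'}) (vec.span {vt}) at_top"
    and small: "(\<lambda>i. norm (\<rho> (D i) *v (v' - vt)) / norm (\<rho> (D i) *v vt)) \<longlonglongrightarrow> 0"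
    using rep.dominant_component[OF V D[unfolded \<Lambda>] step v'0] by blast
  have TG: "V ** dg (\<lambda>a. complex_of_real (exp (t * l a))) ** adj V \<in> G_cent \<Lambda>" for t
    by (rule conj_dg_in_G_cent[OF V \<Lambda>]) simp
  then have TGLC: "V ** dg (\<lambda>a. complex_of_real (exp (t * l a))) ** adj V \<in> GLC" for t by (simp add: G_cent_iff)
  have vbar: "vbar = vec.span {vt}"
  proof -
    have conj: "C0 ** mexp (t *\<^sub>R \<xi>) = V ** dg (\<lambda>a. of_real (exp (t * l a))) ** adj V ** C0" for t
      by (rule one_parameter_group_conj[where W = W, OF V \<Lambda> lam_eigenvalues _ C0_GL]) (use xi C0_W in blast)+
    have "act (\<rho> (C0 ** mexp (t *\<^sub>R \<xi>))) (vec.span {v}) = vec.span {\<rho> (V ** dg (\<lambda>a. of_real (exp (t * l a))) ** adj V) *v v'}" for t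
      unfolding conj act_span v'_def
      by (simp add: rep.rho_mult[OF TGLC C0_GL] matrix_vector_mul_assoc)
    then show ?thesis unfolding vbar_def
      using proj_lim_span[OF _ _ lim_vt] rep.rho_nz[OF TGLC v'0] by simp
  qed
  \<comment> \<open>the same factor normalises both sequences, so that \<open>p - q\<close> tends to \<open>0\<close>\<close>
  define q where "q i = (1 / of_real (norm (\<rho> (D i) *v vt))) *s (\<rho> (D i) *v vt)" for i
  define p where "p i = (1 / of_real (norm (\<rho> (D i) *v vt))) *s (\<rho> (matrix_inv (g i) ** A i) *v v)" for i
  have n0: "norm (\<rho> (D i) *v vt) \<noteq> 0" for i using rep.rho_nz[OF DG vt] by simp
  have q1: "norm (q i) = 1" for i unfolding q_def using n0[of i] by (simp add: norm_divide)
  have MG: "matrix_inv (g i) ** A i \<in> GLC" for i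
    by (intro GLC_mult GLC_matrix_inv A_GL unitary_GLC g_K)
  have p0: "p i \<noteq> 0" for i
    unfolding p_def using rep.rho_nz[OF MG v_nz, of i] n0[of i] by (simp add: vector_mul_eq_0)
  have act_p: "act (\<rho> (matrix_inv (g i) ** A i)) (vec.span {v}) = vec.span {p i}" for i
    unfolding p_def act_span using n0[of i] by (intro span_eqI[symmetric]) simp
  have pq: "(\<lambda>i. p i - q i) \<longlonglongrightarrow> 0"
  proof -
    define x where "x i = (1 / of_real (norm (\<rho> (D i) *v vt))) *s (\<rho> (D i) *v (v' - vt))" for i
    have "norm (x i) = norm (\<rho> (D i) *v (v' - vt)) / norm (\<rho> (D i) *v vt)" for i by (simp add: x_def norm_divide)
    then have x: "x \<longlonglongrightarrow> 0" using small by (intro tendsto_norm_zero_cancel[of x]) simp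
    have "p i = \<rho> (S i) *v (q i + x i)" for i
    proof -
      have "\<rho> (matrix_inv (g i) ** A i) *v v = \<rho> (S i) *v (\<rho> (D i) *v v')"
        unfolding fac v'_def by (simp add: rep.rho_mult S(2) DG C0_GL GLC_mult matrix_vector_mul_assoc matrix_mul_assoc)
      moreover have "q i + x i = (1 / of_real (norm (\<rho> (D i) *v vt))) *s (\<rho> (D i) *v v')"
        unfolding q_def x_def by (simp add: matrix_vector_mult_diff_distrib vector_add_ldistrib[symmetric])
      ultimately show ?thesis unfolding p_def by (simp add: smult_mv)
    qed
    then have eq: "p i - q i = (\<rho> (S i) - mat 1) *v q i + \<rho> (S i) *v x i" for i
      by (simp add: matrix_vector_right_distrib matrix_vector_mult_diff_rdistrib)
    have \<rho>S: "(\<lambda>i. \<rho> (S i)) \<longlonglongrightarrow> mat 1" using rep.tendsto_rho[OF S(1) GLC_mat1] by simp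
    obtain K where K: "K > 0" "\<And>(M :: complex^'m^'m) (v :: complex^'m). norm (M *v v) \<le> norm M * norm v * K"
      using bounded_bilinear.pos_bounded[OF bounded_bilinear_mv[where 'n='m and 'm='m]] by auto
    have "(\<lambda>i. norm (\<rho> (S i) - mat 1) * K) \<longlonglongrightarrow> norm (mat 1 - mat 1 :: complex^'m^'m) * K"
      by (intro tendsto_intros \<rho>S)
    then have null: "(\<lambda>i. norm (\<rho> (S i) - mat 1) * K) \<longlonglongrightarrow> 0" by simp
    have "norm ((\<rho> (S i) - mat 1) *v q i) \<le> norm (\<rho> (S i) - mat 1) * K" for i
      using K(2)[of "\<rho> (S i) - mat 1" "q i"] by (simp add: q1)
    from Lim_null_comparison[OF always_eventually[OF allI[OF this]] null]
    have "(\<lambda>i. (\<rho> (S i) - mat 1) *v q i) \<longlonglongrightarrow> 0" .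
    from tendsto_add[OF this tendsto_mv[OF \<rho>S x]] show ?thesis by (simp add: eq)
  qed
  \<comment> \<open>every limit line of \<open>q\<close> is one of \<open>p\<close>, so that Property (R) applies to it\<close>
  have RP: "reductive (proj_stab \<rho> (G_cent \<Lambda>) P)"
    "proj_orbit \<rho> (G_cent \<Lambda>) P = proj_orbit \<rho> (K_cent \<Lambda>) P"
    if "P \<in> Lim_set \<rho> \<Lambda> A g (vec.span {v})" for P
    using R that unfolding property_R_def by blast+
  have fixed: "\<exists>c. \<rho> h *v w = c *s w"
    if \<alpha>: "strict_mono (\<alpha> :: nat \<Rightarrow> nat)" "norm w = 1" "(\<lambda>j. q (\<alpha> j)) \<longlonglongrightarrow> w" and h: "h \<in> G_cent \<Lambda>" for \<alpha> w h
  proof -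
    have w0: "w \<noteq> 0" using \<alpha>(2) by auto
    have "(\<lambda>j. q (\<alpha> j) + (p (\<alpha> j) - q (\<alpha> j))) \<longlonglongrightarrow> w + 0"
      using LIMSEQ_subseq_LIMSEQ[OF pq \<alpha>(1)] by (intro tendsto_add \<alpha>(3)) (simp add: o_def)
    then have "(\<lambda>j. p (\<alpha> j)) \<longlonglongrightarrow> w" by simp
    from limitin_span_tendsto[OF this w0]
    have "limitin proj_top (\<lambda>j. act (\<rho> (matrix_inv (g (\<alpha> j)) ** A (\<alpha> j))) (vec.span {v})) (vec.span {w}) sequentially"
      unfolding act_p .
    then have in_Lim: "act (\<rho> k) (vec.span {w}) \<in> Lim_set \<rho> \<Lambda> A g (vec.span {v})" if "k \<in> K_cent \<Lambda>" for k
      unfolding Lim_set_def proj_orbit_def using \<alpha>(1) that by blast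
    have "act (\<rho> (mat 1)) (vec.span {w}) = vec.span {w}" by (simp add: act_span)
    then have "vec.span {w} \<in> Lim_set \<rho> \<Lambda> A g (vec.span {v})" using in_Lim[OF K_cent_mat1] by (simp only:)
    note orb = RP(2)[OF this]
    show ?thesis
    proof (rule rep.reductive_compact_orbit_fixed[OF Lambda w0 _ _ h])
      fix h assume "h \<in> G_cent \<Lambda>"
      then have "act (\<rho> h) (vec.span {w}) \<in> proj_orbit \<rho> (K_cent \<Lambda>) (vec.span {w})"
        unfolding orb[symmetric] unfolding proj_orbit_def by (rule imageI)
      then show "\<exists>k\<in>K_cent \<Lambda>. vec.span {\<rho> h *v w} = vec.span {\<rho> k *v w}"
        by (simp only: proj_orbit_def act_span image_iff)
    next
      fix k assume "k \<in> K_cent \<Lambda>"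
      from RP(1)[OF in_Lim[OF this]] show "reductive (proj_stab \<rho> (G_cent \<Lambda>) (vec.span {\<rho> k *v w}))"
        by (simp only: act_span)
    qed
  qed
  have HG: "V ** dg (\<lambda>a. complex_of_real (exp (l a))) ** adj V \<in> G_cent \<Lambda>" using TG[of 1] by simp
  have "\<exists>w. norm w = 1 \<and> (\<forall>h\<in>G_cent \<Lambda>. \<exists>c. \<rho> h *v w = c *s w) \<and> (\<lambda>i. norm (herm (q i) w)) \<longlonglongrightarrow> 1 \<and>
    (\<exists>\<phi>. algebraic_1ps \<phi> (G_cent \<Lambda>) \<and>
      limitin proj_top (\<lambda>t. act (\<rho> (\<phi> t)) (vec.span {vt})) (vec.span {w}) (at 0))"
    by (rule rep.unique_limit_line[OF Lambda D step HG vt q_def]) (rule fixed)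
  then obtain w where w: "norm w = 1" and wfix: "\<And>h. h \<in> G_cent \<Lambda> \<Longrightarrow> \<exists>c. \<rho> h *v w = c *s w"
    and lim_w: "(\<lambda>i. norm (herm (q i) w)) \<longlonglongrightarrow> 1"
    and deg: "\<exists>\<phi>. algebraic_1ps \<phi> (G_cent \<Lambda>) \<and>
      limitin proj_top (\<lambda>t. act (\<rho> (\<phi> t)) (vec.span {vt})) (vec.span {w}) (at 0)"
    by blast
  have w0: "w \<noteq> 0" using w by auto
  have cos: "(\<lambda>i. cosang (p i) w) \<longlonglongrightarrow> 1"
  proof -
    have "(\<lambda>i. norm (herm (p i) w) - norm (herm (q i) w)) \<longlonglongrightarrow> 0"
    proof (rule Lim_null_comparison[OF always_eventually])
      show "\<forall>i. norm (norm (herm (p i) w) - norm (herm (q i) w)) \<le> norm (herm (p i - q i) w)"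
        unfolding herm_diff real_norm_def by (intro allI norm_triangle_ineq3)
      have "(\<lambda>i. norm (herm (p i - q i) w)) \<longlonglongrightarrow> norm (herm 0 w)" by (intro tendsto_intros pq)
      then show "(\<lambda>i. norm (herm (p i - q i) w)) \<longlonglongrightarrow> 0" by simp
    qed
    from tendsto_add[OF this lim_w] have 1: "(\<lambda>i. norm (herm (p i) w)) \<longlonglongrightarrow> 1" by simp
    have "(\<lambda>i. norm (p i) - norm (q i)) \<longlonglongrightarrow> 0"
      by (rule Lim_null_comparison[OF always_eventually tendsto_norm_zero[OF pq]])
         (use norm_triangle_ineq3 in auto)
    from tendsto_add[OF this tendsto_const[of 1]] have 2: "(\<lambda>i. norm (p i)) \<longlonglongrightarrow> 1" by (simp add: q1)
    have "(\<lambda>i. norm (herm (p i) w) / (norm (p i) * norm w)) \<longlonglongrightarrow> 1 / (1 * norm w)"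
      by (intro tendsto_intros 1 2) (simp add: w)
    then show ?thesis by (simp add: cosang_def w)
  qed
  have limP: "limitin proj_top (\<lambda>j. act (\<rho> (matrix_inv (g (\<alpha> j)) ** A (\<alpha> j))) (vec.span {v})) P sequentially \<longleftrightarrow> P = vec.span {w}"
    if \<alpha>: "strict_mono (\<alpha> :: nat \<Rightarrow> nat)" for \<alpha> P
  proof -
    have nz: "\<forall>\<^sub>F j in sequentially. p (\<alpha> j) \<noteq> 0" using p0 by simp
    have "(\<lambda>j. cosang (p (\<alpha> j)) w) \<longlonglongrightarrow> 1" using LIMSEQ_subseq_LIMSEQ[OF cos \<alpha>] by (simp add: o_def)
    then have "limitin proj_top (\<lambda>j. vec.span {p (\<alpha> j)}) (vec.span {w}) sequentially"
      using limitin_span_iff[OF nz w0] by blast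
    then show ?thesis unfolding act_p using limitin_span_unique[OF nz sequentially_bot] by blast
  qed
  have "act (\<rho> k) (vec.span {w}) = vec.span {w}" if k: "k \<in> K_cent \<Lambda>" for k
  proof -
    have kG: "k \<in> G_cent \<Lambda>" "k \<in> GLC" using K_cent_subset_G_cent[OF k] by (simp_all add: G_cent_iff)
    obtain c where c: "\<rho> k *v w = c *s w" using wfix[OF kG(1)] by blast
    have "c \<noteq> 0" using rep.rho_nz[OF kG(2) w0] c by auto
    then show ?thesis unfolding act_span c by (rule span_eqI)
  qed
  then have "proj_orbit \<rho> (K_cent \<Lambda>) (vec.span {w}) = (\<lambda>k. vec.span {w}) ` K_cent \<Lambda>"
    unfolding proj_orbit_def by (rule image_cong[OF refl])
  then have orbit: "proj_orbit \<rho> (K_cent \<Lambda>) (vec.span {w}) = {vec.span {w}}"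
    by (simp only: image_constant[OF K_cent_mat1])
  have "strict_mono (\<lambda>i :: nat. i)" by (simp add: strict_mono_def)
  then have "{P. \<exists>\<alpha>. strict_mono \<alpha> \<and>
      limitin proj_top (\<lambda>j. act (\<rho> (matrix_inv (g (\<alpha> j)) ** A (\<alpha> j))) (vec.span {v})) P sequentially} = {vec.span {w}}"
    using limP by blast
  then have Lim: "Lim_set \<rho> \<Lambda> A g (vec.span {v}) = {vec.span {w}}"
    unfolding Lim_set_def by (simp add: orbit)
  have uniq: "P = vec.span {w}" if P: "P \<in> proj_space" "{vec.span {w}} = proj_orbit \<rho> (K_cent \<Lambda>) P" for P
  proof -
    obtain u where u: "P = vec.span {u}" using P(1) by (rule proj_spaceE)
    have "act (\<rho> (mat 1)) P \<in> proj_orbit \<rho> (K_cent \<Lambda>) P" unfolding proj_orbit_def using K_cent_mat1 by blast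
    then show ?thesis using P(2) by (auto simp: u act_span)
  qed
  show ?thesis
    unfolding Lim vbar
    by (intro bexI[of _ "vec.span {w}"] conjI ballI impI deg proj_space_span w0 orbit[symmetric] uniq)
qed

end
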